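(* Every finitely presentable group $G$ that is not free satisfies $\mathrm{SR}(G)\le \frac{16}{\pi}$.
   Context: All complexes are finite connected simplicial complexes. For a piecewise flat metric $\mathcal G$ on a complex $X$, $\mathrm{sys}(\mathcal G)$ is the least length of a noncontractible loop in $X$ and $\mathrm{SR}(\mathcal G)=\mathrm{sys}(\mathcal G)^2/\mathrm{area}(\mathcal G)$. The systolic ratio of $X$ is $\mathrm{SR}(X)=\sup_{\mathcal G}\mathrm{SR}(\mathcal G)$ over all piecewise flat metrics on $X$, and for a finitely presentable group $G$, $\mathrm{SR}(G)=\sup_X\mathrm{SR}(X)$ over all finite $2$-complexes $X$ with fundamental group isomorphic to $G$. *)

theory Defs
  imports "HOL-Analysis.Analysis" "HOL-Algebra.Algebra"
begin

definition simplicial_2complex :: "nat set set \<Rightarrow> bool" where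
  "simplicial_2complex K \<longleftrightarrow> finite K \<and> K \<noteq> {} \<and>
     (\<forall>\<sigma>\<in>K. \<sigma> \<noteq> {} \<and> finite \<sigma> \<and> card \<sigma> \<le> 3) \<and>
     (\<forall>\<sigma>\<in>K. \<forall>\<tau>. \<tau> \<noteq> {} \<and> \<tau> \<subseteq> \<sigma> \<longrightarrow> \<tau> \<in> K)"

definition bary_simplex :: "nat set \<Rightarrow> (nat \<Rightarrow> real) set" where
  "bary_simplex \<sigma> = {x. (\<forall>v. 0 \<le> x v) \<and> (\<forall>v. v \<notin> \<sigma> \<longrightarrow> x v = 0) \<and> sum x \<sigma> = 1}"

definition realization :: "nat set set \<Rightarrow> (nat \<Rightarrow> real) set" where
  "realization K = (\<Union>\<sigma>\<in>K. bary_simplex \<sigma>)"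

(* Piecewise flat metric: positive edge lengths, every 2-simplex a (nondegenerate)
   Euclidean triangle, i.e. strict triangle inequalities. *)
definition pf_metric :: "nat set set \<Rightarrow> (nat set \<Rightarrow> real) \<Rightarrow> bool" where
  "pf_metric K l \<longleftrightarrow>
     (\<forall>e\<in>K. card e = 2 \<longrightarrow> l e > 0) \<and>
     (\<forall>u v w. {u, v, w} \<in> K \<and> u \<noteq> v \<and> v \<noteq> w \<and> u \<noteq> w \<longrightarrow> l {u, v} < l {u, w} + l {w, v})"

definition edge_len :: "(nat set \<Rightarrow> real) \<Rightarrow> nat \<Rightarrow> nat \<Rightarrow> real" where
  "edge_len l u v = (if u = v then 0 else l {u, v})"

(* Euclidean distance between two points of a common simplex (Cayley-Menger form) *)
definition flat_dist :: "nat set set \<Rightarrow> (nat set \<Rightarrow> real) \<Rightarrow> (nat \<Rightarrow> real) \<Rightarrow> (nat \<Rightarrow> real) \<Rightarrow> real" where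
  "flat_dist K l x y = sqrt (- (1/2) * (\<Sum>u\<in>\<Union>K. \<Sum>v\<in>\<Union>K. (x u - y u) * (x v - y v) * (edge_len l u v)^2))"

definition chain_dist :: "nat set set \<Rightarrow> (nat set \<Rightarrow> real) \<Rightarrow> (nat \<Rightarrow> real) \<Rightarrow> (nat \<Rightarrow> real) \<Rightarrow> real" where
  "chain_dist K l x y = Inf {(\<Sum>i<k. flat_dist K l (p i) (p (Suc i))) | p k.
      p 0 = x \<and> p k = y \<and> (\<forall>i<k. \<exists>\<sigma>\<in>K. p i \<in> bary_simplex \<sigma> \<and> p (Suc i) \<in> bary_simplex \<sigma>)}"

definition partition_sums :: "nat set set \<Rightarrow> (nat set \<Rightarrow> real) \<Rightarrow> (real \<Rightarrow> nat \<Rightarrow> real) \<Rightarrow> real set" where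
  "partition_sums K l g = {(\<Sum>i<k. chain_dist K l (g (t i)) (g (t (Suc i)))) | t k.
      t 0 = 0 \<and> t k = 1 \<and> (\<forall>i<k. t i \<le> t (Suc i))}"

definition rectifiable_in :: "nat set set \<Rightarrow> (nat set \<Rightarrow> real) \<Rightarrow> (real \<Rightarrow> nat \<Rightarrow> real) \<Rightarrow> bool" where
  "rectifiable_in K l g \<longleftrightarrow> bdd_above (partition_sums K l g)"

definition path_length :: "nat set set \<Rightarrow> (nat set \<Rightarrow> real) \<Rightarrow> (real \<Rightarrow> nat \<Rightarrow> real) \<Rightarrow> real" where
  "path_length K l g = Sup (partition_sums K l g)"

(* sys: least length of a noncontractible loop (non-rectifiable loops have infinite length) *)
definition systole :: "nat set set \<Rightarrow> (nat set \<Rightarrow> real) \<Rightarrow> real" where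
  "systole K l = Inf {path_length K l g | g. path g \<and> path_image g \<subseteq> realization K \<and>
      pathfinish g = pathstart g \<and> rectifiable_in K l g \<and>
      \<not> homotopic_loops (realization K) g (\<lambda>_. pathstart g)}"

(* area of a triangle via Heron: 16 A^2 = (sum a^2)^2 - 2 sum a^4 *)
definition tri_area :: "(nat set \<Rightarrow> real) \<Rightarrow> nat set \<Rightarrow> real" where
  "tri_area l \<sigma> = sqrt ((\<Sum>e\<in>{e. e \<subseteq> \<sigma> \<and> card e = 2}. (l e)^2)^2
                          - 2 * (\<Sum>e\<in>{e. e \<subseteq> \<sigma> \<and> card e = 2}. (l e)^4)) / 4"

definition area :: "nat set set \<Rightarrow> (nat set \<Rightarrow> real) \<Rightarrow> real" where
  "area K l = (\<Sum>\<sigma>\<in>{\<sigma>\<in>K. card \<sigma> = 3}. tri_area l \<sigma>)"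

definition pi1 :: "'a::topological_space set \<Rightarrow> 'a \<Rightarrow> (real \<Rightarrow> 'a) set monoid" where
  "pi1 S a = \<lparr> carrier = {{q. homotopic_paths S p q} | p.
                   path p \<and> path_image p \<subseteq> S \<and> pathstart p = a \<and> pathfinish p = a},
               mult = (\<lambda>A B. {r. \<exists>p\<in>A. \<exists>q\<in>B. homotopic_paths S (p +++ q) r}),
               one = {q. homotopic_paths S (\<lambda>_. a) q} \<rparr>"

definition word_eval :: "('a, 'b) monoid_scheme \<Rightarrow> ('a \<times> bool) list \<Rightarrow> 'a" where
  "word_eval G w = foldr (\<lambda>(x, b) r. (if b then x else inv\<^bsub>G\<^esub> x) \<otimes>\<^bsub>G\<^esub> r) w \<one>\<^bsub>G\<^esub>"

definition reduced_word :: "('a \<times> bool) list \<Rightarrow> bool" where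
  "reduced_word w \<longleftrightarrow> (\<forall>i. Suc i < length w \<longrightarrow>
      \<not> (fst (w ! i) = fst (w ! Suc i) \<and> snd (w ! i) \<noteq> snd (w ! Suc i)))"

definition free_group :: "('a, 'b) monoid_scheme \<Rightarrow> bool" where
  "free_group G \<longleftrightarrow> group G \<and> (\<exists>Gs. Gs \<subseteq> carrier G \<and> generate G Gs = carrier G \<and>
      (\<forall>w. set (map fst w) \<subseteq> Gs \<and> w \<noteq> [] \<and> reduced_word w \<longrightarrow> word_eval G w \<noteq> \<one>\<^bsub>G\<^esub>))"

end

theory Submission
  imports Defs
begin

text \<open>
  The metric space is cut into finitely many small cells. Flat triangles are filled with bricks of
  size \<open>h \<times> 4h/5\<close>, laid so that the centres of touching bricks are at distance at most \<open>h\<close>; near the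
  1-skeleton much finer cells are used, of which there are only \<open>O(1/h)\<close>. A walk of \<open>k\<close> steps
  between touching cells is a path of length at most \<open>k h\<close>, so closed walks shorter than \<open>s/h\<close>, with
  \<open>s\<close> the systole, carry no holonomy. Let \<open>Z\<close> be a smallest set of cells whose complement carries no
  holonomy and let \<open>R\<close> be about \<open>s/(2h)\<close>. Exchanging the part of \<open>Z\<close> in a ball for the sphere around
  it does not make \<open>Z\<close> smaller, so if \<open>Z\<close> meets all spheres of radius \<open>1, \<dots>, R\<close> around one of its
  cells at least twice, the sphere of radius \<open>r\<close> has at least \<open>2r + 1\<close> cells and there are at least
  \<open>(R + 1)\<^sup>2\<close> cells. Hence if there are fewer, then around each cell of \<open>Z\<close> some sphere
  meets \<open>Z\<close> at most once, \<open>Z\<close> decomposes at cut vertices into pieces inside balls, and \<open>Z\<close> carries no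
  holonomy either. The fundamental group is then generated by the holonomies between \<open>Z\<close> and its
  complement, and it is free because triangles of mutually touching cells impose no relation but
  equalities between these generators. As there are about \<open>area/(4h\<^sup>2/5)\<close> cells,
  a group that is not free forces \<open>s\<^sup>2 \<le> 5 area\<close>, and \<open>5 < 16/\<pi>\<close>.
\<close>

section \<open>Free groups from edge cocycles\<close>

text \<open>For bricks of width h and height b the centres in neighbouring rows are sqrt(h^2/4 +
  b^2) apart, at most h exactly if b does not exceed h sqrt(3)/2 = 0.866... h. The ratio 4/5 is a
  simple rational number below this bound; the constant it produces, 4 / (4/5) = 5, is still below
  16/pi = 5.09... The factor 4 comes from (R + 1)^2, the sum of the odd numbers up to 2R + 1, which
  is about s^2/(4h^2).

  Equalities are the only relations because there are just two sides: of three mutually touching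
  cells two lie on the same side, the holonomy between these is trivial after a change of gauge, and
  the triangle identifies the other two. That no further relation holds is shown by an action:
  letters permute the reduced words, and transporting reduced words along loops makes the
  fundamental group act.

  The obstacle is the 1-skeleton, where several triangles meet and their brick patterns do not
  match. Cells there have diameter at most h/10, so that rough estimates suffice, and they fill a
  strip whose width is a fixed multiple of h, so that their number is negligible against
  1/h^2.\<close>

lemma (in group) mult_inv_cancel:
  assumes "x \<in> carrier G" "y \<in> carrier G" "z \<in> carrier G"
  shows "x \<otimes> inv y \<otimes> (y \<otimes> z) = x \<otimes> z"
proof -
  have "x \<otimes> inv y \<otimes> (y \<otimes> z) = x \<otimes> (inv y \<otimes> y) \<otimes> z"
    using assms by (simp only: m_assoc inv_closed m_closed)
  then show ?thesis using assms by simp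
qed

text \<open>A nonabelian 1-cocycle on the clique complex of a finite reflexive graph. The vertices
  will be cells, \<open>adj\<close> their touching, and \<open>t u v\<close> the class of a short
  path from \<open>u\<close> to \<open>v\<close>, closed up at a base point.\<close>

locale edge_cocycle = group G for G (structure) +
  fixes V :: "'v set" and adj :: "'v \<Rightarrow> 'v \<Rightarrow> bool" and t :: "'v \<Rightarrow> 'v \<Rightarrow> 'a"
  assumes finite_V: "finite V"
    and adj_V: "adj u v \<Longrightarrow> u \<in> V \<and> v \<in> V"
    and adj_refl: "u \<in> V \<Longrightarrow> adj u u"
    and adj_sym: "adj u v \<Longrightarrow> adj v u"
    and t_closed: "adj u v \<Longrightarrow> t u v \<in> carrier G"
    and t_cocycle: "adj u v \<Longrightarrow> adj v w \<Longrightarrow> adj u w \<Longrightarrow> t u v \<otimes> t v w = t u w"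
begin

text \<open>The number of steps is an index because only closed walks of bounded length are known to
  have trivial product. As \<open>t u u\<close> is the unit, a walk may pause without changing its
  product.\<close>

inductive walk_prod :: "nat \<Rightarrow> 'v \<Rightarrow> 'v \<Rightarrow> 'a \<Rightarrow> bool" where
  walk_prod_0: "u \<in> V \<Longrightarrow> walk_prod 0 u u \<one>"
| walk_prod_Suc: "walk_prod n u v g \<Longrightarrow> adj v w \<Longrightarrow> walk_prod (Suc n) u w (g \<otimes> t v w)"

lemma t_refl: assumes "u \<in> V" shows "t u u = \<one>"
proof -
  have "t u u \<otimes> t u u = t u u" using assms adj_refl t_cocycle by blast
  then show ?thesis using t_closed[OF adj_refl[OF assms]] l_cancel_one' by simp
qed

lemma t_inv: assumes "adj u v" shows "t v u = inv (t u v)"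
proof -
  have "t u v \<otimes> t v u = \<one>"
    using t_cocycle[OF assms adj_sym[OF assms]] adj_refl[of u] adj_V[OF assms] t_refl by simp
  then show ?thesis using t_closed[OF assms] t_closed[OF adj_sym[OF assms]] inv_equality inv_inv by metis
qed

lemma walk_prod_closed: "walk_prod n u v g \<Longrightarrow> g \<in> carrier G \<and> u \<in> V \<and> v \<in> V"
  by (induction rule: walk_prod.induct) (use t_closed adj_V in auto)

lemma walk_prod_edge: "adj u v \<Longrightarrow> walk_prod 1 u v (t u v)"
  using walk_prod_Suc[OF walk_prod_0, of u v] t_closed adj_V by auto

lemma walk_prod_trans:
  assumes "walk_prod m v w h" "walk_prod n u v g"
  shows "walk_prod (n + m) u w (g \<otimes> h)"
  using assms
proof (induction rule: walk_prod.induct)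
  case (walk_prod_0 v) then show ?case using walk_prod_closed by auto
next
  case (walk_prod_Suc m v w h x)
  have "walk_prod (Suc (n + m)) u x (g \<otimes> h \<otimes> t w x)"
    using walk_prod_Suc walk_prod.walk_prod_Suc by blast
  moreover have "g \<otimes> h \<otimes> t w x = g \<otimes> (h \<otimes> t w x)"
    using walk_prod_Suc walk_prod_closed t_closed m_assoc by blast
  ultimately show ?case by simp
qed

lemma walk_prod_sym: "walk_prod n u v g \<Longrightarrow> walk_prod n v u (inv g)"
proof (induction rule: walk_prod.induct)
  case (walk_prod_0 u) then show ?case using walk_prod.walk_prod_0 by simp
next
  case (walk_prod_Suc n u v g w)
  have "walk_prod (1 + n) w u (t w v \<otimes> inv g)"
    using walk_prod_trans[OF walk_prod_Suc.IH walk_prod_edge[OF adj_sym[OF walk_prod_Suc.hyps(2)]]] .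
  moreover have "t w v \<otimes> inv g = inv (g \<otimes> t v w)"
    using walk_prod_Suc walk_prod_closed t_closed t_inv by (simp add: inv_mult_group)
  ultimately show ?case by simp
qed

text \<open>\<open>f\<close> is a potential of the cocycle on \<open>W\<close>, so closed walks
  inside \<open>W\<close> have trivial product. Off \<open>W\<close> the values only have to lie in
  the group, which lets two potentials be compared at any point.\<close>

definition coboundary_on :: "'v set \<Rightarrow> bool" where
  "coboundary_on W \<longleftrightarrow> (\<exists>f. (\<forall>v. f v \<in> carrier G) \<and>
     (\<forall>u\<in>W. \<forall>v\<in>W. adj u v \<longrightarrow> f u \<otimes> t u v = f v))"

lemma coboundary_on_subset: "coboundary_on W \<Longrightarrow> W' \<subseteq> W \<Longrightarrow> coboundary_on W'"
  unfolding coboundary_on_def by blast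

text \<open>A potential may be multiplied on the left by a constant. One common vertex fixes the
  constant that matches the two potentials; two common vertices could demand different ones.\<close>

lemma coboundary_on_glue:
  assumes A: "coboundary_on A" and B: "coboundary_on B" and p: "A \<inter> B \<subseteq> {p}"
    and edges: "\<And>u v. u \<in> A \<union> B \<Longrightarrow> v \<in> A \<union> B \<Longrightarrow> adj u v \<Longrightarrow> u \<in> A \<and> v \<in> A \<or> u \<in> B \<and> v \<in> B"
  shows "coboundary_on (A \<union> B)"
proof -
  obtain f where f: "\<And>v. f v \<in> carrier G" "\<And>u v. u\<in>A \<Longrightarrow> v\<in>A \<Longrightarrow> adj u v \<Longrightarrow> f u \<otimes> t u v = f v"
    using A unfolding coboundary_on_def by blast
  obtain g where g: "\<And>v. g v \<in> carrier G" "\<And>u v. u\<in>B \<Longrightarrow> v\<in>B \<Longrightarrow> adj u v \<Longrightarrow> g u \<otimes> t u v = g v"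
    using B unfolding coboundary_on_def by blast
  \<comment> \<open>This makes \<open>c\<close> times \<open>g\<close> agree with \<open>f\<close>
    at \<open>p\<close>. If the sets are disjoint, any constant would do.\<close>
  define c where "c = f p \<otimes> inv (g p)"
  have c: "c \<in> carrier G" using f g by (simp add: c_def)
  define k where "k v = (if v \<in> A then f v else c \<otimes> g v)" for v
  have kB: "k v = c \<otimes> g v" if "v \<in> B" for v
  proof (cases "v \<in> A")
    case True
    then have "v = p" using p that by auto
    then show ?thesis using True f g by (simp add: k_def c_def m_assoc)
  qed (simp add: k_def)
  have "k u \<otimes> t u v = k v" if "u \<in> A \<union> B" "v \<in> A \<union> B" "adj u v" for u v
    using edges[OF that]
  proof
    assume "u \<in> A \<and> v \<in> A" then show ?thesis using f that by (simp add: k_def)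
  next
    assume uv: "u \<in> B \<and> v \<in> B"
    then have "c \<otimes> g u \<otimes> t u v = c \<otimes> g v"
      using g that c t_closed by (simp add: m_assoc)
    then show ?thesis using kB uv by simp
  qed
  moreover have "k v \<in> carrier G" for v using f g c by (simp add: k_def)
  ultimately show ?thesis unfolding coboundary_on_def by blast
qed

section \<open>Balls, spheres and a smallest separating set\<close>

primrec ball_in :: "'v \<Rightarrow> nat \<Rightarrow> 'v set" where
  "ball_in x 0 = {x}"
| "ball_in x (Suc n) = {v. \<exists>u\<in>ball_in x n. adj u v}"

text \<open>Truncated subtraction makes the sphere of radius 0 empty. Only positive radii are used;
  the centre is counted apart.\<close>

definition sphere_in :: "'v \<Rightarrow> nat \<Rightarrow> 'v set" where
  "sphere_in x r = ball_in x r - ball_in x (r - 1)"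

lemma ball_in_V: "x \<in> V \<Longrightarrow> ball_in x n \<subseteq> V"
  by (induction n) (use adj_V in auto)

lemma ball_in_Suc: "x \<in> V \<Longrightarrow> ball_in x n \<subseteq> ball_in x (Suc n)"
  using ball_in_V[of x n] adj_refl by auto

lemma ball_in_mono: "x \<in> V \<Longrightarrow> m \<le> n \<Longrightarrow> ball_in x m \<subseteq> ball_in x n"
  using lift_Suc_mono_le[of "ball_in x"] ball_in_Suc by blast

lemma ball_in_walk: "x \<in> V \<Longrightarrow> v \<in> ball_in x n \<Longrightarrow> \<exists>g. walk_prod n x v g"
proof (induction n arbitrary: v)
  case 0 then show ?case using walk_prod_0 by auto
next
  case (Suc n)
  then obtain u where "u \<in> ball_in x n" "adj u v" by auto
  then show ?case using Suc walk_prod_Suc by blast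
qed

lemma ball_in_adj: "x \<in> V \<Longrightarrow> 1 \<le> r \<Longrightarrow> u \<in> ball_in x (r - 1) \<Longrightarrow> adj u v \<Longrightarrow> v \<in> ball_in x r"
  by (cases r) auto

text \<open>The product of any walk of \<open>R\<close> steps from the centre is a potential: going
  out to \<open>u\<close>, across an edge to \<open>v\<close> and back is a closed walk of
  \<open>2 * R + 1\<close> steps. By pausing, every point of the ball is reached in exactly
  \<open>R\<close> steps.\<close>

lemma coboundary_on_ball:
  assumes x: "x \<in> V"
    and short: "\<forall>n u g. n \<le> 2 * R + 1 \<longrightarrow> walk_prod n u u g \<longrightarrow> g = \<one>"
  shows "coboundary_on (ball_in x R)"
proof -
  define f where "f v = (if v \<in> ball_in x R then SOME g. walk_prod R x v g else \<one>)" for v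
  have f: "walk_prod R x v (f v)" if "v \<in> ball_in x R" for v
    using someI_ex[OF ball_in_walk[OF x that]] that by (simp add: f_def)
  have fc: "f v \<in> carrier G" for v
  proof (cases "v \<in> ball_in x R")
    case True then show ?thesis using f walk_prod_closed by blast
  qed (simp add: f_def)
  have "f u \<otimes> t u v = f v" if "u \<in> ball_in x R" "v \<in> ball_in x R" "adj u v" for u v
  proof -
    have "walk_prod (Suc R) x v (f u \<otimes> t u v)" using f that walk_prod_Suc by blast
    from walk_prod_trans[OF walk_prod_sym[OF f[OF that(2)]] this]
    have "f u \<otimes> t u v \<otimes> inv (f v) = \<one>" using short[rule_format, of "Suc R + R"] by auto
    then show ?thesis using fc[of u] fc[of v] t_closed[OF that(3)]
      inv_equality[of "f u \<otimes> t u v" "inv (f v)"] by simp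
  qed
  then show ?thesis unfolding coboundary_on_def using fc by blast
qed

text \<open>The spheres are disjoint, so their bounds add up; \<open>e\<close> accounts for the
  centre. It is used with the bound 2 for the smallest set and with \<open>2 * r + 1\<close> for all
  vertices.\<close>

lemma card_ball_in:
  assumes x: "x \<in> V" and S: "\<And>r. 1 \<le> r \<Longrightarrow> r \<le> R \<Longrightarrow> c * r + d \<le> card (sphere_in x r \<inter> Y)"
    and "finite Y" "e \<le> card ({x} \<inter> Y)"
  shows "e + (\<Sum>r=1..R. c * r + d) \<le> card (ball_in x R \<inter> Y)"
  using S
proof (induction R)
  case 0 then show ?case using assms by simp
next
  case (Suc R)
  have "ball_in x (Suc R) \<inter> Y = (ball_in x R \<inter> Y) \<union> (sphere_in x (Suc R) \<inter> Y)"
    using ball_in_Suc[OF x, of R] by (auto simp: sphere_in_def)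
  moreover have "(ball_in x R \<inter> Y) \<inter> (sphere_in x (Suc R) \<inter> Y) = {}"
    by (auto simp: sphere_in_def)
  ultimately have "card (ball_in x (Suc R) \<inter> Y) = card (ball_in x R \<inter> Y) + card (sphere_in x (Suc R) \<inter> Y)"
    using \<open>finite Y\<close> by (simp add: card_Un_disjoint)
  moreover have "c * Suc R + d \<le> card (sphere_in x (Suc R) \<inter> Y)" using Suc.prems[of "Suc R"] by simp
  moreover have "e + (\<Sum>r=1..R. c * r + d) \<le> card (ball_in x R \<inter> Y)" using Suc by simp
  ultimately show ?case by simp
qed

text \<open>A sphere that meets the set once meets it in a cut vertex, where a piece inside a ball
  splits off.\<close>

lemma coboundary_on_thin:
  assumes short: "\<forall>n u g. n \<le> 2 * R + 1 \<longrightarrow> walk_prod n u u g \<longrightarrow> g = \<one>"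
    and Z: "Z \<subseteq> V"
    and thin: "\<And>x. x \<in> Z \<Longrightarrow> \<exists>r. 1 \<le> r \<and> r \<le> R \<and> card (sphere_in x r \<inter> Z) \<le> 1"
    and "W \<subseteq> Z"
  shows "coboundary_on W"
  using \<open>W \<subseteq> Z\<close>
proof (induction "card W" arbitrary: W rule: less_induct)
  case less
  have finW: "finite W" using less.prems Z finite_V by (meson finite_subset)
  show ?case
  proof (cases "W = {}")
    case True
    then show ?thesis unfolding coboundary_on_def by auto
  next
    case False
    then obtain x where x: "x \<in> W" by blast
    then obtain r where r: "1 \<le> r" "r \<le> R" "card (sphere_in x r \<inter> Z) \<le> 1" using thin less.prems by blast
    have xV: "x \<in> V" using x less.prems Z by blast
    have finZ: "finite Z" using Z finite_V by (rule finite_subset)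
    obtain p where p: "sphere_in x r \<inter> Z \<subseteq> {p}"
    proof (cases "sphere_in x r \<inter> Z = {}")
      case False
      then have "card (sphere_in x r \<inter> Z) = 1" using r finZ by (simp add: Suc_leI card_gt_0_iff le_antisym)
      then show ?thesis using card_1_singletonE that by (metis subset_refl)
    qed (use that in auto)
    \<comment> \<open>The pieces share only points of the sphere, hence at most \<open>p\<close>,
      and no edge jumps over the sphere. The first piece lies in a ball of radius at most
      \<open>R\<close>; the second lacks \<open>x\<close>, so the induction hypothesis applies to
      it.\<close>
    let ?A = "W \<inter> ball_in x r" and ?B = "W - ball_in x (r - 1)"
    have sub: "ball_in x (r - 1) \<subseteq> ball_in x r" using ball_in_mono[OF xV] by simp
    have "x \<in> ball_in x (r - 1)" using ball_in_mono[OF xV, of 0 "r - 1"] by auto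
    then have "?B \<subset> W" using x by blast
    then have B: "coboundary_on ?B"
      using less.hyps[of ?B] less.prems psubset_card_mono[OF finW] by blast
    have A: "coboundary_on ?A"
      by (rule coboundary_on_subset[OF coboundary_on_ball[of x R, OF xV short]])
        (use ball_in_mono[OF xV r(2)] in auto)
    have "coboundary_on (?A \<union> ?B)"
    proof (rule coboundary_on_glue[OF A B])
      show "?A \<inter> ?B \<subseteq> {p}" using p less.prems by (auto simp: sphere_in_def)
      fix u v assume "u \<in> ?A \<union> ?B" "v \<in> ?A \<union> ?B" "adj u v"
      then show "u \<in> ?A \<and> v \<in> ?A \<or> u \<in> ?B \<and> v \<in> ?B"
        using ball_in_adj[OF xV r(1)] adj_sym by blast
    qed
    moreover have "?A \<union> ?B = W" using sub by auto
    ultimately show ?thesis by simp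
  qed
qed

text \<open>A smallest set with the second property: replacing its part in a ball by the boundary sphere
  does not make it smaller.\<close>

lemma exists_separating_set:
  assumes short: "\<forall>n u g. n \<le> 2 * R + 1 \<longrightarrow> walk_prod n u u g \<longrightarrow> g = \<one>"
    and card: "card V < (R + 1)\<^sup>2"
  shows "\<exists>Z. Z \<subseteq> V \<and> coboundary_on Z \<and> coboundary_on (V - Z)"
proof -
  define P where "P Z \<longleftrightarrow> Z \<subseteq> V \<and> coboundary_on (V - Z)" for Z
  have "P V" unfolding P_def coboundary_on_def by auto
  then obtain Z where Z: "P Z" and min: "\<And>Y. P Y \<Longrightarrow> card Z \<le> card Y"
    using ex_has_least_nat[of P V card] by blast
  have ZV: "Z \<subseteq> V" using Z P_def by blast
  then have finZ: "finite Z" using finite_V by (rule finite_subset)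
  have repl: "card (ball_in x r \<inter> Z) \<le> card (sphere_in x r)" if x: "x \<in> Z" and r: "1 \<le> r" "r \<le> R" for x r
  proof -
    \<comment> \<open>The complement of \<open>?Y\<close> lies in the union of the ball of radius
      \<open>r - 1\<close> and the part of \<open>V - Z\<close> off the ball of radius
      \<open>r\<close>. Both have potentials and no edge joins them.\<close>
    let ?Y = "(Z - ball_in x r) \<union> sphere_in x r"
    have xV: "x \<in> V" using x ZV by blast
    have sub: "ball_in x (r - 1) \<subseteq> ball_in x r" using ball_in_mono[OF xV] by simp
    have A: "coboundary_on (ball_in x (r - 1))"
      by (rule coboundary_on_subset[OF coboundary_on_ball[of x R, OF xV short]])
        (use ball_in_mono[OF xV, of "r - 1" R] r in auto)
    have B: "coboundary_on (V - Z - ball_in x r)"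
      by (rule coboundary_on_subset[of "V - Z"]) (use Z P_def in auto)
    have "coboundary_on (ball_in x (r - 1) \<union> (V - Z - ball_in x r))"
    proof (rule coboundary_on_glue[OF A B])
      \<comment> \<open>The parts are disjoint, so \<open>undefined\<close> can play the common
        vertex in the gluing lemma.\<close>
      show "ball_in x (r - 1) \<inter> (V - Z - ball_in x r) \<subseteq> {undefined}" using sub by blast
      fix u v assume "u \<in> ball_in x (r - 1) \<union> (V - Z - ball_in x r)"
        "v \<in> ball_in x (r - 1) \<union> (V - Z - ball_in x r)" "adj u v"
      then show "u \<in> ball_in x (r - 1) \<and> v \<in> ball_in x (r - 1) \<or>
         u \<in> V - Z - ball_in x r \<and> v \<in> V - Z - ball_in x r"
        using ball_in_adj[OF xV r(1)] adj_sym by blast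
    qed
    moreover have "V - ?Y \<subseteq> ball_in x (r - 1) \<union> (V - Z - ball_in x r)"
      by (auto simp: sphere_in_def)
    moreover have "?Y \<subseteq> V" using ZV ball_in_V[OF xV] by (auto simp: sphere_in_def)
    ultimately have "P ?Y" unfolding P_def by (meson coboundary_on_subset)
    then have "card Z \<le> card ?Y" using min by blast
    also have "\<dots> \<le> card (Z - ball_in x r) + card (sphere_in x r)" by (rule card_Un_le)
    also have "card (Z - ball_in x r) = card Z - card (ball_in x r \<inter> Z)"
      by (metis Int_commute card_Diff_subset_Int finZ finite_Int)
    finally show ?thesis using card_mono[OF finZ, of "ball_in x r \<inter> Z"] by auto
  qed
  have thin: "\<exists>r. 1 \<le> r \<and> r \<le> R \<and> card (sphere_in x r \<inter> Z) \<le> 1" if x: "x \<in> Z" for x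
  proof (rule ccontr)
    assume "\<not> ?thesis"
    then have two: "0 * r + 2 \<le> card (sphere_in x r \<inter> Z)" if "1 \<le> r" "r \<le> R" for r
      using that by force
    have xV: "x \<in> V" using x ZV by blast
    \<comment> \<open>The ball contains the centre and two more points of \<open>Z\<close> on each
      of its \<open>r\<close> spheres; the exchange inequality \<open>repl\<close> turns this into a
      bound for the sphere.\<close>
    have "2 * r + 1 \<le> card (sphere_in x r \<inter> V)" if r: "1 \<le> r" "r \<le> R" for r
    proof -
      have "1 + (\<Sum>i=1..r. 0 * i + 2) \<le> card (ball_in x r \<inter> Z)"
        by (rule card_ball_in[OF xV two]) (use r x finZ in auto)
      moreover have "sphere_in x r \<inter> V = sphere_in x r" using ball_in_V[OF xV] by (auto simp: sphere_in_def)
      ultimately show ?thesis using repl[OF x r] by simp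
    qed
    then have "1 + (\<Sum>r=1..R. 2 * r + 1) \<le> card (ball_in x R \<inter> V)"
      by (rule card_ball_in[OF xV]) (use xV finite_V in auto)
    also have "\<dots> \<le> card V" by (simp add: card_mono finite_V)
    finally have "1 + (\<Sum>r=1..R. 2 * r + 1) \<le> card V" .
    moreover have "1 + (\<Sum>r=1..R. 2 * r + 1) = (R + 1)\<^sup>2"
      by (induction R) (auto simp: power2_eq_square)
    ultimately show False using card by simp
  qed
  have "coboundary_on Z" by (rule coboundary_on_thin[OF short ZV thin order_refl])
  then show ?thesis using Z ZV by (auto simp: P_def)
qed

text \<open>Besides being trivial within the two sides, the holonomy is made trivial on edges that
  connect all vertices to \<open>u0\<close>. A potential whose trivial edges reach as many vertices
  as possible does this.\<close>

lemma exists_spanning_gauge: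
  assumes u0: "u0 \<in> V" and conn: "\<And>v. v \<in> V \<Longrightarrow> \<exists>n g. walk_prod n u0 v g"
    and Z: "coboundary_on Z" "coboundary_on (V - Z)"
  shows "\<exists>f. (\<forall>v. f v \<in> carrier G) \<and> f u0 = \<one> \<and>
    (\<forall>u v. adj u v \<and> (u \<in> Z \<longleftrightarrow> v \<in> Z) \<longrightarrow> f u \<otimes> t u v = f v) \<and>
    (\<forall>v\<in>V. (u0, v) \<in> {(u, v). adj u v \<and> f u \<otimes> t u v = f v}\<^sup>*)"
proof -
  define P where "P f \<longleftrightarrow> (\<forall>v. f v \<in> carrier G) \<and>
    (\<forall>u v. adj u v \<and> (u \<in> Z \<longleftrightarrow> v \<in> Z) \<longrightarrow> f u \<otimes> t u v = f v)" for f
  define rel where "rel f = {(u, v). adj u v \<and> f u \<otimes> t u v = f v}" for f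
  define reach where "reach f = {v. (u0, v) \<in> (rel f)\<^sup>*}" for f
  have reachV: "reach f \<subseteq> V" for f
  proof
    fix v assume "v \<in> reach f"
    then have "(u0, v) \<in> (rel f)\<^sup>*" by (simp add: reach_def)
    then show "v \<in> V" by (induction rule: rtrancl_induct) (use u0 adj_V in \<open>auto simp: rel_def\<close>)
  qed
  obtain f1 where f1: "\<And>v. f1 v \<in> carrier G" "\<And>u v. u\<in>Z \<Longrightarrow> v\<in>Z \<Longrightarrow> adj u v \<Longrightarrow> f1 u \<otimes> t u v = f1 v"
    using Z(1) unfolding coboundary_on_def by blast
  obtain f2 where f2: "\<And>v. f2 v \<in> carrier G" "\<And>u v. u\<in>V-Z \<Longrightarrow> v\<in>V-Z \<Longrightarrow> adj u v \<Longrightarrow> f2 u \<otimes> t u v = f2 v"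
    using Z(2) unfolding coboundary_on_def by blast
  have "P (\<lambda>v. if v \<in> Z then f1 v else f2 v)"
    unfolding P_def using f1 f2 adj_V by auto
  then obtain f0 where "P f0" by blast
  moreover have "\<forall>f. P f \<longrightarrow> card (reach f) < Suc (card V)" by (simp add: card_mono finite_V reachV less_Suc_eq_le)
  ultimately obtain f where Pf: "P f" and max: "\<And>h. P h \<Longrightarrow> card (reach h) \<le> card (reach f)"
    using ex_has_greatest_nat[of P f0 "\<lambda>f. card (reach f)" "Suc (card V)"] by auto
  have fc: "\<And>v. f v \<in> carrier G" using Pf P_def by blast
  have relsym: "(v, u) \<in> rel f" if "(u, v) \<in> rel f" for u v
  proof -
    have uv: "adj u v" "f u \<otimes> t u v = f v" using that by (auto simp: rel_def)
    then have "f v \<otimes> t v u = f u"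
      using fc t_closed[OF uv(1)] t_inv[OF uv(1)] by (simp add: m_assoc flip: uv(2))
    then show ?thesis using uv adj_sym by (auto simp: rel_def)
  qed
  have reach_rel: "u \<in> reach f \<longleftrightarrow> v \<in> reach f" if "(u, v) \<in> rel f" for u v
    using that relsym[OF that] unfolding reach_def by (auto intro: rtrancl_into_rtrancl)
  have u0r: "u0 \<in> reach h" for h by (simp add: reach_def)
  have all: "reach f = V"
  proof (rule ccontr)
    assume "reach f \<noteq> V"
    then obtain v where v: "v \<in> V" "v \<notin> reach f" using reachV by blast
    obtain n g where "walk_prod n u0 v g" using conn v by blast
    then have "\<exists>x y. adj x y \<and> x \<in> reach f \<and> y \<notin> reach f" using u0r v(2)
    proof (induction rule: walk_prod.induct)
      case (walk_prod_Suc n u v g w) then show ?case by blast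
    qed auto
    then obtain x y where xy: "adj x y" "x \<in> reach f" "y \<notin> reach f" by blast
    \<comment> \<open>Multiplying the potential by \<open>k\<close> off the reached set makes the
      edge from \<open>x\<close> to \<open>y\<close> trivial. Trivial edges do not leave the reached
      set, so all of them survive and the reached set grows.\<close>
    define k where "k = f x \<otimes> t x y \<otimes> inv (f y)"
    have k: "k \<in> carrier G" using fc t_closed[OF xy(1)] by (simp add: k_def)
    define h where "h w = (if w \<in> reach f then f w else k \<otimes> f w)" for w
    have hc: "h w \<in> carrier G" for w using fc k by (simp add: h_def)
    have keep: "(u, v) \<in> rel h" if "(u, v) \<in> rel f" for u v
      using that reach_rel[OF that] fc k t_closed by (auto simp: rel_def h_def m_assoc)
    have "P h" unfolding P_def
    proof (intro conjI allI impI)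
      fix u v assume *: "adj u v \<and> (u \<in> Z) = (v \<in> Z)"
      then have "(u, v) \<in> rel f" using Pf by (auto simp: rel_def P_def)
      then show "h u \<otimes> t u v = h v" using keep by (auto simp: rel_def)
    qed (use hc in auto)
    moreover have "card (reach f) < card (reach h)"
    proof (rule psubset_card_mono)
      show "finite (reach h)" using reachV finite_V finite_subset by blast
      have sub: "reach f \<subseteq> reach h"
      proof -
        have "rel f \<subseteq> rel h" using keep by auto
        then have "(rel f)\<^sup>* \<subseteq> (rel h)\<^sup>*" by (rule rtrancl_mono)
        then show ?thesis by (auto simp: reach_def)
      qed
      have "h x \<otimes> t x y = h y"
        using xy fc t_closed[OF xy(1)] by (simp add: h_def k_def m_assoc)
      then have "(x, y) \<in> rel h" using xy by (simp add: rel_def)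
      moreover have "x \<in> reach h" using sub xy by blast
      ultimately have "y \<in> reach h" unfolding reach_def by (auto intro: rtrancl_into_rtrancl)
      then show "reach f \<subset> reach h" using sub xy by blast
    qed
    ultimately show False using max by fastforce
  qed
  \<comment> \<open>A constant left factor normalises the potential at \<open>u0\<close> and keeps
    the same trivial edges.\<close>
  define h where "h v = inv (f u0) \<otimes> f v" for v
  have shift: "h u \<otimes> t u v = h v \<longleftrightarrow> f u \<otimes> t u v = f v" if "adj u v" for u v
  proof -
    have "h u \<otimes> t u v = inv (f u0) \<otimes> (f u \<otimes> t u v)"
      using fc t_closed[OF that] by (simp add: h_def m_assoc)
    then show ?thesis using fc t_closed[OF that] by (simp add: h_def)
  qed
  have "rel h = rel f" using shift by (auto simp: rel_def)
  then have "\<forall>v\<in>V. (u0, v) \<in> (rel h)\<^sup>*" using all by (auto simp: reach_def)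
  moreover have "h u0 = \<one>" "\<And>v. h v \<in> carrier G" using fc by (auto simp: h_def)
  moreover have "\<forall>u v. adj u v \<and> (u \<in> Z \<longleftrightarrow> v \<in> Z) \<longrightarrow> h u \<otimes> t u v = h v"
    using Pf shift by (auto simp: P_def)
  ultimately show ?thesis unfolding rel_def by blast
qed

end

section \<open>Reduced words and the freeness criterion\<close>

lemma reduced_word_Cons:
  "reduced_word (p # w) \<longleftrightarrow> reduced_word w \<and>
    (w \<noteq> [] \<longrightarrow> \<not> (fst p = fst (hd w) \<and> snd p \<noteq> snd (hd w)))"
proof
  assume L: "reduced_word (p # w)"
  have "reduced_word w" unfolding reduced_word_def
  proof (intro allI impI)
    fix i assume "Suc i < length w"
    then show "\<not> (fst (w ! i) = fst (w ! Suc i) \<and> snd (w ! i) \<noteq> snd (w ! Suc i))"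
      using L[unfolded reduced_word_def, rule_format, of "Suc i"] by simp
  qed
  moreover have "\<not> (fst p = fst (hd w) \<and> snd p \<noteq> snd (hd w))" if "w \<noteq> []"
    using L[unfolded reduced_word_def, rule_format, of 0] that by (simp add: hd_conv_nth)
  ultimately show "reduced_word w \<and> (w \<noteq> [] \<longrightarrow> \<not> (fst p = fst (hd w) \<and> snd p \<noteq> snd (hd w)))" by blast
next
  assume R: "reduced_word w \<and> (w \<noteq> [] \<longrightarrow> \<not> (fst p = fst (hd w) \<and> snd p \<noteq> snd (hd w)))"
  show "reduced_word (p # w)" unfolding reduced_word_def
  proof (intro allI impI)
    fix i assume i: "Suc i < length (p # w)"
    show "\<not> (fst ((p # w) ! i) = fst ((p # w) ! Suc i) \<and> snd ((p # w) ! i) \<noteq> snd ((p # w) ! Suc i))"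
    proof (cases i)
      case 0
      then have "w \<noteq> []" using i by auto
      then show ?thesis using R 0 by (simp add: hd_conv_nth)
    next
      case (Suc j)
      then show ?thesis using R i unfolding reduced_word_def by simp
    qed
  qed
qed

text \<open>Left multiplication by one letter in the free group, carried out on reduced words; the
  Boolean is \<open>False\<close> for an inverse letter.\<close>

definition letter_act :: "'a \<times> bool \<Rightarrow> ('a \<times> bool) list \<Rightarrow> ('a \<times> bool) list" where
  "letter_act p w = (if w \<noteq> [] \<and> hd w = (fst p, \<not> snd p) then tl w else p # w)"

lemma letter_act_reduced: "reduced_word w \<Longrightarrow> reduced_word (letter_act p w)"
  by (cases w; cases p) (auto simp: letter_act_def reduced_word_Cons)

text \<open>If the inner step has removed the first letter of \<open>w\<close>, the outer one must
  put it back rather than cancel once more; this is where \<open>w\<close> has to be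
  reduced.\<close>

lemma letter_act_cancel: "reduced_word w \<Longrightarrow> letter_act (x, b) (letter_act (x, \<not> b) w) = w"
proof (cases w)
  case (Cons q v)
  assume "reduced_word w"
  then show ?thesis using Cons by (cases v; cases q) (auto simp: letter_act_def reduced_word_Cons)
qed (simp add: letter_act_def)

text \<open>The orbit of the empty word tells reduced words apart; this is how a nonempty reduced
  word is later seen to be nontrivial in the group.\<close>

lemma foldr_letter_act: "reduced_word w \<Longrightarrow> foldr letter_act w [] = w"
proof (induction w)
  case (Cons p w)
  then have "foldr letter_act (p # w) [] = letter_act p w" by (simp add: reduced_word_Cons)
  also have "\<dots> = p # w" using Cons.prems by (auto simp: letter_act_def reduced_word_Cons)
  finally show ?case .
qed simp

context edge_cocycle
begin

text \<open>The assumption \<open>univ\<close> says that \<open>G\<close> is the universal group generated by the values of the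
  cocycle: every cocycle of permutations of \<open>S\<close> comes from an action of \<open>G\<close>, up to the gauge \<open>F\<close>.
  It is applied to the action of single letters on reduced words.\<close>

theorem free_group_of_few_vertices:
  assumes u0: "u0 \<in> V" and conn: "\<And>v. v \<in> V \<Longrightarrow> \<exists>n g. walk_prod n u0 v g"
    and gen: "\<And>x. x \<in> carrier G \<Longrightarrow> \<exists>n. walk_prod n u0 u0 x"
    and univ: "\<And>(S :: ('a \<times> bool) list set) g.
      \<lbrakk>\<And>u s. u \<in> V \<Longrightarrow> s \<in> S \<Longrightarrow> g u u s = s;
       \<And>u v s. adj u v \<Longrightarrow> s \<in> S \<Longrightarrow> g u v s \<in> S;
       \<And>u v w s. adj u v \<Longrightarrow> adj v w \<Longrightarrow> adj u w \<Longrightarrow> s \<in> S \<Longrightarrow> g u v (g v w s) = g u w s\<rbrakk>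
      \<Longrightarrow> \<exists>\<Phi> F. (\<forall>x\<in>carrier G. \<forall>y\<in>carrier G. \<forall>s\<in>S. \<Phi> (x \<otimes> y) s = \<Phi> x (\<Phi> y s)) \<and>
           (\<forall>s\<in>S. \<Phi> \<one> s = s) \<and> (\<forall>u\<in>V. \<forall>s\<in>S. F u s \<in> S) \<and> (\<forall>s\<in>S. F u0 s = s) \<and>
           (\<forall>x\<in>carrier G. \<forall>s\<in>S. \<Phi> x s \<in> S) \<and>
           (\<forall>u v. adj u v \<longrightarrow> (\<forall>s\<in>S. \<Phi> (t u v) (F v s) = F u (g u v s)))"
    and short: "\<forall>n u g. n \<le> 2 * R + 1 \<longrightarrow> walk_prod n u u g \<longrightarrow> g = \<one>"
    and card: "card V < (R + 1)\<^sup>2"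
  shows "free_group G"
proof -
  obtain Z where Z: "Z \<subseteq> V" "coboundary_on Z" "coboundary_on (V - Z)"
    using exists_separating_set[of R, OF short card] by auto
  obtain f where f: "(\<forall>v. f v \<in> carrier G) \<and> f u0 = \<one> \<and>
    (\<forall>u v. adj u v \<and> (u \<in> Z \<longleftrightarrow> v \<in> Z) \<longrightarrow> f u \<otimes> t u v = f v) \<and>
    (\<forall>v\<in>V. (u0, v) \<in> {(u, v). adj u v \<and> f u \<otimes> t u v = f v}\<^sup>*)"
    using exists_spanning_gauge[OF u0 conn Z(2,3)] by (rule exE)
  have fc: "f v \<in> carrier G" for v using f by blast
  have f0: "f u0 = \<one>" using f by blast
  have inner: "f u \<otimes> t u v = f v" if "adj u v" "u \<in> Z \<longleftrightarrow> v \<in> Z" for u v using f that by blast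
  have span: "(u0, v) \<in> {(u, v). adj u v \<and> f u \<otimes> t u v = f v}\<^sup>*" if "v \<in> V" for v
    using f that by blast
  \<comment> \<open>\<open>d\<close> is the cocycle in the gauge \<open>f\<close>: trivial inside
    \<open>Z\<close>, inside its complement and on the spanning edges.\<close>
  define d where "d u v = f u \<otimes> t u v \<otimes> inv (f v)" for u v
  have dc: "d u v \<in> carrier G" if "adj u v" for u v using fc t_closed[OF that] by (simp add: d_def)
  have d1: "d u v = \<one> \<longleftrightarrow> f u \<otimes> t u v = f v" if "adj u v" for u v
  proof
    assume "d u v = \<one>"
    then show "f u \<otimes> t u v = f v"
      using fc[of u] fc[of v] t_closed[OF that] inv_equality[of "f u \<otimes> t u v" "inv (f v)"]
      by (simp add: d_def)
  qed (simp add: d_def fc)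
  have dcoc: "d u v \<otimes> d v w = d u w" if "adj u v" "adj v w" "adj u w" for u v w
  proof -
    have "d u v \<otimes> d v w = f u \<otimes> t u v \<otimes> inv (f v) \<otimes> (f v \<otimes> (t v w \<otimes> inv (f w)))"
      using fc t_closed[OF that(2)] by (simp add: d_def m_assoc)
    also have "\<dots> = f u \<otimes> t u v \<otimes> (t v w \<otimes> inv (f w))"
      using fc t_closed[OF that(1)] t_closed[OF that(2)] by (simp add: mult_inv_cancel)
    also have "\<dots> = f u \<otimes> (t u v \<otimes> t v w) \<otimes> inv (f w)"
      using fc t_closed[OF that(1)] t_closed[OF that(2)] by (simp add: m_assoc)
    finally have "d u v \<otimes> d v w = f u \<otimes> (t u v \<otimes> t v w) \<otimes> inv (f w)" .
    then show ?thesis using t_cocycle[OF that] by (simp add: d_def)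
  qed
  have dinner: "d u v = \<one>" if "adj u v" "u \<in> Z \<longleftrightarrow> v \<in> Z" for u v
    using inner[OF that] d1[OF that(1)] by simp
  have drefl: "d u u = \<one>" if "u \<in> V" for u using dinner adj_refl that by simp
  have dinv: "d v u = inv (d u v)" if "adj u v" for u v
    using dcoc[OF adj_sym[OF that] that] drefl adj_refl adj_V[OF that] dc[OF that] dc[OF adj_sym[OF that]]
    by (simp add: inv_equality)
  define S :: "('a \<times> bool) list set" where "S = {w. reduced_word w}"
  \<comment> \<open>Leaving \<open>Z\<close> acts as the letter \<open>d u v\<close>, entering
    \<open>Z\<close> as the inverse of the letter \<open>d v u\<close>. A trivial
    \<open>d u v\<close> is no generator and has to act as the identity.\<close>
  define g where "g u v = (if d u v = \<one> then (\<lambda>w. w)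
     else if u \<in> Z then letter_act (d u v, True) else letter_act (d v u, False))" for u v
  have gS: "g u v s \<in> S" if "s \<in> S" for u v s
    using that by (auto simp: g_def S_def letter_act_reduced)
  have gcoc: "g u v (g v w s) = g u w s" if a: "adj u v" "adj v w" "adj u w" and s: "s \<in> S" for u v w s
  proof -
    \<comment> \<open>Of three vertices two share a side and their edge is trivial. In the first two
      cases the other two edges carry the same letter; in the last one the side is changed and
      changed back, and the two letters cancel.\<close>
    consider "u \<in> Z \<longleftrightarrow> v \<in> Z" | "v \<in> Z \<longleftrightarrow> w \<in> Z" | "u \<in> Z \<longleftrightarrow> w \<in> Z" "(u \<in> Z) \<noteq> (v \<in> Z)" by blast
    then show ?thesis
    proof cases
      case 1
      then have "d u v = \<one>" "d v u = \<one>" using dinner a adj_sym by auto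
      then have "d u w = d v w" "d w u = d w v"
        using dcoc[OF a] dcoc[OF adj_sym[OF a(2)] adj_sym[OF a(1)] adj_sym[OF a(3)]]
          dc[OF a(2)] dc[OF adj_sym[OF a(2)]] by auto
      then show ?thesis using \<open>d u v = \<one>\<close> 1 by (simp add: g_def)
    next
      case 2
      then have "d v w = \<one>" "d w v = \<one>" using dinner a adj_sym by auto
      then have "d u w = d u v" "d w u = d v u"
        using dcoc[OF a] dcoc[OF adj_sym[OF a(2)] adj_sym[OF a(1)] adj_sym[OF a(3)]]
          dc[OF a(1)] dc[OF adj_sym[OF a(1)]] by auto
      then show ?thesis using \<open>d v w = \<one>\<close> 2 by (simp add: g_def)
    next
      case 3
      then have uw: "d u w = \<one>" "d w u = \<one>" using dinner a adj_sym by auto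
      then have vw: "d v w = d v u" "d w v = d u v"
        using dcoc[OF adj_sym[OF a(1)] a(3) a(2)] dcoc[OF adj_sym[OF a(3)] a(1) adj_sym[OF a(2)]]
          dc[OF a(1)] dc[OF adj_sym[OF a(1)]] by auto
      have "d v u = inv (d u v)" using dinv a by blast
      then have "d v u = \<one> \<longleftrightarrow> d u v = \<one>" using dc[OF a(1)] inv_eq_1_iff by simp
      then show ?thesis using uw vw 3 s
        using letter_act_cancel[of s "d u v" True] letter_act_cancel[of s "d v u" False]
        by (auto simp: g_def S_def)
    qed
  qed
  have grefl: "g u u s = s" if "u \<in> V" for u s using drefl that by (simp add: g_def)
  have "\<exists>\<Phi> F. (\<forall>x\<in>carrier G. \<forall>y\<in>carrier G. \<forall>s\<in>S. \<Phi> (x \<otimes> y) s = \<Phi> x (\<Phi> y s)) \<and>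
           (\<forall>s\<in>S. \<Phi> \<one> s = s) \<and> (\<forall>u\<in>V. \<forall>s\<in>S. F u s \<in> S) \<and> (\<forall>s\<in>S. F u0 s = s) \<and>
           (\<forall>x\<in>carrier G. \<forall>s\<in>S. \<Phi> x s \<in> S) \<and>
           (\<forall>u v. adj u v \<longrightarrow> (\<forall>s\<in>S. \<Phi> (t u v) (F v s) = F u (g u v s)))"
    by (rule univ) (use grefl gS gcoc in auto)
  then obtain \<Phi> F where
    homs: "(\<forall>x\<in>carrier G. \<forall>y\<in>carrier G. \<forall>s\<in>S. \<Phi> (x \<otimes> y) s = \<Phi> x (\<Phi> y s)) \<and>
           (\<forall>s\<in>S. \<Phi> \<one> s = s) \<and> (\<forall>u\<in>V. \<forall>s\<in>S. F u s \<in> S) \<and> (\<forall>s\<in>S. F u0 s = s) \<and>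
           (\<forall>x\<in>carrier G. \<forall>s\<in>S. \<Phi> x s \<in> S) \<and>
           (\<forall>u v. adj u v \<longrightarrow> (\<forall>s\<in>S. \<Phi> (t u v) (F v s) = F u (g u v s)))"
    by (elim exE)
  have hom: "\<Phi> (x \<otimes> y) s = \<Phi> x (\<Phi> y s)" if "x\<in>carrier G" "y\<in>carrier G" "s\<in>S" for x y s
    using homs that by blast
  have one: "\<Phi> \<one> s = s" if "s\<in>S" for s using homs that by blast
  have FS: "F u s \<in> S" if "u\<in>V" "s\<in>S" for u s using homs that by blast
  have F0: "F u0 s = s" if "s\<in>S" for s using homs that by blast
  have edge: "\<Phi> (t u v) (F v s) = F u (g u v s)" if "adj u v" "s\<in>S" for u v s using homs that by blast
  \<comment> \<open>On a spanning edge \<open>g\<close> is the identity, so there \<open>F\<close>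
    changes exactly as \<open>t\<close> dictates. Starting from \<open>u0\<close> it therefore stays
    inverse to the action of \<open>f\<close>.\<close>
  have M: "\<Phi> (f v) (F v s) = s" if "v \<in> V" and s: "s \<in> S" for v s
    using span[OF that(1)]
  proof (induction rule: rtrancl_induct)
    case base then show ?case using f0 one F0 s by simp
  next
    case (step u v)
    then have uv: "adj u v" "f u \<otimes> t u v = f v" by auto
    then have "d u v = \<one>" using d1 by blast
    then have "g u v s = s" by (simp add: g_def)
    then have "\<Phi> (f u) (\<Phi> (t u v) (F v s)) = s" using edge[OF uv(1) s] step by simp
    then show ?case using hom[OF fc[of u] t_closed[OF uv(1)] FS[of v s]] s uv adj_V[OF uv(1)] by simp
  qed
  \<comment> \<open>The unknown \<open>F\<close> cancels: each \<open>d u v\<close> acts as the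
    permutation that was prescribed for it.\<close>
  have \<Phi>d: "\<Phi> (d u v) s = g u v s" if uv: "adj u v" and s: "s \<in> S" for u v s
  proof -
    have V: "u \<in> V" "v \<in> V" using adj_V uv by auto
    have Fs: "F v s \<in> S" using FS V s by blast
    have "\<Phi> (d u v) s = \<Phi> (d u v) (\<Phi> (f v) (F v s))" using M V s by simp
    also have "\<dots> = \<Phi> (d u v \<otimes> f v) (F v s)" using hom dc[OF uv] fc Fs by simp
    also have "d u v \<otimes> f v = f u \<otimes> t u v" using fc t_closed[OF uv] by (simp add: d_def m_assoc)
    also have "\<Phi> (f u \<otimes> t u v) (F v s) = \<Phi> (f u) (F u (g u v s))"
      using hom fc t_closed[OF uv] Fs edge[OF uv s] by simp
    also have "\<dots> = g u v s" using M V gS s by simp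
    finally show ?thesis .
  qed
  \<comment> \<open>Each edge between the sides is taken in one orientation only, and the unit is
    removed because it cannot belong to a free generating set.\<close>
  define Gs where "Gs = {d u v | u v. adj u v \<and> u \<in> Z \<and> v \<notin> Z} - {\<one>}"
  have GsG: "Gs \<subseteq> carrier G" using dc by (auto simp: Gs_def)
  have pos: "\<Phi> x s = letter_act (x, True) s" if "x \<in> Gs" "s \<in> S" for x s
    using that \<Phi>d by (auto simp: Gs_def g_def)
  have neg: "\<Phi> (inv x) s = letter_act (x, False) s" if x: "x \<in> Gs" and s: "s \<in> S" for x s
  proof -
    let ?s = "letter_act (x, False) s"
    have s': "?s \<in> S" using s by (simp add: S_def letter_act_reduced)
    have "\<Phi> x ?s = s" using pos[OF x s'] letter_act_cancel[of s x True] s by (simp add: S_def)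
    moreover have xG: "x \<in> carrier G" using x GsG by blast
    ultimately have "\<Phi> (inv x) s = \<Phi> (inv x \<otimes> x) ?s" using hom[OF inv_closed[OF xG] xG s'] by metis
    also have "\<dots> = ?s" using xG one[OF s'] by simp
    finally show ?thesis .
  qed
  have wordG: "word_eval G w \<in> carrier G" if "set (map fst w) \<subseteq> Gs" for w
    using that by (induction w) (use GsG in \<open>auto simp: word_eval_def\<close>)
  have word: "\<Phi> (word_eval G w) [] = foldr letter_act w [] \<and> foldr letter_act w [] \<in> S"
    if "set (map fst w) \<subseteq> Gs" for w
    using that
  proof (induction w)
    case Nil
    then show ?case using one by (simp add: word_eval_def S_def reduced_word_def)
  next
    case (Cons p w)
    obtain x b where p: "p = (x, b)" by (cases p)
    then have x: "x \<in> Gs" using Cons by auto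
    have IH: "\<Phi> (word_eval G w) [] = foldr letter_act w []" "foldr letter_act w [] \<in> S" using Cons by auto
    have nil: "[] \<in> S" by (simp add: S_def reduced_word_def)
    have "word_eval G (p # w) = (if b then x else inv x) \<otimes> word_eval G w"
      by (simp add: word_eval_def p)
    then have "\<Phi> (word_eval G (p # w)) [] = \<Phi> (if b then x else inv x) (foldr letter_act w [])"
      using hom[of "if b then x else inv x" "word_eval G w" "[]"] x GsG wordG[of w] Cons nil IH by auto
    also have "\<dots> = letter_act p (foldr letter_act w [])"
      using pos[OF x IH(2)] neg[OF x IH(2)] p by simp
    finally show ?case using IH by (simp add: S_def letter_act_reduced)
  qed
  have "word_eval G w \<noteq> \<one>" if "set (map fst w) \<subseteq> Gs" "w \<noteq> []" "reduced_word w" for w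
    using word[OF that(1)] foldr_letter_act[OF that(3)] that(2) one[of "[]"]
    by (auto simp: S_def reduced_word_def)
  moreover have "generate G Gs = carrier G"
  proof
    show "generate G Gs \<subseteq> carrier G" using generate_incl[OF GsG] .
    have edge: "d u v \<in> generate G Gs" if uv: "adj u v" for u v
    proof -
      consider "d u v = \<one>" | "d u v \<noteq> \<one>" "u \<in> Z" "v \<notin> Z" | "d u v \<noteq> \<one>" "v \<in> Z" "u \<notin> Z"
        using dinner[OF uv] by blast
      then show ?thesis
      proof cases
        case 1 then show ?thesis using generate.one by simp
      next
        case 2 then show ?thesis using uv by (intro generate.incl) (auto simp: Gs_def)
      next
        case 3
        have "d v u \<noteq> \<one>" using 3 dinv[OF adj_sym[OF uv]] by auto
        then have "d v u \<in> Gs" using 3 adj_sym[OF uv] by (auto simp: Gs_def)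
        then show ?thesis using dinv[OF adj_sym[OF uv]] generate.inv by simp
      qed
    qed
    \<comment> \<open>The factors \<open>f\<close> telescope along the walk. For closed walks at
      \<open>u0\<close>, where \<open>f\<close> is the unit, the walk product itself is
      generated.\<close>
    have walk: "f u \<otimes> h \<otimes> inv (f v) \<in> generate G Gs" if "walk_prod n u v h" for n u v h
      using that
    proof (induction rule: walk_prod.induct)
      case (walk_prod_0 u) then show ?case using fc generate.one by simp
    next
      case (walk_prod_Suc n u v h w)
      have "f u \<otimes> h \<otimes> inv (f v) \<otimes> d v w \<in> generate G Gs"
        using generate.eng[OF walk_prod_Suc.IH edge[OF walk_prod_Suc.hyps(2)]] .
      moreover have "f u \<otimes> h \<otimes> inv (f v) \<otimes> d v w = f u \<otimes> h \<otimes> inv (f v) \<otimes> (f v \<otimes> (t v w \<otimes> inv (f w)))"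
        using fc t_closed[OF walk_prod_Suc.hyps(2)] by (simp add: d_def m_assoc)
      moreover have "\<dots> = f u \<otimes> h \<otimes> (t v w \<otimes> inv (f w))"
        using fc t_closed[OF walk_prod_Suc.hyps(2)] walk_prod_closed[OF walk_prod_Suc.hyps(1)]
        by (simp add: mult_inv_cancel)
      moreover have "\<dots> = f u \<otimes> (h \<otimes> t v w) \<otimes> inv (f w)"
        using fc t_closed[OF walk_prod_Suc.hyps(2)] walk_prod_closed[OF walk_prod_Suc.hyps(1)]
        by (simp add: m_assoc)
      ultimately show ?case by simp
    qed
    show "carrier G \<subseteq> generate G Gs"
    proof
      fix x assume x: "x \<in> carrier G"
      then obtain n where "walk_prod n u0 u0 x" using gen by blast
      from walk[OF this] show "x \<in> generate G Gs" using f0 x by simp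
    qed
  qed
  ultimately show ?thesis unfolding free_group_def using GsG group_axioms by blast
qed

end

section \<open>Homotopy of paths in topological spaces\<close>

lemma pathstart_const [simp]: "pathstart (\<lambda>_. c) = c"
  by (simp add: pathstart_def)

lemma pathfinish_const [simp]: "pathfinish (\<lambda>_. c) = c"
  by (simp add: pathfinish_def)

definition path_between :: "'a::topological_space set \<Rightarrow> 'a \<Rightarrow> 'a \<Rightarrow> (real \<Rightarrow> 'a) \<Rightarrow> bool" where
  "path_between M x y p \<longleftrightarrow> path p \<and> path_image p \<subseteq> M \<and> pathstart p = x \<and> pathfinish p = y"

lemma path_between_at: "path_between M x y p \<Longrightarrow> t \<in> {0..1} \<Longrightarrow> p t \<in> M"
  unfolding path_between_def path_image_def by auto

lemma path_between_join: "path_between M x y p \<Longrightarrow> path_between M y z q \<Longrightarrow> path_between M x z (p +++ q)"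
  unfolding path_between_def by (auto simp: path_join subset_path_image_join)

lemma path_between_rev: "path_between M x y p \<Longrightarrow> path_between M y x (reversepath p)"
  unfolding path_between_def by auto

lemma path_between_const: "x \<in> M \<Longrightarrow> path_between M x x (\<lambda>_. x)"
  unfolding path_between_def path_def path_image_def pathstart_def pathfinish_def by auto

lemma path_between_ends: "path_between M x y p \<Longrightarrow> x \<in> M \<and> y \<in> M \<and> p 0 = x \<and> p 1 = y"
  unfolding path_between_def path_image_def pathstart_def pathfinish_def by force

lemma homotopic_paths_path_between: "homotopic_paths M p q \<Longrightarrow> path_between M x y p \<Longrightarrow> path_between M x y q"
  unfolding path_between_def
  by (metis homotopic_paths_imp_path homotopic_paths_imp_subset homotopic_paths_imp_pathstart
      homotopic_paths_imp_pathfinish)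

lemma homotopic_between_refl: "path_between M x y p \<Longrightarrow> homotopic_paths M p p"
  by (simp add: path_between_def)

text \<open>The unit and inverse laws of the library require normed spaces; they hold in general
  because they already hold for the corresponding reparametrisations of the unit interval.\<close>

lemma homotopic_paths_reparam:
  assumes p: "path_between M x y p" and h: "homotopic_paths {0..1} \<alpha> \<beta>"
  shows "homotopic_paths M (p \<circ> \<alpha>) (p \<circ> \<beta>)"
  by (rule homotopic_paths_continuous_image[OF h])
    (use p in \<open>auto simp: path_between_def path_def path_image_def\<close>)

lemma comp_linepath_01: "(p :: real \<Rightarrow> 'a) \<circ> linepath 0 1 = p"
  by (simp add: linepath_def fun_eq_iff)

lemma comp_linepath_const: "(p :: real \<Rightarrow> 'a) \<circ> linepath c c = (\<lambda>_. p c)"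
  by (simp add: linepath_refl o_def)

lemma homotopic_between_rid:
  assumes "path_between M x y p" shows "homotopic_paths M (p +++ (\<lambda>_. y)) p"
proof -
  have "homotopic_paths {0..1} (linepath 0 1 +++ linepath 1 1) (linepath 0 (1::real))"
    using homotopic_paths_rid[of "linepath 0 (1::real)" "{0..1}"] by (simp add: closed_segment_eq_real_ivl)
  from homotopic_paths_reparam[OF assms this]
  show ?thesis using path_between_ends[OF assms]
    by (simp only: path_compose_join comp_linepath_01 comp_linepath_const)
qed

lemma homotopic_between_lid:
  assumes "path_between M x y p" shows "homotopic_paths M ((\<lambda>_. x) +++ p) p"
proof -
  have "homotopic_paths {0..1} (linepath 0 0 +++ linepath 0 1) (linepath 0 (1::real))"
    using homotopic_paths_lid[of "linepath 0 (1::real)" "{0..1}"] by (simp add: closed_segment_eq_real_ivl)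
  from homotopic_paths_reparam[OF assms this]
  show ?thesis using path_between_ends[OF assms]
    by (simp only: path_compose_join comp_linepath_01 comp_linepath_const)
qed

lemma homotopic_between_rinv:
  assumes "path_between M x y p" shows "homotopic_paths M (p +++ reversepath p) (\<lambda>_. x)"
proof -
  have "homotopic_paths {0..1} (linepath 0 1 +++ reversepath (linepath 0 1)) (linepath 0 (0::real))"
    using homotopic_paths_rinv[of "linepath 0 (1::real)" "{0..1}"] by (simp add: closed_segment_eq_real_ivl)
  from homotopic_paths_reparam[OF assms this]
  have "homotopic_paths M ((p \<circ> linepath 0 1) +++ reversepath (p \<circ> linepath 0 1)) (p \<circ> linepath 0 0)"
    by (simp only: path_compose_join path_compose_reversepath)
  then show ?thesis using path_between_ends[OF assms]
    by (simp only: comp_linepath_01 comp_linepath_const)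
qed

lemma homotopic_between_linv:
  assumes "path_between M x y p" shows "homotopic_paths M (reversepath p +++ p) (\<lambda>_. y)"
  using homotopic_between_rinv[OF path_between_rev[OF assms]] by simp

lemma homotopic_between_cancel:
  assumes p: "path_between M x y p" and q: "path_between M x y q"
    and h: "homotopic_paths M (p +++ reversepath q) (\<lambda>_. x)"
  shows "homotopic_paths M p q"
proof -
  have "homotopic_paths M p (p +++ (\<lambda>_. y))"
    using homotopic_between_rid[OF p] homotopic_paths_sym by blast
  also have "homotopic_paths M \<dots> (p +++ (reversepath q +++ q))"
    using p q by (intro homotopic_paths_join homotopic_between_refl[OF p]
        homotopic_paths_sym[OF homotopic_between_linv[OF q]]) (auto simp: path_between_def pathstart_def)
  also have "homotopic_paths M \<dots> ((p +++ reversepath q) +++ q)"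
    using p q by (intro homotopic_paths_assoc) (auto simp: path_between_def)
  also have "homotopic_paths M \<dots> ((\<lambda>_. x) +++ q)"
    using p q by (intro homotopic_paths_join h homotopic_between_refl[OF q]) (auto simp: path_between_def)
  also have "homotopic_paths M \<dots> q" by (rule homotopic_between_lid[OF q])
  finally show ?thesis .
qed

text \<open>Push the bottom edge of the square across to the other three edges: the image of the latter
  is the track of the base point, the constant loop, and the track traversed backwards.\<close>

lemma homotopic_loops_const_imp_paths:
  assumes "homotopic_loops M p (\<lambda>_. c)"
  shows "homotopic_paths M p (\<lambda>_. pathstart p)"
proof -
  let ?Q = "{0..1::real} \<times> {0..1::real}"
  obtain h where h: "continuous_on ?Q h" "h \<in> ?Q \<rightarrow> M"
    and h0: "\<And>x. x \<in> {0..1} \<Longrightarrow> h (0, x) = p x" and h1: "\<And>x. x \<in> {0..1} \<Longrightarrow> h (1, x) = c"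
    and ends: "\<And>t. t \<in> {0..1} \<Longrightarrow> h (t, 1) = h (t, 0)"
    using assms unfolding homotopic_loops by (auto simp: pathstart_def pathfinish_def)
  have p: "path_between M (p 0) (p 0) p"
    using homotopic_loops_imp_path[OF assms] homotopic_loops_imp_loop[OF assms]
      homotopic_loops_imp_subset[OF assms] by (auto simp: path_between_def pathstart_def pathfinish_def)
  define \<sigma> where "\<sigma> t = h (t, 0)" for t
  have \<sigma>: "path_between M (p 0) c \<sigma>"
  proof -
    have "continuous_on {0..1} \<sigma>" unfolding \<sigma>_def
      by (rule continuous_on_compose2[OF h(1)]) (auto intro!: continuous_intros)
    then show ?thesis using h(2) h0[of 0] h1[of 0]
      by (auto simp: path_between_def path_def path_image_def pathstart_def pathfinish_def \<sigma>_def)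
  qed
  have seg: "closed_segment x y \<subseteq> ?Q" if "x \<in> ?Q" "y \<in> ?Q" for x y
    using that by (intro closed_segment_subset convex_Times) auto
  let ?\<beta> = "linepath (0,0) (1,0) +++ (linepath (1,0) (1,1) +++ linepath (1,1) (0::real,1::real))"
  have im: "path_image ?\<beta> \<subseteq> ?Q"
    by (intro subset_path_image_join) (use seg in auto)
  have "homotopic_paths ?Q (linepath (0,0) (0,1)) ?\<beta>"
  proof (rule homotopic_paths_linear)
    fix t :: real assume t: "t \<in> {0..1}"
    have "linepath (0,0) (0,1) t \<in> ?Q" using t by (auto simp: linepath_def)
    moreover have "?\<beta> t \<in> ?Q" using im t by (auto simp: path_image_def)
    ultimately show "closed_segment (linepath (0,0) (0,1) t) (?\<beta> t) \<subseteq> ?Q" by (rule seg)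
  qed auto
  from homotopic_paths_continuous_image[OF this h]
  have *: "homotopic_paths M (h \<circ> linepath (0,0) (0,1)) (h \<circ> ?\<beta>)" .
  have "homotopic_paths M p (h \<circ> linepath (0,0) (0,1))"
    by (rule homotopic_paths_eq) (use p h0 in \<open>auto simp: path_between_def linepath_def\<close>)
  also note *
  also have "homotopic_paths M (h \<circ> ?\<beta>) (\<sigma> +++ ((\<lambda>_. c) +++ reversepath \<sigma>))"
  proof (rule homotopic_paths_eq)
    show "path (h \<circ> ?\<beta>)" "path_image (h \<circ> ?\<beta>) \<subseteq> M"
      using homotopic_paths_imp_path[OF *] homotopic_paths_imp_subset[OF *] by auto
    fix t :: real assume t: "t \<in> {0..1}"
    \<comment> \<open>On the last edge the second coordinate is 1. There \<open>ends\<close> at the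
      parameter \<open>4 * (1 - t)\<close> replaces it by 0, which yields the reversed
      track.\<close>
    show "(h \<circ> ?\<beta>) t = (\<sigma> +++ ((\<lambda>_. c) +++ reversepath \<sigma>)) t"
      using t ends[of "4 * (1 - t)"] ends h1 by (auto simp: joinpaths_def linepath_def \<sigma>_def reversepath_def)
  qed
  also have "homotopic_paths M \<dots> (\<sigma> +++ reversepath \<sigma>)"
    by (intro homotopic_paths_join homotopic_between_refl[OF \<sigma>] homotopic_between_lid[OF path_between_rev[OF \<sigma>]])
      (use \<sigma> in \<open>auto simp: path_between_def\<close>)
  also have "homotopic_paths M \<dots> (\<lambda>_. p 0)" by (rule homotopic_between_rinv[OF \<sigma>])
  finally show ?thesis by (simp add: pathstart_def)
qed

section \<open>The fundamental group as a group of path classes\<close>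

definition path_class :: "'a::topological_space set \<Rightarrow> (real \<Rightarrow> 'a) \<Rightarrow> (real \<Rightarrow> 'a) set" where
  "path_class M p = {q. homotopic_paths M p q}"

lemma path_class_eq:
  assumes p: "path_between M x y p"
  shows "path_class M p = path_class M q \<longleftrightarrow> homotopic_paths M p q"
  unfolding path_class_def
proof
  assume "{r. homotopic_paths M p r} = {r. homotopic_paths M q r}"
  then have "homotopic_paths M q p" using homotopic_between_refl[OF p] by blast
  then show "homotopic_paths M p q" by (rule homotopic_paths_sym)
next
  assume h: "homotopic_paths M p q"
  then show "{r. homotopic_paths M p r} = {r. homotopic_paths M q r}"
    using homotopic_paths_trans homotopic_paths_sym by blast
qed

lemma carrier_pi1: "carrier (pi1 M a) = {path_class M p | p. path_between M a a p}"
  by (simp add: pi1_def path_class_def path_between_def conj_ac)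

lemma one_pi1: "\<one>\<^bsub>pi1 M a\<^esub> = path_class M (\<lambda>_. a)"
  by (simp add: pi1_def path_class_def)

lemma mult_pi1:
  assumes p: "path_between M a a p" and q: "path_between M a a q"
  shows "path_class M p \<otimes>\<^bsub>pi1 M a\<^esub> path_class M q = path_class M (p +++ q)"
proof -
  have "homotopic_paths M (p +++ q) r \<longleftrightarrow>
    (\<exists>p'. homotopic_paths M p p' \<and> (\<exists>q'. homotopic_paths M q q' \<and> homotopic_paths M (p' +++ q') r))" for r
  proof
    assume "homotopic_paths M (p +++ q) r"
    then show "\<exists>p'. homotopic_paths M p p' \<and> (\<exists>q'. homotopic_paths M q q' \<and> homotopic_paths M (p' +++ q') r)"
      using homotopic_between_refl[OF p] homotopic_between_refl[OF q] by blast
  next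
    assume "\<exists>p'. homotopic_paths M p p' \<and> (\<exists>q'. homotopic_paths M q q' \<and> homotopic_paths M (p' +++ q') r)"
    then obtain p' q' where *: "homotopic_paths M p p'" "homotopic_paths M q q'" "homotopic_paths M (p' +++ q') r" by blast
    have "homotopic_paths M (p +++ q) (p' +++ q')"
      using p q by (intro homotopic_paths_join *) (auto simp: path_between_def)
    then show "homotopic_paths M (p +++ q) r" using *(3) by (rule homotopic_paths_trans)
  qed
  then show ?thesis by (auto simp: pi1_def path_class_def)
qed

lemma group_pi1:
  assumes a: "a \<in> M" shows "group (pi1 M a)"
proof (rule groupI)
  fix x y z assume "x \<in> carrier (pi1 M a)" "y \<in> carrier (pi1 M a)" "z \<in> carrier (pi1 M a)"
  then obtain p q r where p: "x = path_class M p" "path_between M a a p"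
    and q: "y = path_class M q" "path_between M a a q" and r: "z = path_class M r" "path_between M a a r"
    unfolding carrier_pi1 by blast
  show "x \<otimes>\<^bsub>pi1 M a\<^esub> y \<in> carrier (pi1 M a)"
    using p q mult_pi1 path_between_join unfolding carrier_pi1 by blast
  have "homotopic_paths M ((p +++ q) +++ r) (p +++ (q +++ r))"
    by (rule homotopic_paths_sym, rule homotopic_paths_assoc) (use p q r in \<open>auto simp: path_between_def\<close>)
  then show "x \<otimes>\<^bsub>pi1 M a\<^esub> y \<otimes>\<^bsub>pi1 M a\<^esub> z = x \<otimes>\<^bsub>pi1 M a\<^esub> (y \<otimes>\<^bsub>pi1 M a\<^esub> z)"
    using p q r by (simp add: mult_pi1 path_between_join path_class_eq[OF path_between_join[OF path_between_join]])
next
  note c = path_between_const[OF a]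
  show "\<one>\<^bsub>pi1 M a\<^esub> \<in> carrier (pi1 M a)" using c unfolding carrier_pi1 one_pi1 by blast
  fix x assume "x \<in> carrier (pi1 M a)"
  then obtain p where p: "x = path_class M p" "path_between M a a p" unfolding carrier_pi1 by blast
  show "\<one>\<^bsub>pi1 M a\<^esub> \<otimes>\<^bsub>pi1 M a\<^esub> x = x"
    using p c homotopic_between_lid[OF p(2)]
    by (simp add: one_pi1 mult_pi1 path_class_eq[OF path_between_join])
  have "path_class M (reversepath p) \<otimes>\<^bsub>pi1 M a\<^esub> x = \<one>\<^bsub>pi1 M a\<^esub>"
    using p homotopic_between_linv[OF p(2)]
    by (simp add: one_pi1 mult_pi1 path_between_rev path_class_eq[OF path_between_join[OF path_between_rev[OF p(2)] p(2)]])
  then show "\<exists>y\<in>carrier (pi1 M a). y \<otimes>\<^bsub>pi1 M a\<^esub> x = \<one>\<^bsub>pi1 M a\<^esub>"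
    using path_between_rev[OF p(2)] p unfolding carrier_pi1 by blast
qed

section \<open>Holonomy along paths\<close>

text \<open>\<open>A\<close> chooses access paths from the base point throughout its path component.
  They close every path there up to a loop, so that classes of open paths can be multiplied in
  \<open>pi1\<close>.\<close>

locale based_space =
  fixes M :: "'a::topological_space set" and a :: 'a and A :: "'a \<Rightarrow> real \<Rightarrow> 'a"
  assumes base_in: "a \<in> M" and base_path: "A a = (\<lambda>_. a)"
    and access: "path_between M a x p \<Longrightarrow> path_between M a x (A x)"
begin

definition reached :: "'a set" where "reached = {x. \<exists>p. path_between M a x p}"

definition based_class :: "(real \<Rightarrow> 'a) \<Rightarrow> (real \<Rightarrow> 'a) set" where
  "based_class p = path_class M (A (pathstart p) +++ (p +++ reversepath (A (pathfinish p))))"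

lemma base_reached: "a \<in> reached"
  using path_between_const[OF base_in] by (auto simp: reached_def)

lemma access_reached: "x \<in> reached \<Longrightarrow> path_between M a x (A x)"
  using access by (auto simp: reached_def)

lemma reached_step: "x \<in> reached \<Longrightarrow> path_between M x y p \<Longrightarrow> y \<in> reached"
  using path_between_join by (fastforce simp: reached_def)

lemma reached_along:
  assumes "x \<in> reached" "path_between M x y p" "t \<in> {0..1}"
  shows "p t \<in> reached"
proof -
  have "path_between M x (p t) (p \<circ> linepath 0 t)"
  proof -
    have range: "s * t \<in> {0..1}" if "s \<in> {0..1}" for s
      using that assms(3) by (simp add: mult_le_one)
    have "continuous_on {0..1} p" using assms(2) by (simp add: path_between_def path_def)
    then have "continuous_on {0..1} (\<lambda>s. p (s * t))"
      by (rule continuous_on_compose2) (use range in \<open>auto intro!: continuous_intros\<close>)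
    moreover have "p (s * t) \<in> M" if "s \<in> {0..1}" for s
      using path_between_at[OF assms(2) range[OF that]] .
    ultimately have "path (p \<circ> linepath 0 t)" "path_image (p \<circ> linepath 0 t) \<subseteq> M"
      unfolding path_def path_image_def by (simp_all add: linepath_def o_def image_subset_iff)
    then show ?thesis using path_between_ends[OF assms(2)]
      by (auto simp: path_between_def pathstart_def pathfinish_def linepath_def)
  qed
  then show ?thesis using reached_step assms by blast
qed

lemma based_path:
  assumes "x \<in> reached" "path_between M x y p"
  shows "path_between M a a (A x +++ (p +++ reversepath (A y)))"
  using assms reached_step access_reached by (meson path_between_join path_between_rev)

lemma based_class_eq:
  "path_between M x y p \<Longrightarrow> based_class p = path_class M (A x +++ (p +++ reversepath (A y)))"
  by (simp add: based_class_def path_between_def)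

lemma based_class_closed:
  "x \<in> reached \<Longrightarrow> path_between M x y p \<Longrightarrow> based_class p \<in> carrier (pi1 M a)"
  using based_path based_class_eq unfolding carrier_pi1 by blast

lemma based_class_cong:
  assumes x: "x \<in> reached" and p: "path_between M x y p" and h: "homotopic_paths M p q"
  shows "based_class p = based_class q"
proof -
  have q: "path_between M x y q" using homotopic_paths_path_between[OF h p] .
  have y: "y \<in> reached" using reached_step x p by blast
  have "homotopic_paths M (A x +++ (p +++ reversepath (A y))) (A x +++ (q +++ reversepath (A y)))"
    using p access_reached[OF x] access_reached[OF y] path_between_rev[OF access_reached[OF y]]
    by (intro homotopic_paths_join h) (auto simp: path_between_def)
  then show ?thesis
    using path_class_eq[OF based_path[OF x p]] based_class_eq[OF p] based_class_eq[OF q] by simp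
qed

text \<open>The access path of the middle point is run backwards and then forwards, which cancels up
  to homotopy.\<close>

lemma based_class_join:
  assumes x: "x \<in> reached" and p: "path_between M x y p" and q: "path_between M y z q"
  shows "based_class (p +++ q) = based_class p \<otimes>\<^bsub>pi1 M a\<^esub> based_class q"
proof -
  have y: "y \<in> reached" and z: "z \<in> reached" using reached_step x p q by blast+
  note A = access_reached[OF x] access_reached[OF y] access_reached[OF z]
  note B = path_between_rev[OF A(2)] path_between_rev[OF A(3)]
  note ends = path_between_ends[OF p] path_between_ends[OF q]
  let ?x = "A x" and ?y = "A y" and ?y' = "reversepath (A y)" and ?z' = "reversepath (A z)"
  have "homotopic_paths M ((?x +++ (p +++ ?y')) +++ ?y) (((?x +++ p) +++ ?y') +++ ?y)"
    using A B p q by (intro homotopic_paths_join homotopic_paths_assoc) (auto simp: path_between_def)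
  also have "homotopic_paths M \<dots> ((?x +++ p) +++ (?y' +++ ?y))"
    using A B p q
    by (intro homotopic_paths_sym[OF homotopic_paths_assoc])
      (auto simp: path_between_def path_image_join)
  also have "homotopic_paths M \<dots> ((?x +++ p) +++ (\<lambda>_. y))"
    using path_between_join[OF A(1) p] A B p
    by (intro homotopic_paths_join homotopic_between_linv[OF A(2)] homotopic_between_refl) (auto simp: path_between_def)
  also have "homotopic_paths M \<dots> (?x +++ p)"
    by (rule homotopic_between_rid[OF path_between_join[OF A(1) p]])
  finally have *: "homotopic_paths M ((?x +++ (p +++ ?y')) +++ ?y) (?x +++ p)" .
  have "homotopic_paths M ((?x +++ (p +++ ?y')) +++ (?y +++ (q +++ ?z')))
          (((?x +++ (p +++ ?y')) +++ ?y) +++ (q +++ ?z'))"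
    using A B p q by (intro homotopic_paths_assoc) (auto simp: path_between_def path_image_join)
  also have "homotopic_paths M \<dots> ((?x +++ p) +++ (q +++ ?z'))"
    using A B p q path_between_join[OF q B(2)]
    by (intro homotopic_paths_join * homotopic_between_refl) (auto simp: path_between_def)
  also have "homotopic_paths M \<dots> (?x +++ (p +++ (q +++ ?z')))"
    using A B p q path_between_join[OF q B(2)]
    by (intro homotopic_paths_sym[OF homotopic_paths_assoc]) (auto simp: path_between_def)
  also have "homotopic_paths M \<dots> (?x +++ ((p +++ q) +++ ?z'))"
    using A B p q by (intro homotopic_paths_join homotopic_paths_assoc) (auto simp: path_between_def)
  finally have "path_class M ((?x +++ (p +++ ?y')) +++ (?y +++ (q +++ ?z'))) = path_class M (?x +++ ((p +++ q) +++ ?z'))"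
    using path_class_eq[OF path_between_join[OF based_path[OF x p] based_path[OF y q]]] by simp
  then show ?thesis
    using mult_pi1[OF based_path[OF x p] based_path[OF y q]]
    by (simp add: based_class_eq[OF p] based_class_eq[OF q] based_class_eq[OF path_between_join[OF p q]])
qed

lemma based_class_const:
  assumes x: "x \<in> reached" shows "based_class (\<lambda>_. x) = \<one>\<^bsub>pi1 M a\<^esub>"
proof -
  note A = access_reached[OF x]
  have xM: "x \<in> M" using path_between_ends[OF A] by blast
  have "homotopic_paths M (A x +++ ((\<lambda>_. x) +++ reversepath (A x))) (A x +++ reversepath (A x))"
    using A by (intro homotopic_paths_join homotopic_between_lid[OF path_between_rev[OF A]] homotopic_between_refl[OF A])
      (auto simp: path_between_def)
  also have "homotopic_paths M \<dots> (\<lambda>_. a)" by (rule homotopic_between_rinv[OF A])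
  finally show ?thesis
    using path_class_eq[OF based_path[OF x path_between_const[OF xM]]]
    by (simp add: based_class_eq[OF path_between_const[OF xM]] one_pi1)
qed

lemma based_class_loop:
  assumes p: "path_between M a a p" shows "based_class p = path_class M p"
proof -
  have c: "reversepath (\<lambda>_. a) = (\<lambda>_. a)" by (simp add: reversepath_def)
  have "homotopic_paths M ((\<lambda>_. a) +++ (p +++ (\<lambda>_. a))) (p +++ (\<lambda>_. a))"
    by (rule homotopic_between_lid[OF path_between_join[OF p path_between_const[OF base_in]]])
  also have "homotopic_paths M \<dots> p" by (rule homotopic_between_rid[OF p])
  finally show ?thesis
    using path_class_eq[OF based_path[OF base_reached p]] based_class_eq[OF p] by (simp add: base_path c)
qed

end

text \<open>A cocycle of maps of \<open>S\<close> is a flat bundle with fibre \<open>S\<close>; its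
  parallel transport is computed by sampling the labels along a path. \<open>g u v\<close> leads
  from the fibre over \<open>v\<close> to the fibre over \<open>u\<close>.\<close>

locale path_transport =
  fixes lab :: "'a::topological_space \<Rightarrow> 'v" and adj :: "'v \<Rightarrow> 'v \<Rightarrow> bool"
    and S :: "'s set" and g :: "'v \<Rightarrow> 'v \<Rightarrow> 's \<Rightarrow> 's"
  assumes g_refl: "adj u u \<Longrightarrow> s \<in> S \<Longrightarrow> g u u s = s"
    and g_closed: "adj u v \<Longrightarrow> s \<in> S \<Longrightarrow> g u v s \<in> S"
    and g_cocycle: "adj u v \<Longrightarrow> adj v w \<Longrightarrow> adj u w \<Longrightarrow> s \<in> S \<Longrightarrow> g u v (g v w s) = g u w s"
begin

abbreviation first_half :: "(real \<Rightarrow> 'a) \<Rightarrow> real \<Rightarrow> 'a" where "first_half p \<equiv> \<lambda>t. p (t / 2)"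
abbreviation second_half :: "(real \<Rightarrow> 'a) \<Rightarrow> real \<Rightarrow> 'a" where "second_half p \<equiv> \<lambda>t. p ((t + 1) / 2)"

text \<open>The composition of \<open>g\<close> over \<open>2 ^ k\<close> dyadic intervals. The
  second half acts first because of the direction of \<open>g\<close>.\<close>

primrec transport :: "nat \<Rightarrow> (real \<Rightarrow> 'a) \<Rightarrow> 's \<Rightarrow> 's" where
  "transport 0 p s = g (lab (p 0)) (lab (p 1)) s"
| "transport (Suc k) p s = transport k (first_half p) (transport k (second_half p) s)"

text \<open>For \<open>p = q\<close> the samples at scale \<open>k\<close> meet only touching
  labels. For two paths, the squares of the ladder between them split into touching triples.\<close>

definition close_paths :: "nat \<Rightarrow> (real \<Rightarrow> 'a) \<Rightarrow> (real \<Rightarrow> 'a) \<Rightarrow> bool" where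
  "close_paths k p q \<longleftrightarrow> (\<forall>t\<in>{0..1}. \<forall>t'\<in>{0..1}. \<bar>t - t'\<bar> \<le> 1 / 2 ^ k \<longrightarrow> adj (lab (p t)) (lab (q t')))"

lemma close_paths_halves:
  assumes "close_paths (Suc k) p q"
  shows "close_paths k (first_half p) (first_half q)" "close_paths k (second_half p) (second_half q)"
proof -
  have half: "\<bar>s / 2 - t / 2\<bar> \<le> 1 / 2 ^ Suc k" if "\<bar>s - t\<bar> \<le> 1 / 2 ^ k" for s t :: real
  proof -
    have "\<bar>s / 2 - t / 2\<bar> = \<bar>s - t\<bar> / 2" by (simp flip: diff_divide_distrib)
    then show ?thesis using that by (simp add: field_simps)
  qed
  show "close_paths k (first_half p) (first_half q)" unfolding close_paths_def
  proof (intro ballI impI)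
    fix t t' :: real assume t: "t \<in> {0..1}" "t' \<in> {0..1}" "\<bar>t - t'\<bar> \<le> 1 / 2 ^ k"
    show "adj (lab (p (t / 2))) (lab (q (t' / 2)))"
      by (rule assms[unfolded close_paths_def, rule_format]) (use t half in auto)
  qed
  show "close_paths k (second_half p) (second_half q)" unfolding close_paths_def
  proof (intro ballI impI)
    fix t t' :: real assume t: "t \<in> {0..1}" "t' \<in> {0..1}" "\<bar>t - t'\<bar> \<le> 1 / 2 ^ k"
    have "(t + 1) / 2 - (t' + 1) / 2 = t / 2 - t' / 2" by (simp add: field_simps)
    then have "\<bar>(t + 1) / 2 - (t' + 1) / 2\<bar> \<le> 1 / 2 ^ Suc k" using half[OF t(3)] by simp
    then show "adj (lab (p ((t + 1) / 2))) (lab (q ((t' + 1) / 2)))"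
      by (rule assms[unfolded close_paths_def, rule_format, rotated 2]) (use t in auto)
  qed
qed

lemma close_paths_mono:
  assumes "close_paths k p q" "k \<le> m" shows "close_paths m p q"
proof -
  have "1 / 2 ^ m \<le> (1 / 2 ^ k :: real)" using assms(2) by (simp add: frac_le)
  then show ?thesis using assms(1) unfolding close_paths_def by (meson order_trans)
qed

lemma close_paths_0:
  "close_paths 0 p q \<Longrightarrow> t \<in> {0..1} \<Longrightarrow> t' \<in> {0..1} \<Longrightarrow> adj (lab (p t)) (lab (q t'))"
  unfolding close_paths_def by auto

lemma transport_cong:
  "(\<And>t. t \<in> {0..1} \<Longrightarrow> p t = q t) \<Longrightarrow> transport k p s = transport k q s"
proof (induction k arbitrary: p q s)
  case (Suc k)
  have "transport k (first_half p) s' = transport k (first_half q) s'"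
    "transport k (second_half p) s' = transport k (second_half q) s'" for s'
    by (rule Suc.IH, rule Suc.prems, simp)+
  then show ?case by simp
qed simp

lemma transport_closed: "close_paths k p p \<Longrightarrow> s \<in> S \<Longrightarrow> transport k p s \<in> S"
proof (induction k arbitrary: p s)
  case 0 then show ?case using g_closed close_paths_0 by simp
next
  case (Suc k)
  then show ?case using close_paths_halves[OF Suc.prems(1)] by simp
qed

text \<open>As all labels on the path touch each other, the cocycle condition collapses every
  subdivision to the two ends.\<close>

lemma transport_0: "close_paths 0 p p \<Longrightarrow> s \<in> S \<Longrightarrow> transport k p s = g (lab (p 0)) (lab (p 1)) s"
proof (induction k arbitrary: p s)
  case (Suc k)
  have c: "close_paths 0 (first_half p) (first_half p)" "close_paths 0 (second_half p) (second_half p)"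
    using close_paths_0[OF Suc.prems(1)] unfolding close_paths_def by auto
  have "transport k (second_half p) s = g (lab (p (1/2))) (lab (p 1)) s" using Suc.IH[OF c(2)] Suc.prems by simp
  moreover have "\<dots> \<in> S" using g_closed close_paths_0[OF Suc.prems(1)] Suc.prems by simp
  ultimately show ?case using Suc.IH[OF c(1)] Suc.prems close_paths_0[OF Suc.prems(1)] g_cocycle by simp
qed simp

lemma transport_refine: "close_paths k p p \<Longrightarrow> s \<in> S \<Longrightarrow> transport (k + m) p s = transport k p s"
proof (induction k arbitrary: p s)
  case 0 then show ?case using transport_0 by simp
next
  case (Suc k)
  note c = close_paths_halves[OF Suc.prems(1)]
  show ?case using Suc.IH[OF c(1) transport_closed[OF c(2)]] Suc.IH[OF c(2)] Suc.prems by simp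
qed

text \<open>Each square of the ladder between close paths consists of two triangles to which the
  cocycle condition applies; halving the paths composes the squares.\<close>

lemma transport_near:
  assumes "close_paths k p p" "close_paths k p q" "close_paths k q p" "close_paths k q q" "s \<in> S"
  shows "transport k p (g (lab (p 1)) (lab (q 1)) s) = g (lab (p 0)) (lab (q 0)) (transport k q s)"
  using assms
proof (induction k arbitrary: p q s)
  case 0
  then show ?case using close_paths_0 g_cocycle by simp
next
  case (Suc k)
  note c = Suc.prems(1-4)[THEN close_paths_halves(1)] and d = Suc.prems(1-4)[THEN close_paths_halves(2)]
  have "transport k (second_half p) (g (lab (p 1)) (lab (q 1)) s) =
      g (lab (p (1/2))) (lab (q (1/2))) (transport k (second_half q) s)"
    using Suc.IH[OF d Suc.prems(5)] by simp
  then show ?case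
    using Suc.IH[OF c transport_closed[OF d(4) Suc.prems(5)]] by simp
qed

text \<open>Every sufficiently fine scale gives the same transport on \<open>S\<close>, by
  \<open>holonomy_eq\<close>; the least one is just a canonical choice.\<close>

definition holonomy :: "(real \<Rightarrow> 'a) \<Rightarrow> 's \<Rightarrow> 's" where
  "holonomy p = transport (LEAST k. close_paths k p p) p"

lemma holonomy_eq: "close_paths k p p \<Longrightarrow> s \<in> S \<Longrightarrow> holonomy p s = transport k p s"
proof -
  assume c: "close_paths k p p" and s: "s \<in> S"
  let ?m = "LEAST k. close_paths k p p"
  have "close_paths ?m p p" using c by (rule LeastI)
  moreover have "?m \<le> k" using c by (rule Least_le)
  then obtain j where j: "k = ?m + j" using le_iff_add by blast
  ultimately have "transport (?m + j) p s = transport ?m p s" using transport_refine s by blast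
  then show ?thesis unfolding holonomy_def using j by metis
qed

lemma holonomy_closed: "close_paths k p p \<Longrightarrow> s \<in> S \<Longrightarrow> holonomy p s \<in> S"
  using holonomy_eq transport_closed by metis

lemma holonomy_join:
  assumes "close_paths k (p +++ q) (p +++ q)" "close_paths k p p" "close_paths k q q" "p 1 = q 0" "s \<in> S"
  shows "holonomy (p +++ q) s = holonomy p (holonomy q s)"
proof -
  have "holonomy (p +++ q) s = transport (Suc k) (p +++ q) s"
    using holonomy_eq close_paths_mono[OF assms(1)] assms(5) by (metis le_add2 plus_1_eq_Suc)
  also have "\<dots> = transport k (first_half (p +++ q)) (transport k (second_half (p +++ q)) s)" by simp
  also have "transport k (second_half (p +++ q)) s = transport k q s"
    by (rule transport_cong) (use assms(4) in \<open>auto simp: joinpaths_def field_simps\<close>)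
  also have "\<dots> = holonomy q s" using holonomy_eq[OF assms(3,5)] by simp
  also have "transport k (first_half (p +++ q)) (holonomy q s) = transport k p (holonomy q s)"
    by (rule transport_cong) (auto simp: joinpaths_def)
  also have "\<dots> = holonomy p (holonomy q s)"
    using holonomy_eq[OF assms(2) holonomy_closed[OF assms(3,5)]] by simp
  finally show ?thesis .
qed

lemma holonomy_cong:
  assumes "\<And>t. t \<in> {0..1} \<Longrightarrow> p t = q t"
  shows "holonomy p s = holonomy q s"
proof -
  have "close_paths k p p = close_paths k q q" for k using assms by (simp add: close_paths_def)
  then show ?thesis unfolding holonomy_def using transport_cong[of p q] assms by simp
qed

lemma holonomy_const: "adj (lab x) (lab x) \<Longrightarrow> s \<in> S \<Longrightarrow> holonomy (\<lambda>_. x) s = s"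
  using holonomy_eq[of 0 "\<lambda>_. x"] g_refl by (simp add: close_paths_def)

text \<open>The square is cut into \<open>2 ^ k\<close> strips so thin that consecutive paths are
  close. Since all these paths have the same ends, the end rungs of each ladder act as the
  identity.\<close>

lemma holonomy_homotopy:
  fixes h :: "real \<times> real \<Rightarrow> 'a"
  assumes fine: "\<And>t t' r r'. t \<in> {0..1} \<Longrightarrow> t' \<in> {0..1} \<Longrightarrow> r \<in> {0..1} \<Longrightarrow> r' \<in> {0..1} \<Longrightarrow>
      \<bar>t - t'\<bar> \<le> 1 / 2 ^ k \<Longrightarrow> \<bar>r - r'\<bar> \<le> 1 / 2 ^ k \<Longrightarrow> adj (lab (h (r, t))) (lab (h (r', t')))"
    and ends: "\<And>r. r \<in> {0..1} \<Longrightarrow> h (r, 0) = x \<and> h (r, 1) = y" and s: "s \<in> S"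
  shows "holonomy (\<lambda>t. h (0, t)) s = holonomy (\<lambda>t. h (1, t)) s"
proof -
  have close: "close_paths k (\<lambda>t. h (r, t)) (\<lambda>t. h (r', t))"
    if "r \<in> {0..1}" "r' \<in> {0..1}" "\<bar>r - r'\<bar> \<le> 1 / 2 ^ k" for r r'
    using fine that unfolding close_paths_def by blast
  have refl: "adj (lab x) (lab x)" "adj (lab y) (lab y)" using fine[of 0 0 0 0] fine[of 1 1 0 0] ends[of 0] by auto
  have step: "transport k (\<lambda>t. h (r, t)) s = transport k (\<lambda>t. h (r', t)) s"
    if r: "r \<in> {0..1}" "r' \<in> {0..1}" "\<bar>r - r'\<bar> \<le> 1 / 2 ^ k" for r r'
  proof -
    have "\<bar>r' - r\<bar> \<le> 1 / 2 ^ k" using r by simp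
    then have "transport k (\<lambda>t. h (r, t)) (g (lab y) (lab y) s) = g (lab x) (lab x) (transport k (\<lambda>t. h (r', t)) s)"
      using transport_near[OF close close close close s, of r r' ] r ends by simp
    then show ?thesis
      using g_refl refl s transport_closed[OF close[OF r(2) r(2)] s] by simp
  qed
  have "transport k (\<lambda>t. h (0, t)) s = transport k (\<lambda>t. h (real j / 2 ^ k, t)) s" if "j \<le> 2 ^ k" for j
    using that
  proof (induction j)
    case (Suc j)
    have j: "real j \<le> 2 ^ k" "real (Suc j) \<le> 2 ^ k"
      using Suc.prems by (metis Suc_leD of_nat_le_iff of_nat_numeral of_nat_power)+
    have "transport k (\<lambda>t. h (real j / 2 ^ k, t)) s = transport k (\<lambda>t. h (real (Suc j) / 2 ^ k, t)) s"
      by (rule step) (use j in \<open>auto simp: field_simps\<close>)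
    then show ?case using Suc by simp
  qed simp
  from this[of "2 ^ k"] have "transport k (\<lambda>t. h (0, t)) s = transport k (\<lambda>t. h (1, t)) s" by simp
  then show ?thesis using holonomy_eq[OF close s] by simp
qed

end

section \<open>Spaces partitioned into few small cells\<close>

text \<open>\<open>len p L\<close> reads: \<open>p\<close> has length at most \<open>L\<close>;
  loops shorter than \<open>s\<close> are contractible. The bound \<open>h\<close> in
  \<open>ctr_adj\<close> is the sharp one, because walks of many steps are measured by it. The other
  bounds only enter loops of length at most \<open>15 * h\<close>, which the generous
  \<open>20 * h < s\<close> makes contractible.\<close>

locale fine_cells =
  fixes M :: "'a::topological_space set" and D :: "'a \<Rightarrow> 'a \<Rightarrow> real" and lab :: "'a \<Rightarrow> 'v"
    and len :: "(real \<Rightarrow> 'a) \<Rightarrow> real \<Rightarrow> bool" and ctr :: "'v \<Rightarrow> 'a" and h s :: real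
  assumes D_sym: "D x y = D y x" and D_refl: "D x x = 0"
    and uniform: "\<And>(f :: real \<times> real \<Rightarrow> 'a) e. continuous_on ({0..1} \<times> {0..1}) f \<Longrightarrow> f ` ({0..1} \<times> {0..1}) \<subseteq> M \<Longrightarrow> 0 < e \<Longrightarrow>
      \<exists>d>0. \<forall>p\<in>{0..1} \<times> {0..1}. \<forall>q\<in>{0..1} \<times> {0..1}. dist p q < d \<longrightarrow> D (f p) (f q) < e"
    and finite_lab: "finite (lab ` M)"
    and len_join: "path_between M x y p \<Longrightarrow> path_between M y z q \<Longrightarrow> len p L \<Longrightarrow> len q L' \<Longrightarrow> len (p +++ q) (L + L')"
    and len_rev: "path_between M x y p \<Longrightarrow> len p L \<Longrightarrow> len (reversepath p) L"
    and len_const: "x \<in> M \<Longrightarrow> len (\<lambda>_. x) 0"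
    and len_mono: "len p L \<Longrightarrow> L \<le> L' \<Longrightarrow> len p L'"
    and len_null: "path_between M x x p \<Longrightarrow> len p L \<Longrightarrow> L < s \<Longrightarrow> homotopic_paths M p (\<lambda>_. x)"
    and jump: "\<And>e. 0 < e \<Longrightarrow> \<exists>d>0. \<forall>x\<in>M. \<forall>y\<in>M. D x y < d \<longrightarrow>
      (\<exists>J. path_between M x y J \<and> len J e \<and> (\<forall>t\<in>{0..1}. \<forall>t'\<in>{0..1}. D (J t) (J t') < e))"
    and local: "\<exists>d>0. \<forall>x y p q. path_between M x y p \<longrightarrow> path_between M x y q \<longrightarrow>
      (\<forall>t\<in>{0..1}. D x (p t) < d \<and> D x (q t) < d) \<longrightarrow> homotopic_paths M p q"
    and cell: "x \<in> M \<Longrightarrow> y \<in> M \<Longrightarrow> lab x = lab y \<Longrightarrow>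
      \<exists>p. path_between M x y p \<and> len p (2 * h) \<and> (\<forall>t\<in>{0..1}. lab (p t) = lab x)"
    and ctr: "x \<in> M \<Longrightarrow> \<exists>p. path_between M x (ctr (lab x)) p \<and> len p h"
    and ctr_adj: "\<forall>d>0. \<exists>x\<in>M. \<exists>y\<in>M. D x y < d \<and> lab x = u \<and> lab y = v \<Longrightarrow>
      \<exists>p. path_between M (ctr u) (ctr v) p \<and> len p h"
    and h_pos: "0 < h" and h_small: "20 * h < s"
begin

lemma same_ends_homotopic:
  assumes p: "path_between M x y p" "len p L" and q: "path_between M x y q" "len q L'" and L: "L + L' < s"
  shows "homotopic_paths M p q"
proof (rule homotopic_between_cancel[OF p(1) q(1)])
  show "homotopic_paths M (p +++ reversepath q) (\<lambda>_. x)"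
    by (rule len_null[OF path_between_join[OF p(1) path_between_rev[OF q(1)]]
          len_join[OF p(1) path_between_rev[OF q(1)] p(2) len_rev[OF q]] L])
qed

lemma path_uniform:
  assumes p: "path_between M x y p" and e: "0 < e"
  shows "\<exists>k. \<forall>t\<in>{0..1}. \<forall>t'\<in>{0..1}. \<bar>t - t'\<bar> \<le> 1 / 2 ^ k \<longrightarrow> D (p t) (p t') < e"
proof -
  have "continuous_on ({0..1} \<times> {0..1}) (\<lambda>z. p (snd z))"
    using p unfolding path_between_def path_def
    by (intro continuous_on_compose2[of "{0..1}" p _ snd]) (auto intro!: continuous_intros)
  moreover have "(\<lambda>z. p (snd z)) ` ({0..1::real} \<times> {0..1}) \<subseteq> M"
    using path_between_at[OF p] by auto
  ultimately obtain d where d: "d > 0" and close: "\<forall>z\<in>{0..1::real} \<times> {0..1}. \<forall>z'\<in>{0..1} \<times> {0..1}. dist z z' < d \<longrightarrow> D (p (snd z)) (p (snd z')) < e"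
    using uniform e by blast
  obtain k where k: "(1/2) ^ k < d" using d real_arch_pow_inv[of d "1/2"] by auto
  have "D (p t) (p t') < e" if "t \<in> {0..1}" "t' \<in> {0..1}" "\<bar>t - t'\<bar> \<le> 1 / 2 ^ k" for t t'
  proof -
    have "dist (0::real, t) (0, t') < d" using that k by (simp add: dist_prod_def dist_real_def power_one_over)
    then show ?thesis using close that by force
  qed
  then show ?thesis by blast
qed

text \<open>The graph consists of the cells in the path component of \<open>a\<close>, and
  \<open>t\<close> is given by short paths between touching cells. Sampling a path shows that their
  classes generate, holonomy along loops gives the universal property, and moving to the centres
  turns short walks into short loops.\<close>

theorem free_pi1:
  assumes a: "a \<in> M" and R: "(2 * real R + 1) * h < s" and card: "card (lab ` M) < (R + 1)\<^sup>2"
  shows "free_group (pi1 M a)"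
proof -
  define A where "A x = (if x = a then (\<lambda>_. a) else SOME p. path_between M a x p)" for x
  interpret based_space M a A
  proof
    show "path_between M a x (A x)" if "path_between M a x p" for x p
      using that someI[of "path_between M a x" p] path_between_const[OF a] by (auto simp: A_def)
  qed (auto simp: a A_def)
  interpret P: group "pi1 M a" by (rule group_pi1[OF a])
  have reached_M: "reached \<subseteq> M" using access_reached path_between_ends by blast
  define V where "V = lab ` reached"
  \<comment> \<open>Touching means having points at arbitrarily small \<open>D\<close>-distance.
    Since there are finitely many pairs of cells, one threshold \<open>\<delta>\<close> works for
    all pairs that do not touch.\<close>
  define adj where "adj u v \<longleftrightarrow> (\<forall>d>0. \<exists>x\<in>reached. \<exists>y\<in>reached. D x y < d \<and> lab x = u \<and> lab y = v)" for u v
  have finV: "finite V" using finite_lab reached_M unfolding V_def by (meson finite_subset image_mono)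
  have adjV: "u \<in> V \<and> v \<in> V" if "adj u v" for u v
    using that zero_less_one unfolding adj_def V_def by blast
  have adj_refl: "adj u u" if "u \<in> V" for u
  proof -
    obtain x where "x \<in> reached" "lab x = u" using \<open>u \<in> V\<close> by (auto simp: V_def)
    then show ?thesis using D_refl[of x] unfolding adj_def by metis
  qed
  have adj_sym: "adj v u" if "adj u v" for u v
    using that D_sym unfolding adj_def by metis
  obtain \<delta> where \<delta>: "\<delta> > 0" and near: "\<And>x y. x \<in> reached \<Longrightarrow> y \<in> reached \<Longrightarrow> D x y < \<delta> \<Longrightarrow> adj (lab x) (lab y)"
  proof -
    let ?B = "{(u, v). u \<in> V \<and> v \<in> V \<and> \<not> adj u v}"
    have "\<forall>w\<in>?B. \<exists>d>0. \<forall>x\<in>reached. \<forall>y\<in>reached. D x y < d \<longrightarrow> \<not> (lab x = fst w \<and> lab y = snd w)"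
    proof
      fix w assume "w \<in> ?B"
      then have "\<not> adj (fst w) (snd w)" by auto
      then show "\<exists>d>0. \<forall>x\<in>reached. \<forall>y\<in>reached. D x y < d \<longrightarrow> \<not> (lab x = fst w \<and> lab y = snd w)"
        unfolding adj_def by blast
    qed
    from bchoice[OF this] obtain \<epsilon> where \<epsilon>_all: "\<forall>w\<in>?B. \<epsilon> w > 0 \<and>
        (\<forall>x\<in>reached. \<forall>y\<in>reached. D x y < \<epsilon> w \<longrightarrow> \<not> (lab x = fst w \<and> lab y = snd w))" ..
    note \<epsilon> = bspec[OF \<epsilon>_all]
    have fin: "finite ?B" by (rule finite_subset[of _ "V \<times> V"]) (use finV in auto)
    define d where "d = Min (insert 1 (\<epsilon> ` ?B))"
    have "d > 0" unfolding d_def using fin \<epsilon>_all by (subst Min_gr_iff) auto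
    moreover have "adj (lab x) (lab y)" if "x \<in> reached" "y \<in> reached" "D x y < d" for x y
    proof (rule ccontr)
      assume "\<not> ?thesis"
      then have w: "(lab x, lab y) \<in> ?B" using that by (auto simp: V_def)
      have "d \<le> \<epsilon> (lab x, lab y)" unfolding d_def using fin w by (intro Min_le) auto
      then have "D x y < \<epsilon> (lab x, lab y)" using that by simp
      then show False using \<epsilon>[OF w] that by auto
    qed
    ultimately show ?thesis using that by blast
  qed
  define u0 where "u0 = lab a"
  have u0: "u0 \<in> V" using base_reached by (auto simp: u0_def V_def)
  \<comment> \<open>With \<open>a\<close> representing its own cell, the corrections
    \<open>A\<close> and \<open>I\<close> are constant at the base point.\<close>
  define b where "b u = (if u = u0 then a else SOME x. x \<in> reached \<and> lab x = u)" for u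
  have b: "b u \<in> reached \<and> lab (b u) = u" if "u \<in> V" for u
  proof (cases "u = u0")
    case False
    have "\<exists>x. x \<in> reached \<and> lab x = u" using that by (auto simp: V_def)
    from someI_ex[OF this] show ?thesis using False by (simp add: b_def)
  qed (auto simp: b_def u0_def base_reached)
  \<comment> \<open>No assumption places \<open>ctr u\<close> inside the cell \<open>u\<close>, so a
    path \<open>Q u\<close> links it to the representative \<open>b u\<close>.\<close>
  have Q_ex: "\<exists>p. path_between M (b u) (ctr u) p \<and> len p h" if "u \<in> V" for u
    using ctr[of "b u"] b[OF that] reached_M by auto
  define Q where "Q u = (SOME p. path_between M (b u) (ctr u) p \<and> len p h)" for u
  have Q: "path_between M (b u) (ctr u) (Q u)" "len (Q u) h" if "u \<in> V" for u
    using someI_ex[OF Q_ex[OF that]] by (auto simp: Q_def)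
  define I where "I x = (if x = a then (\<lambda>_. a) else SOME p. path_between M (b (lab x)) x p \<and> len p (2 * h))" for x
  have I: "path_between M (b (lab x)) x (I x) \<and> len (I x) (2 * h)" if x: "x \<in> reached" for x
  proof (cases "x = a")
    case True
    then show ?thesis using path_between_const[OF a] len_mono[OF len_const[OF a]] h_pos
      by (simp add: I_def b_def u0_def)
  next
    case False
    have "lab x \<in> V" using x by (simp add: V_def)
    then have "\<exists>p. path_between M (b (lab x)) x p \<and> len p (2 * h)"
      using cell[of "b (lab x)" x] b[of "lab x"] x reached_M by auto
    then show ?thesis using False someI_ex[of "\<lambda>p. path_between M (b (lab x)) x p \<and> len p (2 * h)"] by (simp add: I_def)
  qed
  \<comment> \<open>The length is \<open>2 * h\<close> inside each of the two cells and
    \<open>h\<close> for the jump between them. As all labels on the path touch each other, its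
    holonomy is the single map \<open>g u v\<close>.\<close>
  define isE where "isE u v p \<longleftrightarrow> path_between M (b u) (b v) p \<and> len p (5 * h) \<and>
      (\<forall>t\<in>{0..1}. \<forall>t'\<in>{0..1}. adj (lab (p t)) (lab (p t')))" for u v p
  have E_ex: "\<exists>p. isE u v p" if uv: "adj u v" for u v
  proof -
    have e: "min \<delta> h > 0" using \<delta> h_pos by simp
    obtain d where d: "d > 0" and J: "\<And>x y. x \<in> M \<Longrightarrow> y \<in> M \<Longrightarrow> D x y < d \<Longrightarrow>
      (\<exists>J. path_between M x y J \<and> len J (min \<delta> h) \<and> (\<forall>t\<in>{0..1}. \<forall>t'\<in>{0..1}. D (J t) (J t') < min \<delta> h))"
      using jump[OF e] by blast
    obtain x y where xy: "x \<in> reached" "y \<in> reached" "D x y < d" "lab x = u" "lab y = v"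
      using uv d unfolding adj_def by blast
    obtain J where J: "path_between M x y J" "len J (min \<delta> h)" "\<And>t t'. t\<in>{0..1} \<Longrightarrow> t'\<in>{0..1} \<Longrightarrow> D (J t) (J t') < min \<delta> h"
      using J[of x y] xy reached_M by blast
    have V: "u \<in> V" "v \<in> V" using adjV uv by auto
    have inM: "b u \<in> M" "x \<in> M" "y \<in> M" "b v \<in> M" using b[OF V(1)] b[OF V(2)] xy reached_M by auto
    obtain p where p: "path_between M (b u) x p" "len p (2 * h)" "\<And>t. t \<in> {0..1} \<Longrightarrow> lab (p t) = u"
      using cell[OF inM(1,2)] b[OF V(1)] xy(4) by metis
    obtain q where q: "path_between M y (b v) q" "len q (2 * h)" "\<And>t. t \<in> {0..1} \<Longrightarrow> lab (q t) = v"
      using cell[OF inM(3,4)] b[OF V(2)] xy(5) by metis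
    let ?E = "p +++ (J +++ q)"
    have Jq: "path_between M x (b v) (J +++ q)" using path_between_join[OF J(1) q(1)] .
    have "path_between M (b u) (b v) ?E" using path_between_join[OF p(1) Jq] .
    moreover have "len ?E (5 * h)"
      using len_mono[OF len_join[OF p(1) Jq p(2) len_join[OF J(1) q(1) J(2) q(2)]], of "5 * h"] by simp
    moreover have "\<exists>t'\<in>{0..1}. lab (?E t) = lab (J t')" if "t \<in> {0..1}" for t
    proof -
      have "?E t \<in> path_image p \<union> (path_image J \<union> path_image q)"
        using that path_image_join_subset[of p "J +++ q"] path_image_join_subset[of J q]
        unfolding path_image_def by blast
      then consider r where "r \<in> {0..1}" "?E t = p r" | r where "r \<in> {0..1}" "?E t = J r" | r where "r \<in> {0..1}" "?E t = q r"
        unfolding path_image_def by blast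
      then show ?thesis
      proof cases
        case 1 then show ?thesis using p(3) path_between_ends[OF J(1)] xy by (intro bexI[of _ 0]) auto
      next
        case 2 then show ?thesis by metis
      next
        case 3 then show ?thesis using q(3) path_between_ends[OF J(1)] xy by (intro bexI[of _ 1]) auto
      qed
    qed
    moreover have "adj (lab (J t)) (lab (J t'))" if "t \<in> {0..1}" "t' \<in> {0..1}" for t t'
      using near reached_along[OF xy(1) J(1)] J(3) that by (meson min_less_iff_conj)
    ultimately have "isE u v ?E" unfolding isE_def by metis
    then show ?thesis by blast
  qed
  define E where "E u v = (SOME p. isE u v p)" for u v
  have E: "isE u v (E u v)" if "adj u v" for u v
    unfolding E_def using E_ex[OF that] by (rule someI_ex)
  have E1: "path_between M (b u) (b v) (E u v)" and E2: "len (E u v) (5 * h)" if "adj u v" for u v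
    using E[OF that] by (auto simp: isE_def)
  define t where "t u v = based_class (E u v)" for u v
  have bR: "b u \<in> reached" if "u \<in> V" for u using b[OF that] by blast
  have bRa: "b u \<in> reached" "b v \<in> reached" if "adj u v" for u v using adjV[OF that] bR by auto
  interpret edge_cocycle "pi1 M a" V adj t
  proof
    show "finite V" by (rule finV)
    show "u \<in> V \<and> v \<in> V" if "adj u v" for u v using adjV that .
    show "adj u u" if "u \<in> V" for u using adj_refl that .
    show "adj v u" if "adj u v" for u v using adj_sym that .
    show "t u v \<in> carrier (pi1 M a)" if "adj u v" for u v
      unfolding t_def by (rule based_class_closed[OF bRa(1)[OF that] E1[OF that]])
    fix u v w assume uv: "adj u v" "adj v w" "adj u w"
    note J = path_between_join[OF E1[OF uv(1)] E1[OF uv(2)]]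
    have "len (E u v +++ E v w) (5 * h + 5 * h)" by (rule len_join[OF E1[OF uv(1)] E1[OF uv(2)] E2[OF uv(1)] E2[OF uv(2)]])
    then have "homotopic_paths M (E u v +++ E v w) (E u w)"
      by (rule same_ends_homotopic[OF J _ E1[OF uv(3)] E2[OF uv(3)]]) (use h_small h_pos in simp)
    then show "t u v \<otimes>\<^bsub>pi1 M a\<^esub> t v w = t u w"
      unfolding t_def using based_class_cong[OF bRa(1)[OF uv(1)] J]
        based_class_join[OF bRa(1)[OF uv(1)] E1[OF uv(1)] E1[OF uv(2)]] by simp
  qed
  have short: "\<forall>n u g. n \<le> 2 * R + 1 \<longrightarrow> walk_prod n u u g \<longrightarrow> g = \<one>\<^bsub>pi1 M a\<^esub>"
  proof -
    \<comment> \<open>A walk becomes, up to homotopy, \<open>Q u\<close> followed by a path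
      \<open>c\<close> through the centres. Each step is compared separately, so \<open>c\<close>
      has length at most \<open>n * h\<close> and the longer paths \<open>E\<close> do not
      contribute.\<close>
    have walk: "\<exists>w. path_between M (b u) (ctr v) w \<and>
        (\<exists>c. path_between M (ctr u) (ctr v) c \<and> len c (n * h) \<and> homotopic_paths M w (Q u +++ c)) \<and>
        g \<otimes>\<^bsub>pi1 M a\<^esub> based_class (Q v) = based_class w" if "walk_prod n u v g" for n u v g
      using that
    proof (induction rule: walk_prod.induct)
      case (walk_prod_0 u)
      note q = Q[OF walk_prod_0] and r = bR[OF walk_prod_0]
      have c: "ctr u \<in> M" using path_between_ends[OF q(1)] by blast
      show ?case
        by (rule exI[of _ "Q u"], intro conjI exI[of _ "\<lambda>_. ctr u"])
          (use q r c path_between_const[OF c] len_const[OF c]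
            homotopic_paths_sym[OF homotopic_between_rid[OF q(1)]] based_class_closed[OF r q(1)] in auto)
    next
      case (walk_prod_Suc n u v g w)
      then obtain p c where p: "path_between M (b u) (ctr v) p"
        and c: "path_between M (ctr u) (ctr v) c" "len c (n * h)" "homotopic_paths M p (Q u +++ c)"
        and g: "g \<otimes>\<^bsub>pi1 M a\<^esub> based_class (Q v) = based_class p" by blast
      note vw = walk_prod_Suc.hyps(2)
      have V: "u \<in> V" "v \<in> V" "w \<in> V" using adjV[OF vw] walk_prod_closed[OF walk_prod_Suc.hyps(1)] by auto
      note R = bR[OF V(1)] bR[OF V(2)] bR[OF V(3)]
      obtain e where e: "path_between M (ctr v) (ctr w) e" "len e h"
      proof -
        have "\<forall>d>0. \<exists>x\<in>M. \<exists>y\<in>M. D x y < d \<and> lab x = v \<and> lab y = w"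
          using vw reached_M unfolding adj_def by blast
        then show ?thesis using ctr_adj that by blast
      qed
      have "path_between M (b v) (ctr w) (Q v +++ e)" "len (Q v +++ e) (h + h)"
        using path_between_join[OF Q(1)[OF V(2)] e(1)] len_join[OF Q(1)[OF V(2)] e(1) Q(2)[OF V(2)] e(2)] .
      moreover have "path_between M (b v) (ctr w) (E v w +++ Q w)" "len (E v w +++ Q w) (5 * h + h)"
        using path_between_join[OF E1[OF vw] Q(1)[OF V(3)]] len_join[OF E1[OF vw] Q(1)[OF V(3)] E2[OF vw] Q(2)[OF V(3)]] .
      ultimately have "homotopic_paths M (E v w +++ Q w) (Q v +++ e)"
        by (intro same_ends_homotopic[where L = "5 * h + h" and L' = "h + h"]) (use h_small h_pos in auto)
      from based_class_cong[OF R(2) path_between_join[OF E1[OF vw] Q(1)[OF V(3)]] this]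
      have eq: "t v w \<otimes>\<^bsub>pi1 M a\<^esub> based_class (Q w) = based_class (Q v) \<otimes>\<^bsub>pi1 M a\<^esub> based_class e"
        unfolding t_def using based_class_join[OF R(2) E1[OF vw] Q(1)[OF V(3)]] based_class_join[OF R(2) Q(1)[OF V(2)] e(1)] by simp
      have ctrv: "ctr v \<in> reached" using reached_step[OF R(2) Q(1)[OF V(2)]] .
      note G = walk_prod_closed[OF walk_prod_Suc.hyps(1), THEN conjunct1] t_closed[OF vw]
        based_class_closed[OF R(3) Q(1)[OF V(3)]] based_class_closed[OF R(2) Q(1)[OF V(2)]] based_class_closed[OF ctrv e(1)]
      have "g \<otimes>\<^bsub>pi1 M a\<^esub> t v w \<otimes>\<^bsub>pi1 M a\<^esub> based_class (Q w) = g \<otimes>\<^bsub>pi1 M a\<^esub> (t v w \<otimes>\<^bsub>pi1 M a\<^esub> based_class (Q w))"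
        using G by (simp add: P.m_assoc)
      also have "\<dots> = g \<otimes>\<^bsub>pi1 M a\<^esub> based_class (Q v) \<otimes>\<^bsub>pi1 M a\<^esub> based_class e"
        unfolding eq using G by (simp add: P.m_assoc)
      also have "\<dots> = based_class (p +++ e)" unfolding g by (rule based_class_join[OF R(1) p e(1), symmetric])
      finally have 1: "g \<otimes>\<^bsub>pi1 M a\<^esub> t v w \<otimes>\<^bsub>pi1 M a\<^esub> based_class (Q w) = based_class (p +++ e)" .
      have "homotopic_paths M (p +++ e) ((Q u +++ c) +++ e)"
        using c(3) p e(1) by (intro homotopic_paths_join homotopic_between_refl[OF e(1)]) (auto simp: path_between_def)
      also have "homotopic_paths M \<dots> (Q u +++ (c +++ e))"
        using Q(1)[OF V(1)] c(1) e(1) by (intro homotopic_paths_sym[OF homotopic_paths_assoc]) (auto simp: path_between_def)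
      finally have 2: "homotopic_paths M (p +++ e) (Q u +++ (c +++ e))" .
      have 3: "len (c +++ e) (real (Suc n) * h)"
        using len_join[OF c(1) e(1) c(2) e(2)] by (simp add: algebra_simps)
      show ?case
        using 1 2 3 path_between_join[OF p e(1)] path_between_join[OF c(1) e(1)] by blast
    qed
    show ?thesis
    proof (intro allI impI)
      fix n u g assume n: "n \<le> 2 * R + 1" and wp: "walk_prod n u u g"
      obtain w c where w: "path_between M (b u) (ctr u) w" and c: "path_between M (ctr u) (ctr u) c" "len c (n * h)"
        and hom: "homotopic_paths M w (Q u +++ c)" and g: "g \<otimes>\<^bsub>pi1 M a\<^esub> based_class (Q u) = based_class w"
        using walk[OF wp] by blast
      have u: "u \<in> V" and gG: "g \<in> carrier (pi1 M a)" using walk_prod_closed[OF wp] by auto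
      have "real n \<le> 2 * real R + 1" using n by linarith
      then have "real n * h < s" using R h_pos by (meson mult_right_mono less_imp_le le_less_trans)
      then have "homotopic_paths M c (\<lambda>_. ctr u)" using len_null[OF c] by blast
      then have "homotopic_paths M (Q u +++ c) (Q u +++ (\<lambda>_. ctr u))"
        using Q(1)[OF u] c(1) by (intro homotopic_paths_join homotopic_between_refl[OF Q(1)[OF u]]) (auto simp: path_between_def)
      then have "homotopic_paths M w (Q u)"
        using hom homotopic_between_rid[OF Q(1)[OF u]] homotopic_paths_trans by blast
      then have "based_class w = based_class (Q u)" using based_class_cong[OF bR[OF u] w] by blast
      then show "g = \<one>\<^bsub>pi1 M a\<^esub>" using g gG based_class_closed[OF bR[OF u] Q(1)[OF u]] by simp
    qed
  qed
  \<comment> \<open>The cells along a path form a walk whose product is the class of the path, up to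
    the correction \<open>I\<close> at both ends. Halving the path reduces this to pieces that are
    homotopic to one jump.\<close>
  have sample: "\<exists>n. walk_prod n (lab x) (lab y)
      (based_class (I x) \<otimes>\<^bsub>pi1 M a\<^esub> based_class p \<otimes>\<^bsub>pi1 M a\<^esub> inv\<^bsub>pi1 M a\<^esub> based_class (I y))"
    if x: "x \<in> reached" and p: "path_between M x y p" for x y p
  proof -
    obtain d1 where d1: "d1 > 0" and loc: "\<And>x y p q. path_between M x y p \<Longrightarrow> path_between M x y q \<Longrightarrow>
      (\<And>t. t\<in>{0..1} \<Longrightarrow> D x (p t) < d1 \<and> D x (q t) < d1) \<Longrightarrow> homotopic_paths M p q" using local by blast
    have e: "min d1 h > 0" using d1 h_pos by simp
    obtain d2 where d2: "d2 > 0" and J: "\<And>x y. x \<in> M \<Longrightarrow> y \<in> M \<Longrightarrow> D x y < d2 \<Longrightarrow>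
      (\<exists>J. path_between M x y J \<and> len J (min d1 h) \<and> (\<forall>t\<in>{0..1}. \<forall>t'\<in>{0..1}. D (J t) (J t') < min d1 h))"
      using jump[OF e] by blast
    \<comment> \<open>Below this threshold labels touch, a short jump exists, and the piece stays
      where paths with equal ends are homotopic.\<close>
    define \<epsilon> where "\<epsilon> = min \<delta> (min d1 d2)"
    have "\<epsilon> > 0" using \<delta> d1 d2 by (simp add: \<epsilon>_def)
    then obtain k where "\<forall>t\<in>{0..1}. \<forall>t'\<in>{0..1}. \<bar>t - t'\<bar> \<le> 1 / 2 ^ k \<longrightarrow> D (p t) (p t') < \<epsilon>"
      using path_uniform[OF p] by blast
    then show ?thesis using x p
    proof (induction k arbitrary: p x y)
      case 0
      note x = \<open>x \<in> reached\<close> and p = \<open>path_between M x y p\<close>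
      have pc: "D (p t) (p t') < \<epsilon>" if "t \<in> {0..1}" "t' \<in> {0..1}" for t t'
        using 0 that by auto
      have y: "y \<in> reached" using reached_step[OF x p] .
      have xy: "D x y < \<epsilon>" using pc[of 0 1] path_between_ends[OF p] by simp
      have uv: "adj (lab x) (lab y)" using near x y xy by (simp add: \<epsilon>_def)
      have "D x y < d2" using xy by (simp add: \<epsilon>_def)
      then obtain J where J: "path_between M x y J" "len J (min d1 h)" "\<forall>t\<in>{0..1}. \<forall>t'\<in>{0..1}. D (J t) (J t') < min d1 h"
        using J[of x y] path_between_ends[OF p] by blast
      have "homotopic_paths M p J"
      proof (rule loc[OF p J(1)])
        fix t :: real assume t: "t \<in> {0..1}"
        have "D (p 0) (p t) < \<epsilon>" "D (J 0) (J t) < min d1 h" using pc J(3) t by auto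
        then show "D x (p t) < d1 \<and> D x (J t) < d1"
          using path_between_ends[OF p] path_between_ends[OF J(1)] by (simp add: \<epsilon>_def)
      qed
      then have pJ: "based_class p = based_class J" by (rule based_class_cong[OF x p])
      note Ix = I[OF x, THEN conjunct1] and Iy = I[OF y, THEN conjunct1]
      have bx: "b (lab x) \<in> reached" using bRa[OF uv] by blast
      have "homotopic_paths M (I x +++ J) (E (lab x) (lab y) +++ I y)"
        by (rule same_ends_homotopic[OF path_between_join[OF Ix J(1)]
              len_join[OF Ix J(1) I[OF x, THEN conjunct2] J(2)]
              path_between_join[OF E1[OF uv] Iy] len_join[OF E1[OF uv] Iy E2[OF uv] I[OF y, THEN conjunct2]]])
          (use h_small h_pos in auto)
      from based_class_cong[OF bx path_between_join[OF Ix J(1)] this]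
      have "based_class (I x) \<otimes>\<^bsub>pi1 M a\<^esub> based_class J = t (lab x) (lab y) \<otimes>\<^bsub>pi1 M a\<^esub> based_class (I y)"
        unfolding t_def using based_class_join[OF bx Ix J(1)] based_class_join[OF bx E1[OF uv] Iy] by simp
      moreover have "based_class (I y) \<in> carrier (pi1 M a)" using based_class_closed[OF bRa(2)[OF uv] Iy] .
      ultimately have "based_class (I x) \<otimes>\<^bsub>pi1 M a\<^esub> based_class J \<otimes>\<^bsub>pi1 M a\<^esub> inv\<^bsub>pi1 M a\<^esub> based_class (I y) = t (lab x) (lab y)"
        using t_closed[OF uv] by (simp add: P.m_assoc)
      then show ?case using walk_prod_edge[OF uv] pJ by metis
    next
      case (Suc k)
      note x = \<open>x \<in> reached\<close> and p = \<open>path_between M x y p\<close>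
      let ?p = "\<lambda>t. p (t / 2)" and ?q = "\<lambda>t. p ((t + 1) / 2)"
      have cp: "continuous_on {0..1} p" using p by (simp add: path_between_def path_def)
      have "continuous_on {0..1} ?p" "continuous_on {0..1} ?q"
        by (rule continuous_on_compose2[OF cp]; auto intro!: continuous_intros)+
      moreover have "?p ` {0..1} \<subseteq> M" "?q ` {0..1} \<subseteq> M" using path_between_at[OF p] by auto
      ultimately have P: "path_between M x (p (1/2)) ?p" and Q: "path_between M (p (1/2)) y ?q"
        using path_between_ends[OF p] by (auto simp: path_between_def path_def path_image_def pathstart_def pathfinish_def)
      define z where "z = p (1/2)"
      note P = P[folded z_def] and Q = Q[folded z_def]
      have z: "z \<in> reached" using reached_step[OF x P] .
      have y: "y \<in> reached" using reached_step[OF z Q] .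
      have join: "p = ?p +++ ?q" by (auto simp: joinpaths_def fun_eq_iff)
      have c: "D (p t) (p t') < \<epsilon>" if "t\<in>{0..1}" "t'\<in>{0..1}" "\<bar>t - t'\<bar> \<le> 1 / 2 ^ Suc k" for t t'
        using Suc.prems(1) that by blast
      have "\<exists>n. walk_prod n (lab x) (lab z) (based_class (I x) \<otimes>\<^bsub>pi1 M a\<^esub> based_class ?p \<otimes>\<^bsub>pi1 M a\<^esub> inv\<^bsub>pi1 M a\<^esub> based_class (I z))"
      proof (rule Suc.IH[OF _ x P], intro ballI impI)
        fix t t' :: real assume t: "t \<in> {0..1}" "t' \<in> {0..1}" "\<bar>t - t'\<bar> \<le> 1 / 2 ^ k"
        show "D (p (t / 2)) (p (t' / 2)) < \<epsilon>"
          by (rule c) (use t in \<open>auto simp: field_simps abs_le_iff\<close>)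
      qed
      moreover have "\<exists>n. walk_prod n (lab z) (lab y) (based_class (I z) \<otimes>\<^bsub>pi1 M a\<^esub> based_class ?q \<otimes>\<^bsub>pi1 M a\<^esub> inv\<^bsub>pi1 M a\<^esub> based_class (I y))"
      proof (rule Suc.IH[OF _ z Q], intro ballI impI)
        fix t t' :: real assume t: "t \<in> {0..1}" "t' \<in> {0..1}" "\<bar>t - t'\<bar> \<le> 1 / 2 ^ k"
        show "D (p ((t + 1) / 2)) (p ((t' + 1) / 2)) < \<epsilon>"
          by (rule c) (use t in \<open>auto simp: field_simps abs_le_iff\<close>)
      qed
      ultimately obtain n m where "walk_prod (n + m) (lab x) (lab y)
        ((based_class (I x) \<otimes>\<^bsub>pi1 M a\<^esub> based_class ?p \<otimes>\<^bsub>pi1 M a\<^esub> inv\<^bsub>pi1 M a\<^esub> based_class (I z)) \<otimes>\<^bsub>pi1 M a\<^esub>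
         (based_class (I z) \<otimes>\<^bsub>pi1 M a\<^esub> based_class ?q \<otimes>\<^bsub>pi1 M a\<^esub> inv\<^bsub>pi1 M a\<^esub> based_class (I y)))"
        using walk_prod_trans by meson
      moreover have "(based_class (I x) \<otimes>\<^bsub>pi1 M a\<^esub> based_class ?p \<otimes>\<^bsub>pi1 M a\<^esub> inv\<^bsub>pi1 M a\<^esub> based_class (I z)) \<otimes>\<^bsub>pi1 M a\<^esub>
         (based_class (I z) \<otimes>\<^bsub>pi1 M a\<^esub> based_class ?q \<otimes>\<^bsub>pi1 M a\<^esub> inv\<^bsub>pi1 M a\<^esub> based_class (I y)) =
         based_class (I x) \<otimes>\<^bsub>pi1 M a\<^esub> based_class p \<otimes>\<^bsub>pi1 M a\<^esub> inv\<^bsub>pi1 M a\<^esub> based_class (I y)"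
      proof -
        have Ic: "based_class (I x) \<in> carrier (pi1 M a)" if "x \<in> reached" for x
        proof -
          have "lab x \<in> V" using that by (simp add: V_def)
          then show ?thesis using based_class_closed bR I[OF that] by blast
        qed
        note G = Ic[OF x] Ic[OF y] Ic[OF z] based_class_closed[OF x P] based_class_closed[OF z Q]
        have "based_class p = based_class ?p \<otimes>\<^bsub>pi1 M a\<^esub> based_class ?q"
          using based_class_join[OF x P Q] join by simp
        then show ?thesis
          using G P.mult_inv_cancel[of "based_class (I x) \<otimes>\<^bsub>pi1 M a\<^esub> based_class ?p" "based_class (I z)"
              "based_class ?q \<otimes>\<^bsub>pi1 M a\<^esub> inv\<^bsub>pi1 M a\<^esub> based_class (I y)"]
          by (simp add: P.m_assoc)
      qed
      ultimately show ?case by metis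
    qed
  qed
  show ?thesis
  proof (rule free_group_of_few_vertices[OF u0 _ _ _ short])
    fix v assume "v \<in> V"
    then obtain y p where y: "lab y = v" "path_between M a y p" by (auto simp: V_def reached_def)
    from sample[OF base_reached y(2)] show "\<exists>n g. walk_prod n u0 v g" using y(1) unfolding u0_def by blast
  next
    fix x assume "x \<in> carrier (pi1 M a)"
    then obtain p where p: "x = path_class M p" "path_between M a a p" unfolding carrier_pi1 by blast
    have "based_class (I a) = \<one>\<^bsub>pi1 M a\<^esub>" using based_class_const[OF base_reached] by (simp add: I_def)
    moreover have "based_class p = x" using based_class_loop[OF p(2)] p(1) by simp
    moreover have "x \<in> carrier (pi1 M a)" using p unfolding carrier_pi1 by blast
    ultimately show "\<exists>n. walk_prod n u0 u0 x" using sample[OF base_reached p(2)] by (simp add: u0_def)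
  next
    have "card V \<le> card (lab ` M)"
      unfolding V_def using reached_M finite_lab by (intro card_mono image_mono)
    then show "card V < (R + 1)\<^sup>2" using card by simp
  next
    fix S :: "((real \<Rightarrow> 'a) set \<times> bool) list set" and g
    assume refl: "\<And>u s. u \<in> V \<Longrightarrow> s \<in> S \<Longrightarrow> g u u s = s"
      and closed: "\<And>u v s. adj u v \<Longrightarrow> s \<in> S \<Longrightarrow> g u v s \<in> S"
      and cocycle: "\<And>u v w s. adj u v \<Longrightarrow> adj v w \<Longrightarrow> adj u w \<Longrightarrow> s \<in> S \<Longrightarrow> g u v (g v w s) = g u w s"
    interpret T: path_transport lab adj S g
    proof
      show "g u u s = s" if "adj u u" "s \<in> S" for u s using refl adjV that by blast
      show "g u v s \<in> S" if "adj u v" "s \<in> S" for u v s using closed that by blast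
      show "g u v (g v w s) = g u w s" if "adj u v" "adj v w" "adj u w" "s \<in> S" for u v w s
        using cocycle that by blast
    qed
    have fine: "\<exists>k. T.close_paths k p p" if x: "x \<in> reached" and p: "path_between M x y p" for x y p
    proof -
      obtain k where "\<forall>t\<in>{0..1}. \<forall>t'\<in>{0..1}. \<bar>t - t'\<bar> \<le> 1 / 2 ^ k \<longrightarrow> D (p t) (p t') < \<delta>"
        using path_uniform[OF p \<delta>] by blast
      then have "T.close_paths k p p"
        unfolding T.close_paths_def using near reached_along[OF x p] by blast
      then show ?thesis by blast
    qed
    have hol_closed: "T.holonomy p s \<in> S" if "x \<in> reached" "path_between M x y p" "s \<in> S" for x y p s
      using fine[OF that(1,2)] T.holonomy_closed that(3) by blast
    have hol_join: "T.holonomy (p +++ q) s = T.holonomy p (T.holonomy q s)"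
      if x: "x \<in> reached" and p: "path_between M x y p" and q: "path_between M y z q" and s: "s \<in> S" for x y z p q s
    proof -
      obtain k1 k2 k3 where k: "T.close_paths k1 p p" "T.close_paths k2 q q" "T.close_paths k3 (p +++ q) (p +++ q)"
        using fine[OF x p] fine[OF reached_step[OF x p] q] fine[OF x path_between_join[OF p q]] by blast
      let ?k = "k1 + k2 + k3"
      show ?thesis
        by (rule T.holonomy_join[where k = ?k])
          (use k T.close_paths_mono[of _ _ _ ?k] path_between_ends[OF p] path_between_ends[OF q] s in auto)
    qed
    have hol_homotopic: "T.holonomy p s = T.holonomy q s"
      if x: "x \<in> reached" and p: "path_between M x y p" and pq: "homotopic_paths M p q" and s: "s \<in> S" for x y p q s
    proof -
      obtain H where H: "continuous_on ({0..1::real} \<times> {0..1}) H" "H \<in> ({0..1} \<times> {0..1}) \<rightarrow> M"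
        and H01: "\<forall>t\<in>{0..1}. H (0, t) = p t" "\<forall>t\<in>{0..1}. H (1, t) = q t"
        and ends_p: "\<forall>r\<in>{0..1::real}. pathstart (H \<circ> Pair r) = pathstart p \<and> pathfinish (H \<circ> Pair r) = pathfinish p"
        using pq unfolding homotopic_paths by blast
      note H0 = bspec[OF H01(1)] and H1 = bspec[OF H01(2)]
      have ends: "H (r, 0) = x \<and> H (r, 1) = y" if "r \<in> {0..1}" for r
        using bspec[OF ends_p that] path_between_ends[OF p] by (simp add: pathstart_def pathfinish_def)
      have HM: "H ` ({0..1} \<times> {0..1}) \<subseteq> M" using H(2) by blast
      have HR: "H (r, t) \<in> reached" if "r \<in> {0..1}" "t \<in> {0..1}" for r t
      proof -
        have "continuous_on {0..1} (\<lambda>t. H (r, t))"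
          by (rule continuous_on_compose2[OF H(1)]) (use that in \<open>auto intro!: continuous_intros\<close>)
        then have "path_between M x y (\<lambda>t. H (r, t))"
          using HM ends[OF that(1)] that(1)
          by (auto simp: path_between_def path_def path_image_def pathstart_def pathfinish_def)
        from reached_along[OF x this that(2)] show ?thesis .
      qed
      obtain d where d: "d > 0" and close: "\<forall>z\<in>{0..1} \<times> {0..1}. \<forall>z'\<in>{0..1} \<times> {0..1}. dist z z' < d \<longrightarrow> D (H z) (H z') < \<delta>"
        using uniform[OF H(1) HM \<delta>] by blast
      obtain k where "(1/2) ^ k < d / 2" using d real_arch_pow_inv[of "d / 2" "1/2"] by auto
      then have k: "1 / 2 ^ k + 1 / 2 ^ k < d" by (simp add: power_one_over)
      have "T.holonomy (\<lambda>t. H (0, t)) s = T.holonomy (\<lambda>t. H (1, t)) s"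
      proof (rule T.holonomy_homotopy[OF _ ends s])
        fix t t' r r' :: real
        assume t: "t \<in> {0..1}" "t' \<in> {0..1}" "r \<in> {0..1}" "r' \<in> {0..1}" "\<bar>t - t'\<bar> \<le> 1 / 2 ^ k" "\<bar>r - r'\<bar> \<le> 1 / 2 ^ k"
        have "dist (r, t) (r', t') \<le> dist r r' + dist t t'"
          by (simp add: dist_prod_def sqrt_sum_squares_le_sum)
        then have "dist (r, t) (r', t') < d" using t k by (simp add: dist_real_def)
        then have "D (H (r, t)) (H (r', t')) < \<delta>" using close t by blast
        then show "adj (lab (H (r, t))) (lab (H (r', t')))" using near HR t by blast
      qed
      then show ?thesis using T.holonomy_cong[of "\<lambda>t. H (0, t)" p s] T.holonomy_cong[of "\<lambda>t. H (1, t)" q s] H0 H1 by simp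
    qed
    \<comment> \<open>Homotopy invariance makes the chosen representative irrelevant.
      \<open>F u\<close> transports the fibre over the cell \<open>u\<close> to the fibre over the
      base cell.\<close>
    define \<Phi> where "\<Phi> c = T.holonomy (SOME p. p \<in> c)" for c
    define F where "F u = T.holonomy (A (b u))" for u
    have \<Phi>: "\<Phi> (path_class M p) s = T.holonomy p s" if p: "path_between M a a p" and s: "s \<in> S" for p s
    proof -
      have "p \<in> path_class M p" using homotopic_between_refl[OF p] by (simp add: path_class_def)
      then have "(SOME q. q \<in> path_class M p) \<in> path_class M p"
        by (metis someI)
      then have "homotopic_paths M p (SOME q. q \<in> path_class M p)" by (simp add: path_class_def)
      then show ?thesis using hol_homotopic[OF base_reached p _ s] by (simp add: \<Phi>_def)
    qed
    have hol_const: "T.holonomy (\<lambda>_. x) s = s" if "x \<in> reached" "s \<in> S" for x s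
      using T.holonomy_const adj_refl that by (simp add: V_def)
    show "\<exists>\<Phi> F. (\<forall>x\<in>carrier (pi1 M a). \<forall>y\<in>carrier (pi1 M a). \<forall>s\<in>S. \<Phi> (x \<otimes>\<^bsub>pi1 M a\<^esub> y) s = \<Phi> x (\<Phi> y s)) \<and>
           (\<forall>s\<in>S. \<Phi> \<one>\<^bsub>pi1 M a\<^esub> s = s) \<and> (\<forall>u\<in>V. \<forall>s\<in>S. F u s \<in> S) \<and> (\<forall>s\<in>S. F u0 s = s) \<and>
           (\<forall>x\<in>carrier (pi1 M a). \<forall>s\<in>S. \<Phi> x s \<in> S) \<and>
           (\<forall>u v. adj u v \<longrightarrow> (\<forall>s\<in>S. \<Phi> (t u v) (F v s) = F u (g u v s)))"
    proof (intro exI[of _ \<Phi>] exI[of _ F] conjI ballI allI impI)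
      fix x y s assume "x \<in> carrier (pi1 M a)" "y \<in> carrier (pi1 M a)" and s: "s \<in> S"
      then obtain p q where p: "x = path_class M p" "path_between M a a p" and q: "y = path_class M q" "path_between M a a q"
        unfolding carrier_pi1 by blast
      show "\<Phi> (x \<otimes>\<^bsub>pi1 M a\<^esub> y) s = \<Phi> x (\<Phi> y s)"
        using \<Phi>[OF path_between_join[OF p(2) q(2)] s] \<Phi>[OF q(2) s] \<Phi>[OF p(2) hol_closed[OF base_reached q(2) s]]
          hol_join[OF base_reached p(2) q(2) s] mult_pi1[OF p(2) q(2)] p(1) q(1) by simp
    next
      fix s assume s: "s \<in> S"
      show "\<Phi> \<one>\<^bsub>pi1 M a\<^esub> s = s"
        unfolding one_pi1 using \<Phi>[OF path_between_const[OF a] s] hol_const[OF base_reached s] by simp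
      show "F u0 s = s" using hol_const[OF base_reached s] by (simp add: F_def b_def base_path)
    next
      fix u s assume "u \<in> V" "s \<in> S"
      then show "F u s \<in> S" unfolding F_def using hol_closed[OF base_reached access_reached[OF bR]] by blast
    next
      fix x s assume "x \<in> carrier (pi1 M a)" and s: "s \<in> S"
      then obtain p where p: "x = path_class M p" "path_between M a a p" unfolding carrier_pi1 by blast
      then show "\<Phi> x s \<in> S" using \<Phi>[OF p(2) s] hol_closed[OF base_reached p(2) s] by simp
    next
      fix u v s assume uv: "adj u v" and s: "s \<in> S"
      note Au = access_reached[OF bRa(1)[OF uv]] and Av = access_reached[OF bRa(2)[OF uv]] and e = E1[OF uv]
      note rv = path_between_rev[OF Av]
      have Fv: "F v s \<in> S" unfolding F_def by (rule hol_closed[OF base_reached Av s])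
      have cancel: "T.holonomy (reversepath (A (b v))) (F v s) = s"
      proof -
        have "T.holonomy (reversepath (A (b v)) +++ A (b v)) s = T.holonomy (\<lambda>_. b v) s"
          by (rule hol_homotopic[OF bRa(2)[OF uv] path_between_join[OF rv Av] homotopic_between_linv[OF Av] s])
        then show ?thesis
          using hol_join[OF bRa(2)[OF uv] rv Av s] hol_const[OF bRa(2)[OF uv] s] by (simp add: F_def)
      qed
      have Ehol: "T.holonomy (E u v) s = g u v s"
      proof -
        have "T.close_paths 0 (E u v) (E u v)" using E[OF uv] by (auto simp: isE_def T.close_paths_def)
        from T.holonomy_eq[OF this s] show ?thesis
          using path_between_ends[OF e] b adjV[OF uv] by simp
      qed
      have "\<Phi> (t u v) (F v s) = T.holonomy (A (b u) +++ (E u v +++ reversepath (A (b v)))) (F v s)"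
        unfolding t_def based_class_eq[OF e] by (rule \<Phi>[OF based_path[OF bRa(1)[OF uv] e] Fv])
      also have "\<dots> = T.holonomy (A (b u)) (T.holonomy (E u v +++ reversepath (A (b v))) (F v s))"
        by (rule hol_join[OF base_reached Au path_between_join[OF e rv] Fv])
      also have "T.holonomy (E u v +++ reversepath (A (b v))) (F v s) = g u v s"
        using hol_join[OF bRa(1)[OF uv] e rv Fv] cancel Ehol by simp
      finally show "\<Phi> (t u v) (F v s) = F u (g u v s)" by (simp add: F_def)
    qed
  qed
qed

end

section \<open>Piecewise flat complexes\<close>

locale flat_complex =
  fixes K :: "nat set set" and l :: "nat set \<Rightarrow> real"
  assumes complex: "simplicial_2complex K" and metric: "pf_metric K l"
begin

lemma finite_K: "finite K" and simplex: "\<sigma> \<in> K \<Longrightarrow> \<sigma> \<noteq> {} \<and> finite \<sigma> \<and> card \<sigma> \<le> 3"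
  and face: "\<sigma> \<in> K \<Longrightarrow> \<tau> \<subseteq> \<sigma> \<Longrightarrow> \<tau> \<noteq> {} \<Longrightarrow> \<tau> \<in> K"
  using complex unfolding simplicial_2complex_def by blast+

definition verts :: "nat set" where "verts = \<Union> K"

lemma finite_verts: "finite verts"
  unfolding verts_def using finite_K simplex by blast

lemma simplex_verts: "\<sigma> \<in> K \<Longrightarrow> \<sigma> \<subseteq> verts"
  unfolding verts_def by blast

abbreviation Sp :: "(nat \<Rightarrow> real) set" where "Sp \<equiv> realization K"

lemma bary_nonneg: "x \<in> bary_simplex \<sigma> \<Longrightarrow> 0 \<le> x v"
  and bary_zero: "x \<in> bary_simplex \<sigma> \<Longrightarrow> v \<notin> \<sigma> \<Longrightarrow> x v = 0"
  and bary_sum: "x \<in> bary_simplex \<sigma> \<Longrightarrow> sum x \<sigma> = 1"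
  unfolding bary_simplex_def by auto

lemma bary_Sp: "\<sigma> \<in> K \<Longrightarrow> x \<in> bary_simplex \<sigma> \<Longrightarrow> x \<in> Sp"
  unfolding realization_def by blast

lemma Sp_bary: "x \<in> Sp \<Longrightarrow> \<exists>\<sigma>\<in>K. x \<in> bary_simplex \<sigma>"
  unfolding realization_def by blast

lemma bary_sum_verts: "\<sigma> \<in> K \<Longrightarrow> x \<in> bary_simplex \<sigma> \<Longrightarrow> sum x verts = 1"
  using sum.mono_neutral_right[OF finite_verts simplex_verts, of \<sigma> x] bary_zero bary_sum by auto

lemma Sp_sum: "x \<in> Sp \<Longrightarrow> sum x verts = 1"
  and Sp_nonneg: "x \<in> Sp \<Longrightarrow> 0 \<le> x v"
  and Sp_zero: "x \<in> Sp \<Longrightarrow> v \<notin> verts \<Longrightarrow> x v = 0"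
proof -
  assume "x \<in> Sp"
  then obtain \<sigma> where s: "\<sigma> \<in> K" "x \<in> bary_simplex \<sigma>" using Sp_bary by blast
  show "sum x verts = 1" using bary_sum_verts[OF s] .
  show "0 \<le> x v" using bary_nonneg[OF s(2)] .
  show "v \<notin> verts \<Longrightarrow> x v = 0" using bary_zero[OF s(2)] simplex_verts[OF s(1)] by blast
qed

section \<open>Flat coordinates on simplices\<close>

definition segment :: "(nat \<Rightarrow> real) \<Rightarrow> (nat \<Rightarrow> real) \<Rightarrow> real \<Rightarrow> nat \<Rightarrow> real" where
  "segment x y t v = (1 - t) * x v + t * y v"

lemma segment_bary:
  assumes "x \<in> bary_simplex \<sigma>" "y \<in> bary_simplex \<sigma>" "t \<in> {0..1}"
  shows "segment x y t \<in> bary_simplex \<sigma>"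
proof -
  have "sum (segment x y t) \<sigma> = (1 - t) * sum x \<sigma> + t * sum y \<sigma>"
    by (simp add: segment_def sum.distrib sum_distrib_left)
  then show ?thesis using assms by (simp add: bary_simplex_def segment_def)
qed

lemma segment_between:
  assumes "\<sigma> \<in> K" "x \<in> bary_simplex \<sigma>" "y \<in> bary_simplex \<sigma>"
  shows "path_between Sp x y (segment x y)"
proof -
  have "continuous_on {0..1} (segment x y)"
    by (rule continuous_on_coordinatewise_then_product) (auto simp: segment_def intro!: continuous_intros)
  then show ?thesis using segment_bary[OF assms(2,3)] bary_Sp[OF assms(1)]
    by (auto simp: path_between_def path_def path_image_def pathstart_def pathfinish_def segment_def)
qed

text \<open>An isometric copy of each simplex in the plane allows areas to be compared with Lebesgue
  measure. A triangle is placed with one side on the first axis.\<close>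

lemma exists_planar_embedding:
  assumes "\<sigma> \<in> K"
  shows "\<exists>e :: nat \<Rightarrow> real^2. (\<forall>u\<in>\<sigma>. \<forall>v\<in>\<sigma>. dist (e u) (e v) = edge_len l u v) \<and>
    (card \<sigma> = 3 \<longrightarrow> measure lborel (convex hull (e ` \<sigma>)) = tri_area l \<sigma> \<and> 0 < tri_area l \<sigma>)"
proof -
  have pos: "l {u, v} > 0" if "u \<in> \<sigma>" "v \<in> \<sigma>" "u \<noteq> v" for u v
    using metric face[OF assms, of "{u, v}"] that unfolding pf_metric_def by auto
  consider "card \<sigma> = 1" | "card \<sigma> = 2" | "card \<sigma> = 3"
    using simplex[OF assms] by (metis One_nat_def Suc_1 card_gt_0_iff le_SucE le_zero_eq less_numeral_extra(3) numeral_3_eq_3)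
  then show ?thesis
  proof cases
    case 1
    then obtain u where "\<sigma> = {u}" using card_1_singletonE by blast
    then show ?thesis by (intro exI[of _ "\<lambda>_. 0"]) (simp add: edge_len_def)
  next
    case 2
    then obtain u v where uv: "\<sigma> = {u, v}" "u \<noteq> v" by (meson card_2_iff)
    have "l {u, v} > 0" using pos uv by simp
    then show ?thesis using uv
      by (intro exI[of _ "\<lambda>w. if w = u then 0 else vector [l {u, v}, 0]"])
        (auto simp: edge_len_def dist_vec_def L2_set_def UNIV_2 insert_commute)
  next
    case 3
    then obtain u v w where uvw: "\<sigma> = {u, v, w}" "u \<noteq> v" "v \<noteq> w" "u \<noteq> w" by (meson card_3_iff)
    define c b a where "c = l {u, v}" and "b = l {u, w}" and "a = l {v, w}"
    have abc: "a > 0" "b > 0" "c > 0" using pos uvw by (auto simp: a_def b_def c_def)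
    have strict: "l {x, y} < l {x, z} + l {z, y}" if "{x, y, z} = \<sigma>" "x \<noteq> y" "y \<noteq> z" "x \<noteq> z" for x y z
      using metric that assms unfolding pf_metric_def by blast
    have tri: "c < b + a" "b < c + a" "a < c + b"
      using strict[of u v w] strict[of u w v] strict[of v w u] uvw
      by (auto simp: a_def b_def c_def insert_commute)
    \<comment> \<open>By the law of cosines this is the foot of the altitude on the side
      \<open>c\<close>, measured from \<open>u\<close>.\<close>
    define p where "p = (b\<^sup>2 + c\<^sup>2 - a\<^sup>2) / (2 * c)"
    have cp: "2 * c * p = b\<^sup>2 + c\<^sup>2 - a\<^sup>2" using abc by (simp add: p_def)
    \<comment> \<open>Heron's formula for sixteen times the squared area. The strict triangle
      inequalities make it positive, so the altitude \<open>q\<close> exists.\<close>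
    have heron: "4 * c\<^sup>2 * (b\<^sup>2 - p\<^sup>2) = (a + b + c) * (b + c - a) * (a + c - b) * (a + b - c)"
    proof -
      have "4 * c\<^sup>2 * (b\<^sup>2 - p\<^sup>2) = 4 * c\<^sup>2 * b\<^sup>2 - (2 * c * p)\<^sup>2" by (simp add: power2_eq_square algebra_simps)
      then show ?thesis unfolding cp by (simp add: power2_eq_square algebra_simps)
    qed
    have hpos: "(a + b + c) * (b + c - a) * (a + c - b) * (a + b - c) > 0" using abc tri by simp
    then have qpos: "b\<^sup>2 - p\<^sup>2 > 0" using heron abc by (metis zero_less_mult_pos zero_less_power zero_less_mult_iff zero_less_numeral)
    define q where "q = sqrt (b\<^sup>2 - p\<^sup>2)"
    have q: "q > 0" "q\<^sup>2 = b\<^sup>2 - p\<^sup>2" using qpos by (auto simp: q_def)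
    define e :: "nat \<Rightarrow> real^2" where "e x = (if x = u then vector [0, 0] else if x = v then vector [c, 0] else vector [p, q])" for x
    have eu: "e u = vector [0, 0]" "e v = vector [c, 0]" "e w = vector [p, q]" using uvw by (auto simp: e_def)
    have d1: "dist (e u) (e v) = c" using abc by (simp add: eu dist_vec_def L2_set_def UNIV_2 dist_real_def)
    have d2: "dist (e u) (e w) = b" using abc q by (simp add: eu dist_vec_def L2_set_def UNIV_2 dist_real_def)
    have "(c - p)\<^sup>2 + q\<^sup>2 = a\<^sup>2" using q(2) cp by (simp add: power2_diff)
    then have d3: "dist (e v) (e w) = a" using abc by (simp add: eu dist_vec_def L2_set_def UNIV_2 dist_real_def)
    have edges: "{e. e \<subseteq> \<sigma> \<and> card e = 2} = {{u, v}, {u, w}, {v, w}}"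
    proof -
      have "e = {u, v} \<or> e = {u, w} \<or> e = {v, w}" if e: "e \<subseteq> \<sigma>" "card e = 2" for e
      proof -
        obtain x y where "e = {x, y}" "x \<noteq> y" using e(2) by (meson card_2_iff)
        then show ?thesis using e(1) uvw by auto
      qed
      moreover have "{u, v} \<subseteq> \<sigma>" "{u, w} \<subseteq> \<sigma>" "{v, w} \<subseteq> \<sigma>" using uvw(1) by simp_all
      moreover have "card {u, v} = 2" "card {u, w} = 2" "card {v, w} = 2" using uvw(2-4) by simp_all
      ultimately show ?thesis by (intro equalityI subsetI) blast+
    qed
    have dist3: "{u, v} \<noteq> {u, w}" "{u, v} \<noteq> {v, w}" "{u, w} \<noteq> {v, w}" using uvw by (auto simp: doubleton_eq_iff)
    have "tri_area l \<sigma> = sqrt ((c\<^sup>2 + b\<^sup>2 + a\<^sup>2)\<^sup>2 - 2 * (c^4 + b^4 + a^4)) / 4"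
      unfolding tri_area_def edges using dist3 by (simp add: a_def b_def c_def add.assoc)
    also have "(c\<^sup>2 + b\<^sup>2 + a\<^sup>2)\<^sup>2 - 2 * (c^4 + b^4 + a^4) = (a + b + c) * (b + c - a) * (a + c - b) * (a + b - c)"
      by (simp add: power2_eq_square power4_eq_xxxx algebra_simps)
    also have "\<dots> = (2 * c * q)\<^sup>2" unfolding heron[symmetric] q(2)[symmetric] by (simp add: power2_eq_square)
    also have "sqrt ((2 * c * q)\<^sup>2) = 2 * c * q" using abc q by simp
    finally have area: "tri_area l \<sigma> = c * q / 2" by simp
    have "measure lborel (convex hull {e u, e v, e w}) = c * q / 2"
      using abc q by (simp add: content_triangle eu)
    moreover have "e ` \<sigma> = {e u, e v, e w}" using uvw by auto
    ultimately have "measure lborel (convex hull (e ` \<sigma>)) = tri_area l \<sigma>" using area by simp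
    moreover have "\<forall>x\<in>\<sigma>. \<forall>y\<in>\<sigma>. dist (e x) (e y) = edge_len l x y"
      using uvw d1 d2 d3 by (auto simp: edge_len_def a_def b_def c_def dist_commute insert_commute)
    moreover have "0 < tri_area l \<sigma>" unfolding area using abc q by simp
    ultimately show ?thesis by (intro exI[of _ e]) simp
  qed
qed

definition emb :: "nat set \<Rightarrow> nat \<Rightarrow> real^2" where
  "emb \<sigma> = (SOME e. (\<forall>u\<in>\<sigma>. \<forall>v\<in>\<sigma>. dist (e u) (e v) = edge_len l u v) \<and>
    (card \<sigma> = 3 \<longrightarrow> measure lborel (convex hull (e ` \<sigma>)) = tri_area l \<sigma> \<and> 0 < tri_area l \<sigma>))"

lemma emb_dist: "\<sigma> \<in> K \<Longrightarrow> u \<in> \<sigma> \<Longrightarrow> v \<in> \<sigma> \<Longrightarrow> dist (emb \<sigma> u) (emb \<sigma> v) = edge_len l u v"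
  and emb_area: "\<sigma> \<in> K \<Longrightarrow> card \<sigma> = 3 \<Longrightarrow> measure lborel (convex hull (emb \<sigma> ` \<sigma>)) = tri_area l \<sigma>"
  and tri_area_pos: "\<sigma> \<in> K \<Longrightarrow> card \<sigma> = 3 \<Longrightarrow> 0 < tri_area l \<sigma>"
  using someI_ex[OF exists_planar_embedding, of \<sigma>] unfolding emb_def by auto

definition flatten :: "nat set \<Rightarrow> (nat \<Rightarrow> real) \<Rightarrow> real^2" where
  "flatten \<sigma> x = (\<Sum>v\<in>\<sigma>. x v *\<^sub>R emb \<sigma> v)"

text \<open>When the squared distances are expanded, the terms with a squared norm carry the factor
  \<open>sum d \<sigma>\<close>, which vanishes, and only inner products remain. This identifies
  \<open>flat_dist\<close> with a Euclidean distance.\<close>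

lemma sum_sum_dist_sq:
  fixes d :: "nat \<Rightarrow> real" and e :: "nat \<Rightarrow> 'b::real_inner"
  assumes "sum d \<sigma> = 0"
  shows "(\<Sum>u\<in>\<sigma>. \<Sum>v\<in>\<sigma>. d u * d v * (dist (e u) (e v))\<^sup>2) = - 2 * (norm (\<Sum>v\<in>\<sigma>. d v *\<^sub>R e v))\<^sup>2"
proof -
  have "d u * d v * (dist (e u) (e v))\<^sup>2 = d v * (d u * (e u \<bullet> e u)) + d u * (d v * (e v \<bullet> e v)) - 2 * ((d u *\<^sub>R e u) \<bullet> (d v *\<^sub>R e v))" for u v
    by (simp add: dist_norm power2_norm_eq_inner inner_diff_left inner_diff_right inner_commute algebra_simps)
  then have "(\<Sum>u\<in>\<sigma>. \<Sum>v\<in>\<sigma>. d u * d v * (dist (e u) (e v))\<^sup>2) =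
    (\<Sum>u\<in>\<sigma>. \<Sum>v\<in>\<sigma>. d v * (d u * (e u \<bullet> e u))) + (\<Sum>u\<in>\<sigma>. \<Sum>v\<in>\<sigma>. d u * (d v * (e v \<bullet> e v)))
     - 2 * (\<Sum>u\<in>\<sigma>. \<Sum>v\<in>\<sigma>. (d u *\<^sub>R e u) \<bullet> (d v *\<^sub>R e v))"
    by (simp add: sum.distrib sum_subtractf sum_distrib_left)
  moreover have "(\<Sum>u\<in>\<sigma>. \<Sum>v\<in>\<sigma>. d v * (d u * (e u \<bullet> e u))) = 0"
    using assms by (simp flip: sum_distrib_right)
  moreover have "(\<Sum>u\<in>\<sigma>. \<Sum>v\<in>\<sigma>. d u * (d v * (e v \<bullet> e v))) = 0"
    using assms by (simp flip: sum_distrib_left sum_distrib_right)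
  moreover have "(\<Sum>u\<in>\<sigma>. \<Sum>v\<in>\<sigma>. (d u *\<^sub>R e u) \<bullet> (d v *\<^sub>R e v)) = (norm (\<Sum>v\<in>\<sigma>. d v *\<^sub>R e v))\<^sup>2"
    by (simp only: power2_norm_eq_inner inner_sum_left inner_sum_right) (rule sum.swap)
  ultimately show ?thesis by simp
qed

lemma flat_dist_eq:
  assumes s: "\<sigma> \<in> K" and x: "x \<in> bary_simplex \<sigma>" and y: "y \<in> bary_simplex \<sigma>"
  shows "flat_dist K l x y = dist (flatten \<sigma> x) (flatten \<sigma> y)"
proof -
  let ?d = "\<lambda>v. x v - y v"
  have zero: "?d v = 0" if "v \<notin> \<sigma>" for v using bary_zero[OF x that] bary_zero[OF y that] by simp
  note mn = sum.mono_neutral_right[OF finite_verts simplex_verts[OF s]]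
  have "(\<Sum>u\<in>verts. \<Sum>v\<in>verts. ?d u * ?d v * (edge_len l u v)\<^sup>2) =
     (\<Sum>u\<in>\<sigma>. \<Sum>v\<in>verts. ?d u * ?d v * (edge_len l u v)\<^sup>2)"
    by (rule mn) (use zero in auto)
  also have "\<dots> = (\<Sum>u\<in>\<sigma>. \<Sum>v\<in>\<sigma>. ?d u * ?d v * (edge_len l u v)\<^sup>2)"
    by (intro sum.cong refl mn) (use zero in auto)
  also have "\<dots> = (\<Sum>u\<in>\<sigma>. \<Sum>v\<in>\<sigma>. ?d u * ?d v * (dist (emb \<sigma> u) (emb \<sigma> v))\<^sup>2)"
    by (intro sum.cong refl) (simp add: emb_dist[OF s])
  also have "\<dots> = - 2 * (norm (\<Sum>v\<in>\<sigma>. ?d v *\<^sub>R emb \<sigma> v))\<^sup>2"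
    by (rule sum_sum_dist_sq) (simp add: sum_subtractf bary_sum[OF x] bary_sum[OF y])
  finally have "flat_dist K l x y = norm (\<Sum>v\<in>\<sigma>. ?d v *\<^sub>R emb \<sigma> v)"
    unfolding flat_dist_def verts_def by simp
  then show ?thesis
    by (simp add: dist_norm flatten_def sum_subtractf scaleR_diff_left)
qed

lemma flatten_segment: "flatten \<sigma> (segment x y t) = (1 - t) *\<^sub>R flatten \<sigma> x + t *\<^sub>R flatten \<sigma> y"
  by (simp add: flatten_def segment_def scaleR_add_left sum.distrib scaleR_sum_right)

text \<open>The l1 distance of barycentric coordinates. It measures closeness also across different
  simplices, where the formula of \<open>flat_dist\<close> has no geometric meaning.\<close>

definition D :: "(nat \<Rightarrow> real) \<Rightarrow> (nat \<Rightarrow> real) \<Rightarrow> real" where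
  "D x y = (\<Sum>v\<in>verts. \<bar>x v - y v\<bar>)"

lemma D_sym: "D x y = D y x"
  by (simp add: D_def abs_minus_commute)

lemma D_refl: "D x x = 0"
  by (simp add: D_def)

lemma D_nonneg: "0 \<le> D x y"
  by (simp add: D_def sum_nonneg)

lemma D_triangle: "D x z \<le> D x y + D y z"
  unfolding D_def sum.distrib[symmetric] by (rule sum_mono) simp

lemma D_coord: "v \<in> verts \<Longrightarrow> \<bar>x v - y v\<bar> \<le> D x y"
  unfolding D_def using finite_verts by (intro member_le_sum) auto

lemma D_segment: "t \<in> {0..1} \<Longrightarrow> D (segment x z t) z \<le> D x z"
proof -
  assume t: "t \<in> {0..1}"
  have "\<bar>segment x z t v - z v\<bar> \<le> \<bar>x v - z v\<bar>" for v
  proof -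
    have "segment x z t v - z v = (1 - t) * (x v - z v)" by (simp add: segment_def algebra_simps)
    then show ?thesis using t by (simp add: abs_mult mult_left_le_one_le)
  qed
  then show ?thesis unfolding D_def by (intro sum_mono)
qed

definition lipschitz_const :: real where
  "lipschitz_const = 1 + (\<Sum>\<sigma>\<in>K. \<Sum>v\<in>\<sigma>. norm (emb \<sigma> v))"

lemma lipschitz_const_ge1: "1 \<le> lipschitz_const"
  by (simp add: lipschitz_const_def sum_nonneg)

lemma flat_dist_le_D:
  assumes s: "\<sigma> \<in> K" and x: "x \<in> bary_simplex \<sigma>" and y: "y \<in> bary_simplex \<sigma>"
  shows "flat_dist K l x y \<le> lipschitz_const * D x y"
proof -
  have e: "norm (emb \<sigma> v) \<le> lipschitz_const" if v: "v \<in> \<sigma>" for v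
  proof -
    have "norm (emb \<sigma> v) \<le> (\<Sum>v\<in>\<sigma>. norm (emb \<sigma> v))"
      using simplex[OF s] v by (intro member_le_sum) auto
    also have "\<dots> \<le> (\<Sum>\<sigma>\<in>K. \<Sum>v\<in>\<sigma>. norm (emb \<sigma> v))"
      using finite_K s by (intro member_le_sum) (auto intro: sum_nonneg)
    finally show ?thesis by (simp add: lipschitz_const_def)
  qed
  have "flat_dist K l x y = norm (\<Sum>v\<in>\<sigma>. (x v - y v) *\<^sub>R emb \<sigma> v)"
    unfolding flat_dist_eq[OF assms] by (simp add: dist_norm flatten_def sum_subtractf scaleR_diff_left)
  also have "\<dots> \<le> (\<Sum>v\<in>\<sigma>. \<bar>x v - y v\<bar> * lipschitz_const)"
    by (rule sum_norm_le) (use e in \<open>auto intro: mult_left_mono\<close>)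
  also have "\<dots> \<le> (\<Sum>v\<in>verts. \<bar>x v - y v\<bar> * lipschitz_const)"
    by (rule sum_mono2[OF finite_verts simplex_verts[OF s]]) (use lipschitz_const_ge1 in auto)
  also have "\<dots> = lipschitz_const * D x y" by (simp add: D_def sum_distrib_left mult.commute)
  finally show ?thesis .
qed

section \<open>Chains, lengths and short paths\<close>

inductive chain :: "(nat \<Rightarrow> real) \<Rightarrow> (nat \<Rightarrow> real) \<Rightarrow> real \<Rightarrow> bool" where
  chain_refl: "chain x x 0"
| chain_step: "chain x y L \<Longrightarrow> \<sigma> \<in> K \<Longrightarrow> y \<in> bary_simplex \<sigma> \<Longrightarrow> z \<in> bary_simplex \<sigma> \<Longrightarrow>
    chain x z (L + flat_dist K l y z)"

lemma chain_trans: "chain y z L' \<Longrightarrow> chain x y L \<Longrightarrow> chain x z (L + L')"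
proof (induction rule: chain.induct)
  case (chain_step y w L' \<sigma> z)
  then show ?case using chain.chain_step[of x w "L + L'" \<sigma> z] by (simp add: add.assoc)
qed simp

lemma chain_one: "\<sigma> \<in> K \<Longrightarrow> y \<in> bary_simplex \<sigma> \<Longrightarrow> z \<in> bary_simplex \<sigma> \<Longrightarrow> chain y z (flat_dist K l y z)"
  using chain_step[OF chain_refl] by fastforce

lemma chain_sym: "chain x y L \<Longrightarrow> chain y x L"
proof (induction rule: chain.induct)
  case (chain_step x y L \<sigma> z)
  have "chain z y (flat_dist K l z y)" using chain_one chain_step by blast
  moreover have "flat_dist K l z y = flat_dist K l y z" using chain_step flat_dist_eq by (simp add: dist_commute)
  ultimately show ?case using chain_trans[OF chain_step.IH, of z "flat_dist K l z y"] by (simp add: add.commute)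
qed (rule chain_refl)

lemma chain_dist_nonneg_sums:
  assumes "\<forall>i<k. \<exists>\<sigma>\<in>K. p i \<in> bary_simplex \<sigma> \<and> p (Suc i) \<in> bary_simplex \<sigma>"
  shows "0 \<le> (\<Sum>i<k. flat_dist K l (p i) (p (Suc i)))"
proof (rule sum_nonneg)
  fix i assume "i \<in> {..<k}"
  then obtain \<sigma> where "\<sigma> \<in> K" "p i \<in> bary_simplex \<sigma>" "p (Suc i) \<in> bary_simplex \<sigma>" using assms by blast
  then show "0 \<le> flat_dist K l (p i) (p (Suc i))" using flat_dist_eq by simp
qed

lemma chain_dist_le: assumes "chain x y L" shows "chain_dist K l x y \<le> L"
proof -
  let ?S = "{(\<Sum>i<k. flat_dist K l (p i) (p (Suc i))) | p k.
      p 0 = x \<and> p k = y \<and> (\<forall>i<k. \<exists>\<sigma>\<in>K. p i \<in> bary_simplex \<sigma> \<and> p (Suc i) \<in> bary_simplex \<sigma>)}"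
  have "\<exists>p k. p 0 = x \<and> p k = y \<and> (\<forall>i<k. \<exists>\<sigma>\<in>K. p i \<in> bary_simplex \<sigma> \<and> p (Suc i) \<in> bary_simplex \<sigma>) \<and>
     L = (\<Sum>i<k. flat_dist K l (p i) (p (Suc i)))"
    using assms
  proof (induction rule: chain.induct)
    case (chain_refl x) then show ?case by (intro exI[of _ "\<lambda>_. x"] exI[of _ 0]) auto
  next
    case (chain_step x y L \<sigma> z)
    then obtain p k where p: "p 0 = x" "p k = y" "\<forall>i<k. \<exists>\<sigma>\<in>K. p i \<in> bary_simplex \<sigma> \<and> p (Suc i) \<in> bary_simplex \<sigma>"
      "L = (\<Sum>i<k. flat_dist K l (p i) (p (Suc i)))" by blast
    let ?p = "p(Suc k := z)"
    have "(\<Sum>i<k. flat_dist K l (?p i) (?p (Suc i))) = L" unfolding p(4) by (rule sum.cong) auto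
    then have "L + flat_dist K l y z = (\<Sum>i<Suc k. flat_dist K l (?p i) (?p (Suc i)))" using p(2) by simp
    moreover have "\<exists>\<sigma>\<in>K. ?p i \<in> bary_simplex \<sigma> \<and> ?p (Suc i) \<in> bary_simplex \<sigma>" if "i < Suc k" for i
      using that p(2,3) chain_step.hyps by (cases "i = k") auto
    ultimately show ?case using p(1) by (intro exI[of _ ?p] exI[of _ "Suc k"]) auto
  qed
  then have "L \<in> ?S" by blast
  moreover have "bdd_below ?S" using chain_dist_nonneg_sums by (intro bdd_belowI[of _ 0]) auto
  ultimately show ?thesis unfolding chain_dist_def by (rule cInf_lower)
qed

text \<open>A certificate for a length bound: \<open>m\<close> acts as arc length, and points of the
  path are joined by chains that cost at most the increment of \<open>m\<close>. Unlike suprema over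
  partitions, certificates are easily joined and reversed.\<close>

definition length_le :: "(real \<Rightarrow> nat \<Rightarrow> real) \<Rightarrow> real \<Rightarrow> bool" where
  "length_le p L \<longleftrightarrow> (\<exists>m. m 1 - m 0 \<le> L \<and>
     (\<forall>s t. 0 \<le> s \<longrightarrow> s \<le> t \<longrightarrow> t \<le> 1 \<longrightarrow> (\<exists>c. chain (p s) (p t) c \<and> c \<le> m t - m s)))"

lemma length_le_mono: "length_le p L \<Longrightarrow> L \<le> L' \<Longrightarrow> length_le p L'"
  unfolding length_le_def by (meson order_trans)

lemma length_le_const: "length_le (\<lambda>_. x) 0"
  unfolding length_le_def by (rule exI[of _ "\<lambda>_. 0"]) (auto intro: chain_refl)

lemma length_le_rev: assumes "length_le p L" shows "length_le (reversepath p) L"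
proof -
  from assms(1) obtain m where m_all: "m 1 - m 0 \<le> L \<and>
     (\<forall>s t. 0 \<le> s \<longrightarrow> s \<le> t \<longrightarrow> t \<le> 1 \<longrightarrow> (\<exists>c. chain (p s) (p t) c \<and> c \<le> m t - m s))"
    unfolding length_le_def ..
  note m = m_all[THEN conjunct1] m_all[THEN conjunct2, rule_format]
  show ?thesis unfolding length_le_def
  proof (rule exI[of _ "\<lambda>t. - m (1 - t)"], intro conjI allI impI)
    fix s t :: real assume st: "0 \<le> s" "s \<le> t" "t \<le> 1"
    then obtain c where c: "chain (p (1 - t)) (p (1 - s)) c" "c \<le> m (1 - s) - m (1 - t)"
      using m(2)[of "1 - t" "1 - s"] by auto
    have "chain (reversepath p s) (reversepath p t) c" unfolding reversepath_def by (rule chain_sym[OF c(1)])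
    moreover have "c \<le> - m (1 - t) - - m (1 - s)" using c(2) by simp
    ultimately show "\<exists>c. chain (reversepath p s) (reversepath p t) c \<and> c \<le> - m (1 - t) - - m (1 - s)" by blast
  qed (use m(1) in simp)
qed

lemma length_le_join:
  assumes "length_le p L" "length_le q L'" "p 1 = q 0" shows "length_le (p +++ q) (L + L')"
proof -
  from assms(1) obtain m where m_all: "m 1 - m 0 \<le> L \<and>
     (\<forall>s t. 0 \<le> s \<longrightarrow> s \<le> t \<longrightarrow> t \<le> 1 \<longrightarrow> (\<exists>c. chain (p s) (p t) c \<and> c \<le> m t - m s))"
    unfolding length_le_def ..
  note m = m_all[THEN conjunct1] m_all[THEN conjunct2, rule_format]
  from assms(2) obtain n where n_all: "n 1 - n 0 \<le> L' \<and>
     (\<forall>s t. 0 \<le> s \<longrightarrow> s \<le> t \<longrightarrow> t \<le> 1 \<longrightarrow> (\<exists>c. chain (q s) (q t) c \<and> c \<le> n t - n s))"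
    unfolding length_le_def ..
  note n = n_all[THEN conjunct1] n_all[THEN conjunct2, rule_format]
  let ?k = "\<lambda>t. if t \<le> 1/2 then m (2 * t) else m 1 + n (2 * t - 1) - n 0"
  show ?thesis unfolding length_le_def
  proof (rule exI[of _ ?k], intro conjI allI impI)
    show "?k 1 - ?k 0 \<le> L + L'" using m(1) n(1) by simp
    fix s t :: real assume st: "0 \<le> s" "s \<le> t" "t \<le> 1"
    consider "t \<le> 1/2" | "s \<le> 1/2" "1/2 < t" | "1/2 < s" by linarith
    then show "\<exists>c. chain ((p +++ q) s) ((p +++ q) t) c \<and> c \<le> ?k t - ?k s"
    proof cases
      case 1 then show ?thesis using m(2)[of "2 * s" "2 * t"] st by (auto simp: joinpaths_def)
    next
      case 3 then show ?thesis using n(2)[of "2 * s - 1" "2 * t - 1"] st by (auto simp: joinpaths_def)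
    next
      case 2
      obtain c where c: "chain (p (2 * s)) (p 1) c" "c \<le> m 1 - m (2 * s)" using m(2)[of "2 * s" 1] 2 st by auto
      obtain d where d: "chain (q 0) (q (2 * t - 1)) d" "d \<le> n (2 * t - 1) - n 0" using n(2)[of 0 "2 * t - 1"] 2 st by auto
      have "chain (p (2 * s)) (q (2 * t - 1)) (c + d)" using chain_trans[OF d(1)] c(1) assms(3) by simp
      then show ?thesis using 2 c(2) d(2) by (intro exI[of _ "c + d"]) (simp add: joinpaths_def)
    qed
  qed
qed

lemma length_le_segment:
  assumes "\<sigma> \<in> K" "x \<in> bary_simplex \<sigma>" "y \<in> bary_simplex \<sigma>"
  shows "length_le (segment x y) (flat_dist K l x y)"
  unfolding length_le_def
proof (rule exI[of _ "\<lambda>t. t * flat_dist K l x y"], intro conjI allI impI)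
  fix s t :: real assume st: "0 \<le> s" "s \<le> t" "t \<le> 1"
  have b: "segment x y s \<in> bary_simplex \<sigma>" "segment x y t \<in> bary_simplex \<sigma>"
    using segment_bary[OF assms(2,3)] st by auto
  have "flatten \<sigma> (segment x y s) - flatten \<sigma> (segment x y t) = (t - s) *\<^sub>R (flatten \<sigma> x - flatten \<sigma> y)"
    by (simp add: flatten_segment algebra_simps)
  then have "flat_dist K l (segment x y s) (segment x y t) = (t - s) * flat_dist K l x y"
    using st by (simp add: flat_dist_eq[OF assms] flat_dist_eq[OF assms(1) b] dist_norm)
  then show "\<exists>c. chain (segment x y s) (segment x y t) c \<and> c \<le> t * flat_dist K l x y - s * flat_dist K l x y"
    using chain_one[OF assms(1) b] by (intro exI) (auto simp: algebra_simps)
qed simp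

text \<open>The increments of \<open>m\<close> telescope over every partition.\<close>

lemma length_le_rectifiable:
  assumes "length_le p L"
  shows "rectifiable_in K l p" "path_length K l p \<le> L"
proof -
  from assms(1) obtain m where m_all: "m 1 - m 0 \<le> L \<and>
     (\<forall>s t. 0 \<le> s \<longrightarrow> s \<le> t \<longrightarrow> t \<le> 1 \<longrightarrow> (\<exists>c. chain (p s) (p t) c \<and> c \<le> m t - m s))"
    unfolding length_le_def ..
  note m = m_all[THEN conjunct1] m_all[THEN conjunct2, rule_format]
  have bound: "S \<le> L" if "S \<in> partition_sums K l p" for S
  proof -
    have "\<exists>t k. S = (\<Sum>i<k. chain_dist K l (p (t i)) (p (t (Suc i)))) \<and>
        t 0 = 0 \<and> t k = 1 \<and> (\<forall>i<k. t i \<le> t (Suc i))"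
      using that unfolding partition_sums_def mem_Collect_eq .
    then obtain t k where S: "S = (\<Sum>i<k. chain_dist K l (p (t i)) (p (t (Suc i))))"
      and t: "t 0 = 0" "t k = 1" "\<forall>i<k. t i \<le> t (Suc i)"
      by (elim exE conjE)
    have mono: "t i \<le> t j" if "i \<le> j" "j \<le> k" for i j
      using that
    proof (induction j rule: dec_induct)
      case (step j)
      then have "t i \<le> t j" "t j \<le> t (Suc j)" using t(3) by auto
      then show ?case by (rule order_trans)
    qed simp
    have "S \<le> (\<Sum>i<k. m (t (Suc i)) - m (t i))" unfolding S
    proof (rule sum_mono)
      fix i assume i: "i \<in> {..<k}"
      then have "0 \<le> t i" "t i \<le> t (Suc i)" "t (Suc i) \<le> 1"
        using mono[of 0 i] mono[of "Suc i" k] t by auto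
      then obtain c where "chain (p (t i)) (p (t (Suc i))) c" "c \<le> m (t (Suc i)) - m (t i)" using m(2) by blast
      then show "chain_dist K l (p (t i)) (p (t (Suc i))) \<le> m (t (Suc i)) - m (t i)"
        using chain_dist_le by fastforce
    qed
    also have "\<dots> = m 1 - m 0" using t sum_lessThan_telescope[of "\<lambda>i. m (t i)" k] by simp
    finally show ?thesis using m(1) by simp
  qed
  show "rectifiable_in K l p" unfolding rectifiable_in_def using bound by (rule bdd_aboveI)
  have "(\<Sum>i<1. chain_dist K l (p (real i)) (p (real (Suc i)))) \<in> partition_sums K l p"
    unfolding partition_sums_def by (intro CollectI exI[of _ real] exI[of _ 1]) auto
  then show "path_length K l p \<le> L"
    unfolding path_length_def using bound by (intro cSup_least) auto
qed

text \<open>As a function of the pair, \<open>D (f p) (f q)\<close> is uniformly continuous on a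
  compact set, and it vanishes on the diagonal.\<close>

lemma uniform_D:
  fixes f :: "real \<times> real \<Rightarrow> nat \<Rightarrow> real"
  assumes f: "continuous_on ({0..1} \<times> {0..1}) f" and e: "0 < e"
  shows "\<exists>d>0. \<forall>p\<in>{0..1} \<times> {0..1}. \<forall>q\<in>{0..1} \<times> {0..1}. dist p q < d \<longrightarrow> D (f p) (f q) < e"
proof -
  let ?Q = "{0..1::real} \<times> {0..1::real}"
  have fv: "continuous_on ?Q (\<lambda>z. f z v)" for v
    using f by (rule continuous_on_product_then_coordinatewise)
  have "continuous_on (?Q \<times> ?Q) (\<lambda>z. \<bar>f (fst z) v - f (snd z) v\<bar>)" for v
    by (intro continuous_intros continuous_on_compose2[OF fv]) (auto intro!: continuous_intros)
  then have "continuous_on (?Q \<times> ?Q) (\<lambda>z. D (f (fst z)) (f (snd z)))"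
    unfolding D_def by (intro continuous_on_sum)
  then have "uniformly_continuous_on (?Q \<times> ?Q) (\<lambda>z. D (f (fst z)) (f (snd z)))"
    by (intro compact_uniformly_continuous compact_Times) auto
  then obtain d where d: "d > 0" "\<And>z z'. z \<in> ?Q \<times> ?Q \<Longrightarrow> z' \<in> ?Q \<times> ?Q \<Longrightarrow> dist z' z < d \<Longrightarrow>
      dist (D (f (fst z')) (f (snd z'))) (D (f (fst z)) (f (snd z))) < e"
    unfolding uniformly_continuous_on_def using e by metis
  have "D (f p) (f q) < e" if "p \<in> ?Q" "q \<in> ?Q" "dist p q < d" for p q
  proof -
    have "dist (p, q) (p, p) < d" using that by (simp add: dist_prod_def dist_commute)
    then have "dist (D (f p) (f q)) (D (f p) (f p)) < e" using d(2)[of "(p, p)" "(p, q)"] that by auto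
    then show ?thesis using D_nonneg by (simp add: D_refl dist_real_def)
  qed
  then show ?thesis using d(1) by blast
qed

text \<open>Nearby points are joined through the normalised minimum of their coordinates, which lies in
  every simplex that contains one of them.\<close>

lemma short_jump:
  assumes e: "0 < e"
  shows "\<exists>d>0. \<forall>x\<in>Sp. \<forall>y\<in>Sp. D x y < d \<longrightarrow>
      (\<exists>J. path_between Sp x y J \<and> length_le J e \<and> (\<forall>t\<in>{0..1}. \<forall>t'\<in>{0..1}. D (J t) (J t') < e))"
proof -
  \<comment> \<open>The bound 1 keeps the normalising factor \<open>c = 1 - D x y / 2\<close>
    positive. The other bound pays for two segments, each of flat length at most
    \<open>lipschitz_const * D x y\<close>.\<close>
  define d where "d = min 1 (e / (2 * lipschitz_const))"
  have d: "d > 0" using e lipschitz_const_ge1 by (simp add: d_def)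
  have "\<exists>J. path_between Sp x y J \<and> length_le J e \<and> (\<forall>t\<in>{0..1}. \<forall>t'\<in>{0..1}. D (J t) (J t') < e)"
    if x: "x \<in> Sp" and y: "y \<in> Sp" and xy: "D x y < d" for x y
  proof -
    obtain \<sigma> where \<sigma>: "\<sigma> \<in> K" "x \<in> bary_simplex \<sigma>" using Sp_bary x by blast
    obtain \<tau> where \<tau>: "\<tau> \<in> K" "y \<in> bary_simplex \<tau>" using Sp_bary y by blast
    have De: "2 * lipschitz_const * D x y \<le> e" "2 * D x y < e"
    proof -
      have "D x y < e / (2 * lipschitz_const)" using xy by (simp add: d_def)
      then have *: "2 * lipschitz_const * D x y < e" using lipschitz_const_ge1 by (simp add: field_simps)
      then show "2 * lipschitz_const * D x y \<le> e" by simp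
      have "2 * D x y \<le> 2 * (lipschitz_const * D x y)"
        using mult_right_mono[OF lipschitz_const_ge1 D_nonneg[of x y]] by simp
      then show "2 * D x y < e" using * by simp
    qed
    define m where "m v = min (x v) (y v)" for v
    define c where "c = sum m verts"
    have m: "m v = (x v + y v - \<bar>x v - y v\<bar>) / 2" for v by (simp add: m_def min_def)
    have c: "c = 1 - D x y / 2"
      unfolding c_def m using Sp_sum[OF x] Sp_sum[OF y]
      by (simp add: D_def sum.distrib sum_subtractf flip: sum_divide_distrib)
    have cpos: "c > 0" using xy c by (simp add: d_def)
    define z where "z v = m v / c" for v
    have m0: "0 \<le> m v" for v using Sp_nonneg x y by (simp add: m_def)
    have z_in: "z \<in> bary_simplex \<rho>" if "\<rho> \<in> K" "w \<in> bary_simplex \<rho>" "w = x \<or> w = y" for w \<rho>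
    proof -
      have zero: "m v = 0" if "v \<notin> \<rho>" for v
        using bary_zero[OF \<open>w \<in> bary_simplex \<rho>\<close> that] \<open>w = x \<or> w = y\<close> Sp_nonneg x y by (auto simp: m_def)
      have "sum m \<rho> = c" unfolding c_def
        using sum.mono_neutral_right[OF finite_verts simplex_verts[OF that(1)], of m] zero by simp
      then show ?thesis using zero m0 cpos by (simp add: bary_simplex_def z_def flip: sum_divide_distrib)
    qed
    have zD: "D w z \<le> D x y" if "w = x \<or> w = y" for w
    proof -
      have w: "m v \<le> w v" for v using that by (auto simp: m_def)
      have c1: "c \<le> 1" using c D_nonneg by simp
      have mz: "m v \<le> z v" for v using m0[of v] cpos c1 mult_left_le_one_le[of "m v" c] by (simp add: z_def field_simps)
      have "\<bar>w v - z v\<bar> \<le> (w v - m v) + (z v - m v)" for v using w[of v] mz[of v] by linarith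
      then have "D w z \<le> (\<Sum>v\<in>verts. (w v - m v) + (z v - m v))" unfolding D_def by (intro sum_mono)
      also have "\<dots> = (sum w verts - c) + (sum z verts - c)" by (simp add: sum.distrib sum_subtractf c_def flip: sum_distrib_left)
      also have "sum z verts = 1" using cpos by (simp add: z_def c_def flip: sum_divide_distrib)
      also have "sum w verts = 1" using that Sp_sum x y by auto
      finally show ?thesis using c by simp
    qed
    note zs = z_in[OF \<sigma>] z_in[OF \<tau>]
    note P = segment_between[OF \<sigma> zs(1)[OF disjI1[OF refl]]] and Q = segment_between[OF \<tau> zs(2)[OF disjI2[OF refl]]]
    let ?J = "segment x z +++ reversepath (segment y z)"
    have J: "path_between Sp x y ?J" using path_between_join[OF P path_between_rev[OF Q]] .
    have "lipschitz_const * D x z \<le> lipschitz_const * D x y" "lipschitz_const * D y z \<le> lipschitz_const * D x y"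
      using zD[of x] zD[of y] lipschitz_const_ge1 by (simp_all add: mult_left_mono)
    then have "flat_dist K l x z \<le> lipschitz_const * D x y" "flat_dist K l y z \<le> lipschitz_const * D x y"
      using flat_dist_le_D[OF \<sigma> zs(1)] flat_dist_le_D[OF \<tau> zs(2)] by auto
    moreover have "length_le ?J (flat_dist K l x z + flat_dist K l y z)"
      by (rule length_le_join[OF length_le_segment[OF \<sigma>] length_le_rev[OF length_le_segment[OF \<tau>]]])
        (use zs in \<open>simp_all add: segment_def reversepath_def fun_eq_iff\<close>)
    ultimately have "length_le ?J e" using De(1) length_le_mono by fastforce
    moreover have near: "D (?J t) z \<le> D x y" if t: "t \<in> {0..1}" for t
    proof (cases "t \<le> 1/2")
      case True
      then show ?thesis using D_segment[of "2 * t" x z] zD[of x] t by (auto simp: joinpaths_def)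
    next
      case False
      then show ?thesis using D_segment[of "1 - (2 * t - 1)" y z] zD[of y] t by (auto simp: joinpaths_def reversepath_def)
    qed
    have "D (?J t) (?J t') < e" if t: "t \<in> {0..1}" "t' \<in> {0..1}" for t t'
      using D_triangle[of "?J t" "?J t'" z] near[OF t(1)] near[OF t(2)] D_sym[of "?J t'" z] De(2) by linarith
    ultimately show ?thesis using J by blast
  qed
  then show ?thesis using d by blast
qed

text \<open>Points close to a given one lie in the open star of a vertex, which contracts to the vertex.\<close>

lemma locally_trivial:
  "\<exists>d>0. \<forall>x y p q. path_between Sp x y p \<longrightarrow> path_between Sp x y q \<longrightarrow>
      (\<forall>t\<in>{0..1}. D x (p t) < d \<and> D x (q t) < d) \<longrightarrow> homotopic_paths Sp p q"
\<comment> \<open>A simplex has at most three vertices, so some coordinate of \<open>x\<close> is at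
  least \<open>1/3\<close>; at smaller \<open>D\<close>-distance this coordinate stays
  positive.\<close>
proof (rule exI[of _ "1/3"], intro conjI allI impI)
  fix x y p q assume p: "path_between Sp x y p" and q: "path_between Sp x y q"
    and near: "\<forall>t\<in>{0..1}. D x (p t) < 1/3 \<and> D x (q t) < 1/3"
  have x: "x \<in> Sp" using path_between_ends[OF p] by blast
  obtain \<sigma> where \<sigma>: "\<sigma> \<in> K" "x \<in> bary_simplex \<sigma>" using Sp_bary x by blast
  obtain v where v: "v \<in> \<sigma>" "x v \<ge> 1/3"
  proof (rule ccontr)
    assume "\<not> thesis"
    then have small: "x v < 1/3" if "v \<in> \<sigma>" for v using that \<open>\<not> thesis\<close> \<open>\<And>v. \<lbrakk>v \<in> \<sigma>; 1 / 3 \<le> x v\<rbrakk> \<Longrightarrow> thesis\<close> by force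
    have "sum x \<sigma> < (\<Sum>v\<in>\<sigma>. 1/3)" using simplex[OF \<sigma>(1)] small by (intro sum_strict_mono) auto
    also have "\<dots> \<le> 1" using simplex[OF \<sigma>(1)] by simp
    finally show False using bary_sum[OF \<sigma>(2)] by simp
  qed
  have vW: "v \<in> verts" using v simplex_verts[OF \<sigma>(1)] by blast
  have star: "w v > 0" if "D x w < 1/3" for w using D_coord[OF vW, of x w] that v(2) by linarith
  let ?r = "p +++ reversepath q"
  have r: "path_between Sp x x ?r" using path_between_join[OF p path_between_rev[OF q]] .
  have rv: "?r t v > 0" if "t \<in> {0..1}" for t
  proof (cases "t \<le> 1/2")
    case True then show ?thesis using near that by (auto simp: joinpaths_def intro!: star)
  next
    case False then show ?thesis using near that by (auto simp: joinpaths_def reversepath_def intro!: star)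
  qed
  \<comment> \<open>\<open>z\<close> is the vertex \<open>v\<close>. It belongs to every simplex
    that contains a point of the loop, so the segments from the loop to \<open>z\<close> stay in the
    complex.\<close>
  define z :: "nat \<Rightarrow> real" where "z w = (if w = v then 1 else 0)" for w
  define H where "H u = segment (?r (snd u)) z (fst u)" for u
  have "homotopic_loops Sp ?r (\<lambda>_. z)" unfolding homotopic_loops
  proof (rule exI[of _ H], intro conjI ballI)
    have "continuous_on {0..1} ?r" using r by (simp add: path_between_def path_def)
    then have "continuous_on {0..1} (\<lambda>t. ?r t w)" for w by (rule continuous_on_product_then_coordinatewise)
    then have "continuous_on ({0..1} \<times> {0..1}) (\<lambda>u. ?r (snd u) w)" for w
      by (rule continuous_on_compose2) (auto intro!: continuous_intros)
    then show "continuous_on ({0..1} \<times> {0..1}) H"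
      by (intro continuous_on_coordinatewise_then_product) (auto simp: H_def segment_def intro!: continuous_intros)
    show "H \<in> {0..1} \<times> {0..1} \<rightarrow> Sp"
    proof
      fix u :: "real \<times> real" assume u: "u \<in> {0..1} \<times> {0..1}"
      then have "?r (snd u) \<in> Sp" using path_between_at[OF r] by auto
      then obtain \<tau> where \<tau>: "\<tau> \<in> K" "?r (snd u) \<in> bary_simplex \<tau>" using Sp_bary by blast
      have "v \<in> \<tau>" using bary_zero[OF \<tau>(2), of v] rv[of "snd u"] u by fastforce
      then have "z \<in> bary_simplex \<tau>" using simplex[OF \<tau>(1)] by (auto simp: bary_simplex_def z_def)
      then show "H u \<in> Sp" unfolding H_def using bary_Sp[OF \<tau>(1) segment_bary[OF \<tau>(2)]] u by auto
    qed
    have ends: "?r 0 = x" "?r 1 = x" using path_between_ends[OF r] by auto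
    show "H (0, t) = ?r t" for t by (simp add: H_def segment_def fun_eq_iff)
    show "H (1, t) = z" for t by (simp add: H_def segment_def fun_eq_iff)
    show "pathfinish (H \<circ> Pair t) = pathstart (H \<circ> Pair t)" for t
      using ends by (simp only: pathfinish_def pathstart_def H_def o_def snd_conv fst_conv)
  qed
  from homotopic_loops_const_imp_paths[OF this]
  have "homotopic_paths Sp ?r (\<lambda>_. x)" using r by (simp add: path_between_def)
  then show "homotopic_paths Sp p q" by (rule homotopic_between_cancel[OF p q])
qed (rule divide_pos_pos; simp)

end

section \<open>Brick patterns in flat triangles\<close>

text \<open>Floors make the bricks half open, so they partition the plane; \<open>j mod 2\<close>
  shifts every other row by half a brick.\<close>

definition brick :: "real \<Rightarrow> real^2 \<Rightarrow> int \<times> int" where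
  "brick h q = (let j = \<lfloor>q$2 / (4/5 * h)\<rfloor> in (\<lfloor>q$1 / h - of_int (j mod 2) / 2\<rfloor>, j))"

definition brick_centre :: "real \<Rightarrow> int \<times> int \<Rightarrow> real^2" where
  "brick_centre h c = vector [(of_int (fst c) + 1/2 + of_int (snd c mod 2) / 2) * h, (of_int (snd c) + 1/2) * (4/5 * h)]"

lemma brick_iff:
  assumes "0 < h"
  shows "brick h q = (i, j) \<longleftrightarrow> of_int j * (4/5 * h) \<le> q$2 \<and> q$2 < (of_int j + 1) * (4/5 * h) \<and>
    (of_int i + of_int (j mod 2) / 2) * h \<le> q$1 \<and> q$1 < (of_int i + 1 + of_int (j mod 2) / 2) * h"
proof -
  have "\<lfloor>q$2 / (4/5 * h)\<rfloor> = j \<longleftrightarrow> of_int j * (4/5 * h) \<le> q$2 \<and> q$2 < (of_int j + 1) * (4/5 * h)"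
    using assms by (simp add: floor_eq_iff pos_le_divide_eq pos_divide_less_eq)
  moreover have "\<lfloor>q$1 / h - of_int (j mod 2) / 2\<rfloor> = i \<longleftrightarrow>
     (of_int i + of_int (j mod 2) / 2) * h \<le> q$1 \<and> q$1 < (of_int i + 1 + of_int (j mod 2) / 2) * h"
  proof -
    have "\<lfloor>q$1 / h - of_int (j mod 2) / 2\<rfloor> = i \<longleftrightarrow>
      of_int i + of_int (j mod 2) / 2 \<le> q$1 / h \<and> q$1 / h < of_int i + 1 + of_int (j mod 2) / (2::real)"
      unfolding floor_eq_iff by (intro conj_cong) linarith+
    then show ?thesis using assms by (simp only: pos_le_divide_eq pos_divide_less_eq)
  qed
  ultimately show ?thesis unfolding brick_def Let_def prod.inject by metis
qed

lemma norm_real2: "norm (q :: real^2) = sqrt ((q$1)\<^sup>2 + (q$2)\<^sup>2)"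
  by (simp add: norm_vec_def L2_set_def UNIV_2)

lemma norm_real2_le:
  assumes "\<bar>q$1\<bar> \<le> \<alpha>" "\<bar>q$2\<bar> \<le> \<beta>" "\<alpha>\<^sup>2 + \<beta>\<^sup>2 \<le> c\<^sup>2" "0 \<le> c"
  shows "norm (q :: real^2) \<le> c"
proof -
  have "(q$1)\<^sup>2 \<le> \<alpha>\<^sup>2" "(q$2)\<^sup>2 \<le> \<beta>\<^sup>2" using assms(1,2) power_mono[of "\<bar>q$_\<bar>" _ 2] by auto
  then have "(q$1)\<^sup>2 + (q$2)\<^sup>2 \<le> c\<^sup>2" using assms(3) by linarith
  then show ?thesis unfolding norm_real2 using assms(4) real_le_lsqrt by simp
qed

lemma brick_centre_near:
  assumes h: "0 < h" and q: "brick h q = c"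
  shows "\<bar>q$1 - brick_centre h c$1\<bar> \<le> h / 2" "\<bar>q$2 - brick_centre h c$2\<bar> \<le> 2/5 * h"
proof -
  obtain i j where c: "c = (i, j)" by (cases c)
  note b = iffD1[OF brick_iff[OF h] q[unfolded c]]
  define x y where "x = (of_int i + of_int (j mod 2) / 2) * h" and "y = of_int j * (4/5 * h)"
  have "brick_centre h c$1 = x + h / 2" "brick_centre h c$2 = y + 2/5 * h"
    by (simp_all add: c brick_centre_def x_def y_def algebra_simps)
  moreover have "(of_int i + 1 + of_int (j mod 2) / 2) * h = x + h" "(of_int j + 1) * (4/5 * h) = y + 4/5 * h"
    by (simp_all add: x_def y_def algebra_simps)
  ultimately show "\<bar>q$1 - brick_centre h c$1\<bar> \<le> h / 2" "\<bar>q$2 - brick_centre h c$2\<bar> \<le> 2/5 * h"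
    using b unfolding x_def[symmetric] y_def[symmetric] by linarith+
qed

text \<open>Half the diagonal is \<open>h\<close> times the square root of 1/4 + 4/25 = 0.41, while
  13/20 has the square 0.4225.\<close>

lemma brick_centre_dist:
  assumes h: "0 < h" and q: "brick h q = c" shows "dist q (brick_centre h c) \<le> 13/20 * h"
  unfolding dist_norm
  by (rule norm_real2_le[of _ "h / 2" "2/5 * h"])
    (use brick_centre_near[OF assms] h in \<open>auto simp: power2_eq_square algebra_simps\<close>)

lemma brick_diameter:
  assumes h: "0 < h" and q: "brick h q = brick h r" shows "dist q r \<le> 13/10 * h"
  using dist_triangle2[of q r "brick_centre h (brick h r)"] brick_centre_dist[OF h q] brick_centre_dist[OF h refl, of r] by simp

lemma brick_segment:
  assumes h: "0 < h" and q: "brick h q = c" "brick h r = c" and t: "t \<in> {0..1}"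
  shows "brick h ((1 - t) *\<^sub>R q + t *\<^sub>R r) = c"
proof -
  obtain i j where c: "c = (i, j)" by (cases c)
  have conv: "L \<le> (1 - t) * x + t * y \<and> (1 - t) * x + t * y < U"
    if "L \<le> x" "x < U" "L \<le> y" "y < U" for x y L U :: real
  proof -
    have "convex {L..<U}" by (rule convex_real_interval)
    then have "(1 - t) *\<^sub>R x + t *\<^sub>R y \<in> {L..<U}" using that t by (intro convexD_alt) auto
    then show ?thesis by simp
  qed
  note a = iffD1[OF brick_iff[OF h] q(1)[unfolded c]] and b = iffD1[OF brick_iff[OF h] q(2)[unfolded c]]
  show ?thesis unfolding c brick_iff[OF h]
    using conv[of "of_int j * (4/5 * h)" "q$2" "(of_int j + 1) * (4/5 * h)" "r$2"]
      conv[of "(of_int i + of_int (j mod 2) / 2) * h" "q$1" "(of_int i + 1 + of_int (j mod 2) / 2) * h" "r$1"] a b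
    by simp
qed

text \<open>Neighbouring rows are offset by half a brick, so the centres of touching bricks in them differ
  by \<open>h/2\<close> and \<open>4h/5\<close>, and \<open>1/4 + 16/25 \<le> 1\<close>.\<close>

lemma brick_centres_adjacent:
  assumes h: "0 < h" and near: "dist q r \<le> h / 100"
  shows "dist (brick_centre h (brick h q)) (brick_centre h (brick h r)) \<le> h"
proof -
  obtain i j i' j' where ij: "brick h q = (i, j)" "brick h r = (i', j')" by fastforce
  let ?c = "brick_centre h (i, j)" and ?c' = "brick_centre h (i', j')"
  note a = brick_centre_near[OF h ij(1)] and b = brick_centre_near[OF h ij(2)]
  have n1: "\<bar>q$1 - r$1\<bar> \<le> h / 100" "\<bar>q$2 - r$2\<bar> \<le> h / 100"
    using component_le_norm_cart[of "q - r" 1] component_le_norm_cart[of "q - r" 2] near by (auto simp: dist_norm)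
  \<comment> \<open>The horizontal offset of the centres in half bricks. It amounts to at most
    \<open>h + h / 100\<close>, which is less than three of them.\<close>
  define k where "k = 2 * (i - i') + (j mod 2 - j' mod 2)"
  have c1: "?c$1 - ?c'$1 = of_int k / 2 * h" by (simp add: brick_centre_def k_def algebra_simps diff_divide_distrib)
  have c2: "?c$2 - ?c'$2 = of_int (j - j') * (4/5 * h)" by (simp add: brick_centre_def field_simps)
  have "\<bar>of_int k / 2 * h\<bar> < 3/2 * h" using a(1) b(1) n1(1) h unfolding c1[symmetric] abs_le_iff abs_less_iff by linarith
  then have "\<bar>of_int k :: real\<bar> * h < 3 * h" using h by (simp add: abs_mult)
  then have "\<bar>of_int k :: real\<bar> < 3" using h by simp
  then have k: "\<bar>k\<bar> < 3" by linarith
  have "\<bar>of_int (j - j') * (4/5 * h)\<bar> < 2 * (4/5 * h)"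
    using a(2) b(2) n1(2) h unfolding c2[symmetric] abs_le_iff abs_less_iff by linarith
  then have "\<bar>of_int (j - j') :: real\<bar> * h < 2 * h" using h by (simp add: abs_mult)
  then have "\<bar>of_int (j - j') :: real\<bar> < 2" using h by (simp only: mult_less_cancel_right_pos)
  then have jj: "\<bar>j - j'\<bar> < 2" by linarith
  have "norm (?c - ?c') \<le> h"
  proof (cases "j = j'")
    case True
    then have "\<bar>k\<bar> \<le> 2" using k by simp
    then have "\<bar>of_int k / 2 * h\<bar> \<le> h" using h by (simp add: abs_mult)
    then show ?thesis using c1 c2 True h by (intro norm_real2_le[of _ h 0]) auto
  next
    case False
    then have "j = j' + 1 \<or> j' = j + 1" using jj by linarith
    \<comment> \<open>Rows of different parity are shifted against each other, so the offset is an
      odd number of half bricks, and being less than three it is one.\<close>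
    then have "odd k" unfolding k_def by (auto simp: mod_2_eq_odd)
    then have "k \<noteq> 2" "k \<noteq> - 2" by auto
    then have "\<bar>k\<bar> \<le> 1" using k by linarith
    then have "\<bar>of_int k :: real\<bar> \<le> 1" by linarith
    then have 1: "\<bar>(?c - ?c')$1\<bar> \<le> h / 2"
      unfolding vector_minus_component c1 using h by (simp add: abs_mult)
    have "\<bar>of_int (j - j') :: real\<bar> \<le> 1" using jj by linarith
    then have "\<bar>of_int (j - j')\<bar> * (4/5 * h) \<le> 4/5 * h" using h by simp
    then have 2: "\<bar>(?c - ?c')$2\<bar> \<le> 4/5 * h"
      unfolding vector_minus_component c2 abs_mult using h by simp
    show ?thesis by (rule norm_real2_le[OF 1 2]) (use h in \<open>auto simp: power2_eq_square\<close>)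
  qed
  then show ?thesis using ij by (simp add: dist_norm)
qed

text \<open>The interiors of the bricks are disjoint boxes in \<open>T\<close>, so the volume bounds
  each finite subfamily of \<open>B\<close>; this bound also shows that \<open>B\<close> is
  finite.\<close>

lemma card_bricks_inside:
  fixes T :: "(real^2) set"
  assumes h: "0 < h" and T: "compact T" and inside: "\<And>q. brick h q \<in> B \<Longrightarrow> q \<in> T"
  shows "finite B" "real (card B) * (4/5 * h\<^sup>2) \<le> measure lborel T"
proof -
  define lo hi :: "int \<times> int \<Rightarrow> real^2" where
    "lo c = vector [(of_int (fst c) + of_int (snd c mod 2) / 2) * h, of_int (snd c) * (4/5 * h)]"
    and "hi c = vector [(of_int (fst c) + 1 + of_int (snd c mod 2) / 2) * h, (of_int (snd c) + 1) * (4/5 * h)]" for c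
  have box: "brick h q = c" if "q \<in> box (lo c) (hi c)" for q c
  proof -
    have "lo c $ 1 < q $ 1" "q $ 1 < hi c $ 1" "lo c $ 2 < q $ 2" "q $ 2 < hi c $ 2"
      using that by (auto simp: mem_box_cart)
    then show ?thesis by (cases c) (auto simp: brick_iff[OF h] lo_def hi_def)
  qed
  have vol: "measure lborel (box (lo c) (hi c)) = 4/5 * h\<^sup>2" for c
  proof -
    have le: "lo c $ k \<le> hi c $ k" for k
      using h exhaust_2[of k] by (auto simp: lo_def hi_def algebra_simps)
    then have "cbox (lo c) (hi c) \<noteq> {}" by (simp add: interval_ne_empty_cart)
    then have "measure lborel (cbox (lo c) (hi c)) = 4/5 * h\<^sup>2"
      by (simp add: content_cbox_cart UNIV_2 lo_def hi_def power2_eq_square algebra_simps)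
    moreover have "measure lborel (box (lo c) (hi c)) = measure lborel (cbox (lo c) (hi c))"
      by (simp add: measure_def emeasure_lborel_box_eq emeasure_lborel_cbox_eq)
    ultimately show ?thesis by simp
  qed
  have fin: "real (card F) * (4/5 * h\<^sup>2) \<le> measure lborel T" if F: "finite F" "F \<subseteq> B" for F
  proof -
    have "measure lborel (\<Union>c\<in>F. box (lo c) (hi c)) = (\<Sum>c\<in>F. measure lborel (box (lo c) (hi c)))"
    proof (rule measure_finite_Union[OF F(1)])
      show "disjoint_family_on (\<lambda>c. box (lo c) (hi c)) F"
        unfolding disjoint_family_on_def using box by (metis disjoint_iff)
      show "(\<lambda>c. box (lo c) (hi c)) ` F \<subseteq> sets lborel" by auto
      show "emeasure lborel (box (lo c) (hi c)) \<noteq> \<infinity>" for c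
        using emeasure_lborel_box_finite[of "lo c" "hi c"] by (simp add: less_top)
    qed
    also have "\<dots> = real (card F) * (4/5 * h\<^sup>2)" by (simp add: vol)
    finally have "real (card F) * (4/5 * h\<^sup>2) = measure lborel (\<Union>c\<in>F. box (lo c) (hi c))" by simp
    also have "\<dots> \<le> measure lborel T"
    proof (rule measure_mono_fmeasurable)
      show "(\<Union>c\<in>F. box (lo c) (hi c)) \<subseteq> T" using box inside F(2) by blast
      show "T \<in> fmeasurable lborel"
        using emeasure_bounded_finite[OF compact_imp_bounded[OF T]] compact_imp_closed[OF T]
        by (intro fmeasurableI) auto
      show "(\<Union>c\<in>F. box (lo c) (hi c)) \<in> sets lborel" by auto
    qed
    finally show ?thesis .
  qed
  have "card F \<le> nat \<lfloor>measure lborel T / (4/5 * h\<^sup>2)\<rfloor>" if F: "F \<subseteq> B" "finite F" for F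
  proof -
    have "real (card F) \<le> measure lborel T / (4/5 * h\<^sup>2)" using fin[OF F(2,1)] h by (simp add: field_simps)
    then show ?thesis by (simp add: le_nat_iff le_floor_iff)
  qed
  then have "finite B \<and> card B \<le> nat \<lfloor>measure lborel T / (4/5 * h\<^sup>2)\<rfloor>" by (rule finite_if_finite_subsets_card_bdd)
  then show "finite B" by blast
  then show "real (card B) * (4/5 * h\<^sup>2) \<le> measure lborel T" using fin by blast
qed

section \<open>Discs inscribed in flat triangles\<close>

context flat_complex
begin

lemma flatten_bary: assumes "\<sigma> \<in> K" shows "flatten \<sigma> ` bary_simplex \<sigma> = convex hull (emb \<sigma> ` \<sigma>)"
proof
  have fin: "finite \<sigma>" using simplex[OF assms] by blast
  show "flatten \<sigma> ` bary_simplex \<sigma> \<subseteq> convex hull (emb \<sigma> ` \<sigma>)"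
  proof
    fix q assume "q \<in> flatten \<sigma> ` bary_simplex \<sigma>"
    then obtain x where x: "x \<in> bary_simplex \<sigma>" "q = flatten \<sigma> x" by blast
    show "q \<in> convex hull (emb \<sigma> ` \<sigma>)" unfolding x(2) flatten_def
      by (rule convex_sum[OF fin convex_convex_hull bary_sum[OF x(1)]])
        (use bary_nonneg[OF x(1)] in \<open>auto intro: hull_inc\<close>)
  qed
  show "convex hull (emb \<sigma> ` \<sigma>) \<subseteq> flatten \<sigma> ` bary_simplex \<sigma>"
  proof (rule hull_minimal)
    show "emb \<sigma> ` \<sigma> \<subseteq> flatten \<sigma> ` bary_simplex \<sigma>"
    proof
      fix q assume "q \<in> emb \<sigma> ` \<sigma>"
      then obtain v where v: "v \<in> \<sigma>" "q = emb \<sigma> v" by blast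
      let ?x = "\<lambda>w. if w = v then 1 else 0 :: real"
      have "?x \<in> bary_simplex \<sigma>" using fin v by (auto simp: bary_simplex_def)
      moreover have "flatten \<sigma> ?x = q"
        using fin v by (simp add: flatten_def if_distrib[of "\<lambda>c. c *\<^sub>R _"] cong: if_cong)
      ultimately show "q \<in> flatten \<sigma> ` bary_simplex \<sigma>" by blast
    qed
    show "convex (flatten \<sigma> ` bary_simplex \<sigma>)" unfolding convex_alt
    proof (intro ballI allI impI)
      fix q r and t :: real assume "q \<in> flatten \<sigma> ` bary_simplex \<sigma>" "r \<in> flatten \<sigma> ` bary_simplex \<sigma>" and t: "0 \<le> t \<and> t \<le> 1"
      then obtain x y where "x \<in> bary_simplex \<sigma>" "q = flatten \<sigma> x" "y \<in> bary_simplex \<sigma>" "r = flatten \<sigma> y" by blast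
      then show "(1 - t) *\<^sub>R q + t *\<^sub>R r \<in> flatten \<sigma> ` bary_simplex \<sigma>"
        using segment_bary[of x \<sigma> y t] flatten_segment[of \<sigma> x y t] t by force
    qed
  qed
qed

text \<open>Fix a disc in the triangle with centre \<open>m\<close>, the image of \<open>y\<close>.
  If all coordinates of \<open>x\<close> are at least \<open>\<kappa>\<close>, then \<open>x\<close>
  divides a segment from some \<open>x'\<close> of the simplex to \<open>y\<close> in the ratio
  \<open>\<kappa>\<close>, and the homothety with centre \<open>x'\<close> and factor
  \<open>\<kappa>\<close> shrinks the disc to one around \<open>x\<close> inside the
  triangle.\<close>

lemma inscribed_ball:
  assumes s: "\<sigma> \<in> K" "card \<sigma> = 3"
  shows "\<exists>\<rho>>0. \<forall>\<kappa> x. 0 < \<kappa> \<longrightarrow> x \<in> bary_simplex \<sigma> \<longrightarrow> (\<forall>v\<in>\<sigma>. \<kappa> \<le> x v) \<longrightarrow>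
    ball (flatten \<sigma> x) (\<kappa> * \<rho>) \<subseteq> flatten \<sigma> ` bary_simplex \<sigma>"
proof -
  let ?T = "flatten \<sigma> ` bary_simplex \<sigma>"
  have fin: "finite \<sigma>" using s card.infinite by fastforce
  have T: "?T = convex hull (emb \<sigma> ` \<sigma>)" by (rule flatten_bary[OF s(1)])
  have conv: "convex ?T" unfolding T by (rule convex_convex_hull)
  have "compact ?T" unfolding T using fin by (simp add: compact_convex_hull finite_imp_compact)
  then have "?T \<in> sets lborel" by (simp add: compact_imp_closed)
  then have "measure lebesgue ?T > 0" using emb_area[OF s] tri_area_pos[OF s] T by simp
  then have "interior ?T \<noteq> {}" using negligible_convex_interior[OF conv] negligible_imp_measure0 by fastforce
  then obtain m \<rho> where \<rho>: "\<rho> > 0" "ball m \<rho> \<subseteq> ?T" by (meson ex_in_conv mem_interior)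
  then have "m \<in> ?T" by auto
  then obtain y where y: "y \<in> bary_simplex \<sigma>" "m = flatten \<sigma> y" by blast
  have "ball (flatten \<sigma> x) (\<kappa> * \<rho>) \<subseteq> ?T"
    if \<kappa>: "0 < \<kappa>" and x: "x \<in> bary_simplex \<sigma>" "\<forall>v\<in>\<sigma>. \<kappa> \<le> x v" for \<kappa> x
  proof
    fix q assume q: "q \<in> ball (flatten \<sigma> x) (\<kappa> * \<rho>)"
    \<comment> \<open>Summing over three vertices gives \<open>3 * \<kappa> \<le> 1\<close>, which
      makes the division by \<open>1 - \<kappa>\<close> below legitimate.\<close>
    have "(\<Sum>v\<in>\<sigma>. \<kappa>) \<le> sum x \<sigma>" using x(2) by (intro sum_mono) auto
    then have \<kappa>1: "\<kappa> < 1" using bary_sum[OF x(1)] s(2) \<kappa> by simp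
    define x' where "x' v = (x v - \<kappa> * y v) / (1 - \<kappa>)" for v
    have y1: "y v \<le> 1" if "v \<in> \<sigma>" for v
      using member_le_sum[OF that, of y] bary_nonneg[OF y(1)] bary_sum[OF y(1)] fin by simp
    have "0 \<le> x' v" for v
    proof (cases "v \<in> \<sigma>")
      case True
      then have "\<kappa> * y v \<le> \<kappa>" using y1 \<kappa> by simp
      then show ?thesis using x(2) True \<kappa>1 by (auto simp: x'_def intro!: divide_nonneg_pos)
    next
      case False
      then show ?thesis using bary_zero[OF x(1)] bary_zero[OF y(1)] by (simp add: x'_def)
    qed
    moreover have "x' v = 0" if "v \<notin> \<sigma>" for v using bary_zero[OF x(1) that] bary_zero[OF y(1) that] by (simp add: x'_def)
    moreover have "sum x' \<sigma> = 1"
      using bary_sum[OF x(1)] bary_sum[OF y(1)] \<kappa>1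
      by (simp add: x'_def sum_subtractf flip: sum_divide_distrib sum_distrib_left)
    ultimately have x': "x' \<in> bary_simplex \<sigma>" by (simp add: bary_simplex_def)
    have "x = segment x' y \<kappa>" using \<kappa>1 by (auto simp: segment_def x'_def)
    then have fx: "flatten \<sigma> x = (1 - \<kappa>) *\<^sub>R flatten \<sigma> x' + \<kappa> *\<^sub>R m" using flatten_segment y(2) by metis
    define q' where "q' = m + (1 / \<kappa>) *\<^sub>R (q - flatten \<sigma> x)"
    have "norm (q' - m) = norm (q - flatten \<sigma> x) / \<kappa>" using \<kappa> by (simp add: q'_def flip: scaleR_diff_right)
    moreover have "norm (q - flatten \<sigma> x) < \<kappa> * \<rho>" using q by (simp add: dist_norm norm_minus_commute)
    ultimately have "norm (q' - m) < \<rho>" using \<kappa> by (simp add: pos_divide_less_eq mult.commute)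
    then have "q' \<in> ?T" using \<rho>(2) by (auto simp: dist_norm norm_minus_commute)
    moreover have "flatten \<sigma> x' \<in> ?T" using x' by blast
    ultimately have "(1 - \<kappa>) *\<^sub>R flatten \<sigma> x' + \<kappa> *\<^sub>R q' \<in> ?T"
      using \<kappa> \<kappa>1 by (intro convexD_alt[OF conv]) auto
    moreover have "(1 - \<kappa>) *\<^sub>R flatten \<sigma> x' + \<kappa> *\<^sub>R q' = q"
      using \<kappa> by (simp add: q'_def fx scaleR_add_right algebra_simps)
    ultimately show "q \<in> ?T" by simp
  qed
  then show ?thesis using \<rho>(1) by blast
qed

lemma uniform_inscribed_ball:
  "\<exists>\<rho>>0. \<forall>\<sigma>\<in>K. card \<sigma> = 3 \<longrightarrow> (\<forall>\<kappa> x. 0 < \<kappa> \<longrightarrow> x \<in> bary_simplex \<sigma> \<longrightarrow> (\<forall>v\<in>\<sigma>. \<kappa> \<le> x v) \<longrightarrow>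
    ball (flatten \<sigma> x) (\<kappa> * \<rho>) \<subseteq> flatten \<sigma> ` bary_simplex \<sigma>)"
proof -
  define Q where "Q \<sigma> \<rho> \<longleftrightarrow> (\<forall>\<kappa> x. 0 < \<kappa> \<longrightarrow> x \<in> bary_simplex \<sigma> \<longrightarrow> (\<forall>v\<in>\<sigma>. \<kappa> \<le> x v) \<longrightarrow>
    ball (flatten \<sigma> x) (\<kappa> * \<rho>) \<subseteq> flatten \<sigma> ` bary_simplex \<sigma>)" for \<sigma> \<rho>
  let ?K = "{\<sigma>\<in>K. card \<sigma> = 3}"
  have "\<forall>\<sigma>\<in>?K. \<exists>\<rho>>0. Q \<sigma> \<rho>" using inscribed_ball unfolding Q_def by blast
  from bchoice[OF this] obtain r where r: "\<forall>\<sigma>\<in>?K. r \<sigma> > 0 \<and> Q \<sigma> (r \<sigma>)" ..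
  have fin: "finite (insert 1 (r ` ?K))" using finite_K by simp
  define \<rho> where "\<rho> = Min (insert 1 (r ` ?K))"
  have "\<rho> > 0" unfolding \<rho>_def using fin r by (subst Min_gr_iff) auto
  moreover have "Q \<sigma> \<rho>" if "\<sigma> \<in> ?K" for \<sigma>
  proof -
    have "\<rho> \<le> r \<sigma>" unfolding \<rho>_def using fin that by (intro Min_le) auto
    moreover have "Q \<sigma> (r \<sigma>)" using r that by blast
    ultimately show ?thesis unfolding Q_def
      by (meson less_imp_le mult_left_mono order_trans subset_ball)
  qed
  ultimately show ?thesis unfolding Q_def by blast
qed

end

section \<open>The cell structure of a piecewise flat complex\<close>

text \<open>\<open>N\<close> is the width of the strip along the edges and stays fixed while
  \<open>n\<close> grows. A point with coordinates at least \<open>N / n\<close> sees a disc of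
  radius \<open>N * \<rho> / n\<close>, at least \<open>40 * lipschitz_const / n\<close>, in its
  triangle. Bricks have diameter at most \<open>13/10 * h\<close>, that is
  \<open>39 * lipschitz_const / n\<close>, so a brick around such a point fits.\<close>

locale fine_mesh = flat_complex +
  fixes n N :: nat and \<rho> :: real
  assumes n_pos: "0 < n" and N_pos: "0 < N" and rho_pos: "0 < \<rho>"
    and inscribed: "\<And>\<sigma> \<kappa> x. \<sigma> \<in> K \<Longrightarrow> card \<sigma> = 3 \<Longrightarrow> 0 < \<kappa> \<Longrightarrow> x \<in> bary_simplex \<sigma> \<Longrightarrow>
      (\<And>v. v \<in> \<sigma> \<Longrightarrow> \<kappa> \<le> x v) \<Longrightarrow> ball (flatten \<sigma> x) (\<kappa> * \<rho>) \<subseteq> flatten \<sigma> ` bary_simplex \<sigma>"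
    and margin: "40 * lipschitz_const \<le> real N * \<rho>"
begin

text \<open>The factor 30 makes the fine cells a tenth as large as \<open>h\<close>: at most three
  coordinates vary, each by at most \<open>1 / n\<close>, so the flat diameter is at most
  \<open>3 * lipschitz_const / n\<close>.\<close>

definition h :: real where "h = 30 * lipschitz_const / real n"

lemma h_pos: "0 < h"
  using lipschitz_const_ge1 n_pos by (simp add: h_def)

definition level :: "(nat \<Rightarrow> real) \<Rightarrow> nat \<Rightarrow> int" where
  "level x v = \<lfloor>real n * x v\<rfloor>"

definition supp :: "(nat \<Rightarrow> real) \<Rightarrow> nat set" where
  "supp x = {v \<in> verts. x v \<noteq> 0}"

text \<open>A deep point lies in a triangle and keeps away from all its edges.\<close>

definition deep :: "(nat \<Rightarrow> real) \<Rightarrow> bool" where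
  "deep x \<longleftrightarrow> 3 \<le> card {v \<in> verts. int N \<le> level x v}"

text \<open>The carrier simplex belongs to the label, so that each cell lies in one open simplex.
  Deep points are sorted by bricks, all others by rounded barycentric coordinates.\<close>

definition lab :: "(nat \<Rightarrow> real) \<Rightarrow> nat set \<times> ((int \<times> int) + (nat \<Rightarrow> int))" where
  "lab x = (supp x, if deep x then Inl (brick h (flatten (supp x) x)) else Inr (level x))"

lemma supp_in_K: assumes "x \<in> Sp" shows "supp x \<in> K" "x \<in> bary_simplex (supp x)"
proof -
  obtain \<sigma> where s: "\<sigma> \<in> K" "x \<in> bary_simplex \<sigma>" using Sp_bary assms by blast
  have sub: "supp x \<subseteq> \<sigma>" using bary_zero[OF s(2)] by (auto simp: supp_def)
  have "sum x (supp x) = sum x verts"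
    using finite_verts by (intro sum.mono_neutral_left) (auto simp: supp_def)
  then have one: "sum x (supp x) = 1" using Sp_sum[OF assms] by simp
  then have "supp x \<noteq> {}" by auto
  then show "supp x \<in> K" using face[OF s(1) sub] by blast
  have "x v = 0" if "v \<notin> supp x" for v using Sp_zero[OF assms, of v] that by (auto simp: supp_def)
  then show "x \<in> bary_simplex (supp x)" using one Sp_nonneg[OF assms] by (simp add: bary_simplex_def)
qed

lemma level_supp: "int N \<le> level x v \<Longrightarrow> v \<in> verts \<Longrightarrow> v \<in> supp x"
  using N_pos by (auto simp: level_def supp_def)

lemma level_bound: "int N \<le> level x v \<longleftrightarrow> real N / real n \<le> x v"
proof -
  have "int N \<le> level x v \<longleftrightarrow> real N \<le> real n * x v" by (simp add: level_def le_floor_iff)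
  then show ?thesis using n_pos by (simp add: field_simps)
qed

lemma deep_supp:
  assumes x: "x \<in> Sp" and d: "deep x"
  shows "card (supp x) = 3" "{v \<in> verts. int N \<le> level x v} = supp x"
proof -
  let ?H = "{v \<in> verts. int N \<le> level x v}"
  have sub: "?H \<subseteq> supp x" using level_supp by blast
  have fin: "finite (supp x)" "card (supp x) \<le> 3" using simplex[OF supp_in_K(1)[OF x]] by auto
  have le: "card ?H \<le> card (supp x)" by (rule card_mono[OF fin(1) sub])
  then show c: "card (supp x) = 3" using d fin by (simp add: deep_def)
  show "?H = supp x" by (rule card_subset_eq[OF fin(1) sub]) (use d le c in \<open>simp add: deep_def\<close>)
qed

lemma deep_coord: "x \<in> Sp \<Longrightarrow> deep x \<Longrightarrow> v \<in> supp x \<Longrightarrow> real N / real n \<le> x v"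
  using deep_supp(2) level_bound by blast

lemma deep_ball:
  assumes x: "x \<in> Sp" and d: "deep x" and q: "dist (flatten (supp x) x) q \<le> 13/10 * h"
  shows "q \<in> flatten (supp x) ` bary_simplex (supp x)"
proof -
  have inside: "ball (flatten (supp x) x) (real N / real n * \<rho>) \<subseteq> flatten (supp x) ` bary_simplex (supp x)"
    using supp_in_K[OF x] deep_supp(1)[OF x d] deep_coord[OF x d] N_pos n_pos by (intro inscribed) auto
  have "13/10 * h < real N / real n * \<rho>"
  proof -
    have "13/10 * h = 39 * lipschitz_const / real n" by (simp add: h_def)
    also have "\<dots> < 40 * lipschitz_const / real n" using lipschitz_const_ge1 n_pos by (simp add: divide_strict_right_mono)
    also have "\<dots> \<le> real N * \<rho> / real n" using margin by (simp add: divide_right_mono)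
    finally show ?thesis by simp
  qed
  then have "q \<in> ball (flatten (supp x) x) (real N / real n * \<rho>)" unfolding mem_ball using q by linarith
  then show ?thesis using inside by blast
qed

lemma segment_length:
  assumes "\<sigma> \<in> K" "x \<in> bary_simplex \<sigma>" "y \<in> bary_simplex \<sigma>" "dist (flatten \<sigma> x) (flatten \<sigma> y) \<le> L"
  shows "path_between Sp x y (segment x y)" "length_le (segment x y) L"
  using segment_between[OF assms(1-3)] length_le_segment[OF assms(1-3)] flat_dist_eq[OF assms(1-3)] assms(4) length_le_mono
  by auto

lemma level_segment:
  assumes "level x v = f" "level y v = f" "t \<in> {0..1}" shows "level (segment x y t) v = f"
proof -
  have "convex {of_int f..<of_int f + 1 :: real}" by (rule convex_real_interval)
  moreover have "real n * x v \<in> {of_int f..<of_int f + 1}" "real n * y v \<in> {of_int f..<of_int f + 1}"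
    using assms by (auto simp: level_def floor_eq_iff)
  ultimately have "(1 - t) *\<^sub>R (real n * x v) + t *\<^sub>R (real n * y v) \<in> {of_int f..<of_int f + 1}"
    using assms(3) by (intro convexD_alt) auto
  moreover have "real n * segment x y t v = (1 - t) *\<^sub>R (real n * x v) + t *\<^sub>R (real n * y v)"
    by (simp add: segment_def algebra_simps)
  ultimately show ?thesis by (simp add: level_def floor_eq_iff)
qed

lemma supp_segment:
  assumes x: "x \<in> Sp" and y: "y \<in> Sp" and s: "supp x = supp y" and t: "t \<in> {0..1}"
  shows "supp (segment x y t) = supp x"
proof -
  have "segment x y t v \<noteq> 0 \<longleftrightarrow> x v \<noteq> 0" if v: "v \<in> verts" for v
  proof (cases "x v = 0")
    case True
    then have "y v = 0" using s v by (auto simp: supp_def)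
    then show ?thesis using True by (simp add: segment_def)
  next
    case False
    then have "y v \<noteq> 0" using s v by (auto simp: supp_def)
    then have xy: "0 < x v" "0 < y v" using False Sp_nonneg x y by (auto simp: less_le)
    have "0 < segment x y t v"
    proof (cases "t = 0")
      case False
      then have "0 < t * y v" using t xy by simp
      moreover have "0 \<le> (1 - t) * x v" using t xy by simp
      ultimately show ?thesis by (simp add: segment_def)
    qed (use xy in \<open>simp add: segment_def\<close>)
    then show ?thesis using False by simp
  qed
  then show ?thesis by (auto simp: supp_def)
qed

lemma nondeep_close:
  assumes x: "x \<in> Sp" and y: "y \<in> Sp" and s: "supp x = supp y" and f: "level x = level y"
  shows "dist (flatten (supp x) x) (flatten (supp x) y) \<le> h / 10"
proof -
  note X = supp_in_K[OF x] and Y = supp_in_K[OF y]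
  have c: "\<bar>x v - y v\<bar> \<le> 1 / real n" for v
  proof -
    have "\<lfloor>real n * x v\<rfloor> = \<lfloor>real n * y v\<rfloor>" using f by (metis level_def)
    then have "\<bar>real n * x v - real n * y v\<bar> \<le> 1" by linarith
    then have "real n * \<bar>x v - y v\<bar> \<le> 1" by (simp add: abs_mult flip: right_diff_distrib)
    then show ?thesis using n_pos by (simp add: field_simps)
  qed
  have "D x y = (\<Sum>v\<in>supp x. \<bar>x v - y v\<bar>)"
    unfolding D_def using finite_verts s by (intro sum.mono_neutral_right) (auto simp: supp_def)
  also have "\<dots> \<le> (\<Sum>v\<in>supp x. 1 / real n)" using c by (intro sum_mono)
  also have "\<dots> \<le> 3 / real n" using simplex[OF X(1)] by (simp add: divide_right_mono)
  finally have "lipschitz_const * D x y \<le> lipschitz_const * (3 / real n)" using lipschitz_const_ge1 by (intro mult_left_mono) auto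
  also have "\<dots> = h / 10" by (simp add: h_def)
  finally have "flat_dist K l x y \<le> h / 10" using flat_dist_le_D[OF X(1,2)] Y s by (metis order_trans)
  then show ?thesis using flat_dist_eq[OF X(1,2)] Y s by metis
qed

text \<open>A cell is an intersection of convex conditions: an open simplex with either the deep
  region and a brick or a box of coordinates. So it contains the segment between any two of its
  points.\<close>

lemma cell_path:
  assumes x: "x \<in> Sp" and y: "y \<in> Sp" and e: "lab x = lab y"
  shows "\<exists>p. path_between Sp x y p \<and> length_le p (2 * h) \<and> (\<forall>t\<in>{0..1}. lab (p t) = lab x)"
proof (rule exI[of _ "segment x y"], intro conjI ballI)
  have s: "supp x = supp y" using e by (simp add: lab_def)
  have d: "deep x \<longleftrightarrow> deep y" using e by (auto simp: lab_def split: if_splits)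
  note X = supp_in_K[OF x] and Y = supp_in_K(2)[OF y, folded s]
  have "dist (flatten (supp x) x) (flatten (supp x) y) \<le> 2 * h"
  proof (cases "deep x")
    case True
    then have "brick h (flatten (supp x) x) = brick h (flatten (supp x) y)" using e d s by (simp add: lab_def)
    from brick_diameter[OF h_pos this] show ?thesis using h_pos by simp
  next
    case False
    then have "level x = level y" using e d by (simp add: lab_def)
    from nondeep_close[OF x y s this] show ?thesis using h_pos by simp
  qed
  then show "path_between Sp x y (segment x y)" "length_le (segment x y) (2 * h)" using segment_length[OF X Y] by auto
  fix t :: real assume t: "t \<in> {0..1}"
  note st = supp_segment[OF x y s t]
  show "lab (segment x y t) = lab x"
  proof (cases "deep x")
    case True
    then have b: "brick h (flatten (supp x) x) = brick h (flatten (supp x) y)" using e d s by (simp add: lab_def)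
    have "supp x \<subseteq> {v \<in> verts. int N \<le> level (segment x y t) v}"
    proof
      fix v assume v: "v \<in> supp x"
      define c where "c = real N / real n"
      have "c \<le> x v" "c \<le> y v" using deep_coord x y True d v s by (auto simp: c_def)
      then have "(1 - t) * c + t * c \<le> segment x y t v"
        unfolding segment_def using t by (intro add_mono mult_left_mono) auto
      then have "real N / real n \<le> segment x y t v" by (simp add: left_diff_distrib c_def[symmetric])
      then show "v \<in> {v \<in> verts. int N \<le> level (segment x y t) v}" using v level_bound by (auto simp: supp_def)
    qed
    then have "3 \<le> card {v \<in> verts. int N \<le> level (segment x y t) v}"
      using deep_supp(1)[OF x True] finite_verts by (metis (no_types, lifting) card_mono finite_subset mem_Collect_eq subsetI)
    then have "deep (segment x y t)" by (simp add: deep_def)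
    moreover have "brick h (flatten (supp x) (segment x y t)) = brick h (flatten (supp x) x)"
      unfolding flatten_segment by (rule brick_segment[OF h_pos refl b[symmetric] t])
    ultimately show ?thesis using st True by (simp add: lab_def)
  next
    case False
    then have f: "level x = level y" using e d by (simp add: lab_def)
    then have "level (segment x y t) = level x" using level_segment[OF _ _ t] by (metis ext)
    moreover from this have "\<not> deep (segment x y t)" using False by (simp add: deep_def)
    ultimately show ?thesis using st False by (simp add: lab_def)
  qed
qed

text \<open>A brick needs its true centre for the sharp distance bound, even if this point is not
  deep and so belongs to another cell. For a fine cell any of its points serves.\<close>

definition ctr :: "nat set \<times> ((int \<times> int) + (nat \<Rightarrow> int)) \<Rightarrow> nat \<Rightarrow> real" where
  "ctr u = (case snd u of
     Inl c \<Rightarrow> (SOME y. y \<in> bary_simplex (fst u) \<and> flatten (fst u) y = brick_centre h c)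
   | Inr f \<Rightarrow> (SOME y. y \<in> Sp \<and> lab y = u))"

lemma ctr_deep:
  assumes x: "x \<in> Sp" and d: "deep x"
  shows "ctr (lab x) \<in> bary_simplex (supp x)"
    "flatten (supp x) (ctr (lab x)) = brick_centre h (brick h (flatten (supp x) x))"
proof -
  let ?c = "brick_centre h (brick h (flatten (supp x) x))"
  have "dist (flatten (supp x) x) ?c \<le> 13/20 * h" by (rule brick_centre_dist[OF h_pos refl])
  then have "dist (flatten (supp x) x) ?c \<le> 13/10 * h" using h_pos by linarith
  from deep_ball[OF x d this] obtain y where "y \<in> bary_simplex (supp x)" "?c = flatten (supp x) y" by (rule imageE)
  then have "\<exists>y. y \<in> bary_simplex (supp x) \<and> flatten (supp x) y = ?c" by metis
  note y = someI_ex[OF this]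
  have "ctr (lab x) = (SOME y. y \<in> bary_simplex (supp x) \<and> flatten (supp x) y = ?c)"
    using d by (simp add: ctr_def lab_def)
  then show "ctr (lab x) \<in> bary_simplex (supp x)" "flatten (supp x) (ctr (lab x)) = ?c"
    using y by simp_all
qed

lemma ctr_nondeep:
  assumes x: "x \<in> Sp" and d: "\<not> deep x"
  shows "ctr (lab x) \<in> Sp" "supp (ctr (lab x)) = supp x" "level (ctr (lab x)) = level x"
proof -
  have "\<exists>y. y \<in> Sp \<and> lab y = lab x" using x by blast
  note y = someI_ex[OF this]
  have "ctr (lab x) = (SOME y. y \<in> Sp \<and> lab y = lab x)" using d by (simp add: ctr_def lab_def[of x])
  then have *: "ctr (lab x) \<in> Sp" "lab (ctr (lab x)) = lab x" using y by simp_all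
  then show "ctr (lab x) \<in> Sp" "supp (ctr (lab x)) = supp x" "level (ctr (lab x)) = level x"
    using d by (auto simp: lab_def split: if_splits)
qed

lemma ctr_path:
  assumes x: "x \<in> Sp"
  shows "\<exists>p. path_between Sp x (ctr (lab x)) p \<and> length_le p ((if deep x then 13/20 else 1/10) * h)"
proof (cases "deep x")
  case True
  have "dist (flatten (supp x) x) (flatten (supp x) (ctr (lab x))) \<le> 13/20 * h"
    unfolding ctr_deep(2)[OF x True] by (rule brick_centre_dist[OF h_pos refl])
  from segment_length[OF supp_in_K[OF x] ctr_deep(1)[OF x True] this] show ?thesis using True by auto
next
  case False
  note c = ctr_nondeep[OF x False]
  have "dist (flatten (supp x) x) (flatten (supp x) (ctr (lab x))) \<le> 1/10 * h"
    using nondeep_close[OF x c(1) c(2)[symmetric] c(3)[symmetric]] by simp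
  from segment_length[OF supp_in_K[OF x] supp_in_K(2)[OF c(1), unfolded c(2)] this] show ?thesis using False by auto
qed

text \<open>For two bricks the brick pattern is used. Otherwise at least one cell is fine and plain
  addition suffices: at most 13/20, 1/10 and 1/10 of \<open>h\<close> for the larger cell, the jump
  and the fine cell.\<close>

lemma ctr_adjacent:
  assumes touch: "\<forall>d>0. \<exists>x\<in>Sp. \<exists>y\<in>Sp. D x y < d \<and> lab x = u \<and> lab y = v"
  shows "\<exists>p. path_between Sp (ctr u) (ctr v) p \<and> length_le p h"
proof -
  have "h / 10 > 0" using h_pos by simp
  then obtain d1 where d1: "d1 > 0" and J: "\<forall>x\<in>Sp. \<forall>y\<in>Sp. D x y < d1 \<longrightarrow>
      (\<exists>J. path_between Sp x y J \<and> length_le J (h / 10) \<and> (\<forall>t\<in>{0..1}. \<forall>t'\<in>{0..1}. D (J t) (J t') < h / 10))"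
    using short_jump by blast
  \<comment> \<open>The three bounds yield a short jump, equal carriers for two deep points, and a
    flat distance of at most \<open>h / 100\<close>.\<close>
  define d where "d = min d1 (min (real N / real n) (h / (100 * lipschitz_const)))"
  have "d > 0" using d1 N_pos n_pos h_pos lipschitz_const_ge1 by (simp add: d_def)
  then obtain x y where x: "x \<in> Sp" and y: "y \<in> Sp" and xy: "D x y < d" and u: "lab x = u" and v: "lab y = v"
    using touch by blast
  show ?thesis
  proof (cases "deep x \<and> deep y")
    case True
    have "supp x \<subseteq> supp y"
    proof
      fix w assume w: "w \<in> supp x"
      then have wv: "w \<in> verts" by (simp add: supp_def)
      have "real N / real n \<le> x w" using deep_coord x True w by blast
      moreover have "\<bar>x w - y w\<bar> < real N / real n" using D_coord[OF wv, of x y] xy by (simp add: d_def)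
      ultimately have "y w \<noteq> 0" by auto
      then show "w \<in> supp y" using wv by (simp add: supp_def)
    qed
    then have s: "supp x = supp y"
      using deep_supp(1)[OF x] deep_supp(1)[OF y] True simplex[OF supp_in_K(1)[OF y]] by (intro card_subset_eq) auto
    note X = supp_in_K[OF x] and Y = supp_in_K(2)[OF y, folded s]
    have "lipschitz_const * D x y \<le> lipschitz_const * (h / (100 * lipschitz_const))"
      using xy lipschitz_const_ge1 by (intro mult_left_mono) (auto simp: d_def)
    also have "\<dots> = h / 100" using lipschitz_const_ge1 by simp
    finally have "dist (flatten (supp x) x) (flatten (supp x) y) \<le> h / 100"
      using flat_dist_le_D[OF X Y] flat_dist_eq[OF X Y] by simp
    then have "dist (flatten (supp x) (ctr u)) (flatten (supp x) (ctr v)) \<le> h"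
      using brick_centres_adjacent[OF h_pos] ctr_deep(2)[OF x] ctr_deep(2)[OF y] True u v s by metis
    moreover have "ctr u \<in> bary_simplex (supp x)" "ctr v \<in> bary_simplex (supp x)"
      using ctr_deep(1)[OF x] ctr_deep(1)[OF y] True u v s by auto
    ultimately show ?thesis using segment_length[OF X(1)] by blast
  next
    case False
    obtain p where p: "path_between Sp x (ctr u) p" "length_le p ((if deep x then 13/20 else 1/10) * h)"
      using ctr_path[OF x] u by blast
    obtain q where q: "path_between Sp y (ctr v) q" "length_le q ((if deep y then 13/20 else 1/10) * h)"
      using ctr_path[OF y] v by blast
    have "D x y < d1" using xy by (simp add: d_def)
    then obtain J where J: "path_between Sp x y J" "length_le J (h / 10)" using J x y by blast
    let ?r = "reversepath p +++ (J +++ q)"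
    note Jq = path_between_join[OF J(1) q(1)]
    have r: "path_between Sp (ctr u) (ctr v) ?r" using path_between_join[OF path_between_rev[OF p(1)] Jq] .
    have "length_le (J +++ q) (h / 10 + (if deep y then 13/20 else 1/10) * h)"
      by (rule length_le_join[OF J(2) q(2)]) (use path_between_ends[OF J(1)] path_between_ends[OF q(1)] in simp)
    then have "length_le ?r ((if deep x then 13/20 else 1/10) * h + (h / 10 + (if deep y then 13/20 else 1/10) * h))"
      by (rule length_le_join[OF length_le_rev[OF p(2)]])
        (use path_between_ends[OF path_between_rev[OF p(1)]] path_between_ends[OF Jq] in simp)
    moreover have "(if deep x then 13/20 else 1/10) * h + (h / 10 + (if deep y then 13/20 else 1/10) * h) \<le> h"
      using False h_pos by auto
    ultimately show ?thesis using r length_le_mono by blast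
  qed
qed

section \<open>Counting the cells\<close>

definition nondeep_count :: real where
  "nondeep_count = real (card K * (card verts * (card verts * (N ^ card verts * (card verts + 1)))))"

text \<open>At most two levels of such a point reach \<open>N\<close>, and as all levels add up to nearly \<open>n\<close>, one of
  these two determines the other up to boundedly many choices.\<close>

lemma card_nondeep:
  "finite (lab ` {x\<in>Sp. \<not> deep x})" "real (card (lab ` {x\<in>Sp. \<not> deep x})) \<le> nondeep_count * (real n + 1)"
proof -
  \<comment> \<open>\<open>w\<close> and \<open>u\<close> are the vertices whose levels may be
    large, \<open>g\<close> lists the other levels, \<open>i\<close> is the level of
    \<open>w\<close>, and the level of \<open>u\<close> is what is missing from the total
    \<open>s\<close>. Only \<open>i\<close> has a number of choices that grows with
    \<open>n\<close>.\<close>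
  define decode :: "nat set \<times> nat \<times> nat \<times> (nat \<Rightarrow> int) \<times> int \<times> int \<Rightarrow> nat set \<times> ((int \<times> int) + (nat \<Rightarrow> int))" where
    "decode = (\<lambda>(\<sigma>, w, u, g, s, i). (\<sigma>, Inr (\<lambda>v. if v = u then s - (\<Sum>v'\<in>verts - {u}. if v' = w then i else g v')
       else if v = w then i else if v \<in> verts then g v else 0)))"
  let ?C = "K \<times> verts \<times> verts \<times> (verts \<rightarrow>\<^sub>E {0..<int N}) \<times> {int n - int (card verts)..int n} \<times> {0..int n}"
  have fin: "finite ?C" using finite_K finite_verts by (intro finite_cartesian_product finite_PiE) auto
  have sub: "lab ` {x\<in>Sp. \<not> deep x} \<subseteq> decode ` ?C"
  proof
    fix c assume "c \<in> lab ` {x\<in>Sp. \<not> deep x}"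
    then obtain x where x: "x \<in> Sp" "\<not> deep x" "c = lab x" by blast
    let ?H = "{v \<in> verts. int N \<le> level x v}"
    have "supp x \<noteq> {}" using simplex[OF supp_in_K(1)[OF x(1)]] by blast
    then obtain w0 where w0: "w0 \<in> verts" by (auto simp: supp_def)
    have "card ?H \<le> 2" using x(2) by (simp add: deep_def)
    \<comment> \<open>If fewer than two vertices have a high level, other vertices fill the places;
      \<open>w0\<close> serves when there is none.\<close>
    then have "\<exists>w u. w \<in> verts \<and> u \<in> verts \<and> ?H \<subseteq> {w, u}"
    proof -
      have finH: "finite ?H" using finite_verts by simp
      consider "card ?H = 0" | "card ?H = 1" | "card ?H = 2" using \<open>card ?H \<le> 2\<close> by linarith
      then show ?thesis
      proof cases
        case 1 then show ?thesis using finH w0 by auto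
      next
        case 2
        then obtain a where "?H = {a}" using card_1_singletonE by blast
        then show ?thesis by (metis (no_types, lifting) insertI1 mem_Collect_eq subset_insertI)
      next
        case 3
        then obtain a b where "?H = {a, b}" by (meson card_2_iff)
        then show ?thesis by (metis (no_types, lifting) insertI1 insertI2 mem_Collect_eq order_refl)
      qed
    qed
    then obtain w u where wu: "w \<in> verts" "u \<in> verts" "?H \<subseteq> {w, u}" by blast
    define g where "g = (\<lambda>v\<in>verts. if v = w \<or> v = u then 0 else level x v)"
    have lev0: "0 \<le> level x v" for v using Sp_nonneg[OF x(1)] by (simp add: level_def)
    have g: "g \<in> verts \<rightarrow>\<^sub>E {0..<int N}"
    proof (rule PiE_I)
      fix v assume v: "v \<in> verts"
      have "v \<in> ?H" if "\<not> level x v < int N" using v that by simp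
      then have "level x v < int N" if "v \<noteq> w" "v \<noteq> u" using wu(3) that by blast
      then show "g v \<in> {0..<int N}" using v lev0 N_pos by (simp add: g_def)
    qed (simp add: g_def)
    define s where "s = (\<Sum>v\<in>verts. level x v)"
    \<comment> \<open>Rounding down loses less than 1 at each vertex, from a total of
      \<open>n\<close>.\<close>
    have s: "s \<in> {int n - int (card verts)..int n}"
    proof -
      have "(\<Sum>v\<in>verts. real n * x v) = real n" using Sp_sum[OF x(1)] by (simp flip: sum_distrib_left)
      moreover have "(\<Sum>v\<in>verts. of_int (level x v)) \<le> (\<Sum>v\<in>verts. real n * x v)"
        by (intro sum_mono) (simp add: level_def)
      moreover have "(\<Sum>v\<in>verts. real n * x v) \<le> (\<Sum>v\<in>verts. of_int (level x v) + 1)"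
        by (intro sum_mono) (simp add: level_def)
      ultimately have "of_int s \<le> real n" "real n \<le> of_int s + real (card verts)"
        by (simp_all add: s_def sum.distrib)
      then show ?thesis by auto
    qed
    have i: "level x w \<in> {0..int n}"
    proof -
      have "x w \<le> 1" using member_le_sum[OF wu(1), of x] Sp_nonneg[OF x(1)] Sp_sum[OF x(1)] finite_verts by simp
      then have "real n * x w \<le> real n" by (simp add: mult_left_le)
      then show ?thesis using lev0 by (auto simp: level_def floor_le_iff)
    qed
    have "decode (supp x, w, u, g, s, level x w) = lab x"
    proof -
      have "(if v = u then s - (\<Sum>v'\<in>verts - {u}. if v' = w then level x w else g v')
         else if v = w then level x w else if v \<in> verts then g v else 0) = level x v" for v
      proof (cases "v = u")
        case True
        have "(\<Sum>v'\<in>verts - {u}. if v' = w then level x w else g v') = (\<Sum>v'\<in>verts - {u}. level x v')"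
          by (intro sum.cong) (auto simp: g_def)
        then show ?thesis using True wu(2) finite_verts by (simp add: s_def sum.remove)
      next
        case False
        have "level x v = 0" if "v \<notin> verts" using Sp_zero[OF x(1) that] by (simp add: level_def)
        then show ?thesis using False by (auto simp: g_def)
      qed
      then show ?thesis using x(2) by (simp add: decode_def lab_def fun_eq_iff)
    qed
    moreover have "(supp x, w, u, g, s, level x w) \<in> ?C" using supp_in_K(1)[OF x(1)] wu g s i by simp
    ultimately show "c \<in> decode ` ?C" using x(3) by (metis image_eqI)
  qed
  show "finite (lab ` {x\<in>Sp. \<not> deep x})" using finite_subset[OF sub] fin by blast
  have "card (lab ` {x\<in>Sp. \<not> deep x}) \<le> card ?C"
    using card_mono[OF finite_imageI[OF fin] sub] card_image_le[OF fin, of decode] by linarith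
  also have "card ?C = card K * (card verts * (card verts * (N ^ card verts * ((card verts + 1) * (n + 1)))))"
  proof -
    have "nat (int k + 1) = k + 1" for k by simp
    then have "card {int n - int (card verts)..int n} = card verts + 1" "card {0..int n} = n + 1" by simp_all
    moreover have "card (verts \<rightarrow>\<^sub>E {0..<int N}) = N ^ card verts" using finite_verts by (simp add: card_PiE)
    ultimately show ?thesis by (simp only: card_cartesian_product)
  qed
  finally show "real (card (lab ` {x\<in>Sp. \<not> deep x})) \<le> nondeep_count * (real n + 1)"
    unfolding nondeep_count_def by (simp add: of_nat_le_iff[symmetric, where 'a = real] algebra_simps del: of_nat_le_iff)
qed

text \<open>A brick that contains a deep point lies entirely in its triangle, so the area of the
  triangle bounds the number of such bricks.\<close>

lemma card_deep:
  "finite (lab ` {x\<in>Sp. deep x})" "real (card (lab ` {x\<in>Sp. deep x})) * (4/5 * h\<^sup>2) \<le> area K l"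
proof -
  let ?K = "{\<sigma>\<in>K. card \<sigma> = 3}"
  define B where "B \<sigma> = {brick h (flatten \<sigma> x) | x. x \<in> Sp \<and> deep x \<and> supp x = \<sigma>}" for \<sigma>
  have B: "finite (B \<sigma>) \<and> real (card (B \<sigma>)) * (4/5 * h\<^sup>2) \<le> tri_area l \<sigma>" if s: "\<sigma> \<in> ?K" for \<sigma>
  proof -
    let ?T = "flatten \<sigma> ` bary_simplex \<sigma>"
    have T: "?T = convex hull (emb \<sigma> ` \<sigma>)" using flatten_bary s by blast
    have comp: "compact ?T" unfolding T using s simplex[of \<sigma>] by (intro compact_convex_hull finite_imp_compact) auto
    have inside: "q \<in> ?T" if q: "brick h q \<in> B \<sigma>" for q
    proof -
      obtain x where x: "x \<in> Sp" "deep x" "supp x = \<sigma>" "brick h (flatten \<sigma> x) = brick h q" using q by (auto simp: B_def)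
      then show ?thesis using deep_ball[OF x(1,2)] brick_diameter[OF h_pos x(4)] by simp
    qed
    have "measure lborel ?T = tri_area l \<sigma>" using emb_area[of \<sigma>] s T by simp
    then show ?thesis using card_bricks_inside[OF h_pos comp inside] by simp
  qed
  have finK: "finite ?K" using finite_K by simp
  have sub: "lab ` {x\<in>Sp. deep x} \<subseteq> (\<Union>\<sigma>\<in>?K. (\<lambda>c. (\<sigma>, Inl c)) ` B \<sigma>)"
  proof
    fix c assume "c \<in> lab ` {x\<in>Sp. deep x}"
    then obtain x where x: "x \<in> Sp" "deep x" "c = lab x" by blast
    then have "brick h (flatten (supp x) x) \<in> B (supp x)" "supp x \<in> ?K"
      using supp_in_K(1) deep_supp(1) by (auto simp: B_def)
    moreover have "c = (supp x, Inl (brick h (flatten (supp x) x)))" using x by (simp add: lab_def)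
    ultimately show "c \<in> (\<Union>\<sigma>\<in>?K. (\<lambda>c. (\<sigma>, Inl c)) ` B \<sigma>)" by blast
  qed
  have finU: "finite (\<Union>\<sigma>\<in>?K. (\<lambda>c. (\<sigma>, Inl c) :: nat set \<times> ((int \<times> int) + (nat \<Rightarrow> int))) ` B \<sigma>)"
    using finK B by auto
  show "finite (lab ` {x\<in>Sp. deep x})" using finite_subset[OF sub finU] .
  have "card (lab ` {x\<in>Sp. deep x}) \<le> card (\<Union>\<sigma>\<in>?K. (\<lambda>c. (\<sigma>, Inl c) :: nat set \<times> ((int \<times> int) + (nat \<Rightarrow> int))) ` B \<sigma>)"
    by (rule card_mono[OF finU sub])
  also have "\<dots> \<le> (\<Sum>\<sigma>\<in>?K. card ((\<lambda>c. (\<sigma>, Inl c) :: nat set \<times> ((int \<times> int) + (nat \<Rightarrow> int))) ` B \<sigma>))"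
    by (rule card_UN_le[OF finK])
  also have "\<dots> \<le> (\<Sum>\<sigma>\<in>?K. card (B \<sigma>))" using B by (intro sum_mono card_image_le) auto
  finally have "real (card (lab ` {x\<in>Sp. deep x})) \<le> (\<Sum>\<sigma>\<in>?K. real (card (B \<sigma>)))"
    unfolding of_nat_sum[symmetric] of_nat_le_iff .
  then have "real (card (lab ` {x\<in>Sp. deep x})) * (4/5 * h\<^sup>2) \<le> (\<Sum>\<sigma>\<in>?K. real (card (B \<sigma>))) * (4/5 * h\<^sup>2)"
    by (rule mult_right_mono) simp
  also have "\<dots> = (\<Sum>\<sigma>\<in>?K. real (card (B \<sigma>)) * (4/5 * h\<^sup>2))" by (rule sum_distrib_right)
  also have "\<dots> \<le> area K l" unfolding area_def using B by (intro sum_mono) blast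
  finally show "real (card (lab ` {x\<in>Sp. deep x})) * (4/5 * h\<^sup>2) \<le> area K l" .
qed

lemma card_lab:
  "finite (lab ` Sp)" "real (card (lab ` Sp)) \<le> area K l / (4/5 * h\<^sup>2) + nondeep_count * (real n + 1)"
proof -
  have U: "lab ` Sp = lab ` {x\<in>Sp. deep x} \<union> lab ` {x\<in>Sp. \<not> deep x}" by blast
  show "finite (lab ` Sp)" unfolding U using card_deep(1) card_nondeep(1) by blast
  have "card (lab ` Sp) \<le> card (lab ` {x\<in>Sp. deep x}) + card (lab ` {x\<in>Sp. \<not> deep x})"
    unfolding U by (rule card_Un_le)
  then have "real (card (lab ` Sp)) \<le> real (card (lab ` {x\<in>Sp. deep x})) + real (card (lab ` {x\<in>Sp. \<not> deep x}))" by linarith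
  moreover have "real (card (lab ` {x\<in>Sp. deep x})) \<le> area K l / (4/5 * h\<^sup>2)"
    using card_deep(2) h_pos by (simp add: pos_le_divide_eq)
  ultimately show "real (card (lab ` Sp)) \<le> area K l / (4/5 * h\<^sup>2) + nondeep_count * (real n + 1)"
    using card_nondeep(2) by linarith
qed

lemma free_pi1_of_mesh:
  assumes short: "\<And>g. path g \<Longrightarrow> path_image g \<subseteq> Sp \<Longrightarrow> pathfinish g = pathstart g \<Longrightarrow> rectifiable_in K l g \<Longrightarrow>
      path_length K l g < s \<Longrightarrow> homotopic_loops Sp g (\<lambda>_. pathstart g)"
    and small: "20 * h < s" and a: "a \<in> Sp" and R: "(2 * real R + 1) * h < s" and card: "card (lab ` Sp) < (R + 1)\<^sup>2"
  shows "free_group (pi1 Sp a)"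
proof -
  interpret fine_cells Sp D lab length_le ctr h s
  proof
    show "D x y = D y x" for x y by (rule D_sym)
    show "D x x = 0" for x by (rule D_refl)
    show "\<exists>d>0. \<forall>p\<in>{0..1} \<times> {0..1}. \<forall>q\<in>{0..1} \<times> {0..1}. dist p q < d \<longrightarrow> D (f p) (f q) < e"
      if "continuous_on ({0..1} \<times> {0..1}) f" "f ` ({0..1} \<times> {0..1}) \<subseteq> Sp" "0 < e" for f :: "real \<times> real \<Rightarrow> nat \<Rightarrow> real" and e
      using uniform_D that by blast
    show "finite (lab ` Sp)" by (rule card_lab(1))
    show "length_le (p +++ q) (L + L')"
      if "path_between Sp x y p" "path_between Sp y z q" "length_le p L" "length_le q L'" for x y z p q L L'
      by (rule length_le_join[OF that(3,4)]) (use path_between_ends[OF that(1)] path_between_ends[OF that(2)] in simp)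
    show "length_le (reversepath p) L" if "path_between Sp x y p" "length_le p L" for x y p L
      by (rule length_le_rev[OF that(2)])
    show "length_le (\<lambda>_. x) 0" for x by (rule length_le_const)
    show "length_le p L'" if "length_le p L" "L \<le> L'" for p L L' by (rule length_le_mono[OF that])
    show "homotopic_paths Sp p (\<lambda>_. x)" if p: "path_between Sp x x p" and L: "length_le p L" "L < s" for x p L
    proof -
      have "homotopic_loops Sp p (\<lambda>_. pathstart p)"
        by (rule short) (use p length_le_rectifiable[OF L(1)] L(2) in \<open>auto simp: path_between_def\<close>)
      from homotopic_loops_const_imp_paths[OF this] show ?thesis using p by (simp add: path_between_def)
    qed
    show "\<exists>d>0. \<forall>x\<in>Sp. \<forall>y\<in>Sp. D x y < d \<longrightarrow>
      (\<exists>J. path_between Sp x y J \<and> length_le J e \<and> (\<forall>t\<in>{0..1}. \<forall>t'\<in>{0..1}. D (J t) (J t') < e))" if "0 < e" for e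
      using short_jump[OF that] .
    show "\<exists>d>0. \<forall>x y p q. path_between Sp x y p \<longrightarrow> path_between Sp x y q \<longrightarrow>
      (\<forall>t\<in>{0..1}. D x (p t) < d \<and> D x (q t) < d) \<longrightarrow> homotopic_paths Sp p q" by (rule locally_trivial)
    show "\<exists>p. path_between Sp x y p \<and> length_le p (2 * h) \<and> (\<forall>t\<in>{0..1}. lab (p t) = lab x)"
      if "x \<in> Sp" "y \<in> Sp" "lab x = lab y" for x y using cell_path[OF that] .
    show "\<exists>p. path_between Sp x (ctr (lab x)) p \<and> length_le p h" if x: "x \<in> Sp" for x
    proof -
      have "(if deep x then 13/20 else 1/10) * h \<le> h" using h_pos by simp
      then show ?thesis using ctr_path[OF x] length_le_mono by blast
    qed
    show "\<exists>p. path_between Sp (ctr u) (ctr v) p \<and> length_le p h"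
      if "\<forall>d>0. \<exists>x\<in>Sp. \<exists>y\<in>Sp. D x y < d \<and> lab x = u \<and> lab y = v" for u v using ctr_adjacent[OF that] .
    show "0 < h" by (rule h_pos)
    show "20 * h < s" by (rule small)
  qed
  show ?thesis by (rule free_pi1[OF a R card])
qed

end

section \<open>The systolic inequality\<close>

context flat_complex
begin

lemma area_nonneg: "0 \<le> area K l"
  unfolding area_def using tri_area_pos by (intro sum_nonneg) (auto intro: less_imp_le)

text \<open>With \<open>h = c / n\<close> the number of cells is at most
  \<open>5 * area K l / (4 * c\<^sup>2)\<close> times \<open>n\<^sup>2\<close> plus a linear term,
  and \<open>(R + 1)\<^sup>2\<close> is at least \<open>s\<^sup>2 / (4 * c\<^sup>2)\<close> times
  \<open>n\<^sup>2\<close> minus a linear term. The strict inequality between the leading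
  coefficients decides for large \<open>n\<close>.\<close>

theorem free_pi1_of_long_systole:
  assumes short: "\<And>g. path g \<Longrightarrow> path_image g \<subseteq> Sp \<Longrightarrow> pathfinish g = pathstart g \<Longrightarrow> rectifiable_in K l g \<Longrightarrow>
      path_length K l g < s \<Longrightarrow> homotopic_loops Sp g (\<lambda>_. pathstart g)"
    and s: "0 < s" and area: "5 * area K l < s\<^sup>2" and a: "a \<in> Sp"
  shows "free_group (pi1 Sp a)"
proof -
  obtain \<rho> where \<rho>: "\<rho> > 0" and ball: "\<forall>\<sigma>\<in>K. card \<sigma> = 3 \<longrightarrow> (\<forall>\<kappa> x. 0 < \<kappa> \<longrightarrow> x \<in> bary_simplex \<sigma> \<longrightarrow>
    (\<forall>v\<in>\<sigma>. \<kappa> \<le> x v) \<longrightarrow> ball (flatten \<sigma> x) (\<kappa> * \<rho>) \<subseteq> flatten \<sigma> ` bary_simplex \<sigma>)"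
    using uniform_inscribed_ball by blast
  define c where "c = 30 * lipschitz_const"
  have c: "c > 0" using lipschitz_const_ge1 by (simp add: c_def)
  define N where "N = Suc (nat \<lceil>40 * lipschitz_const / \<rho>\<rceil>)"
  have "40 * lipschitz_const / \<rho> \<le> real N" unfolding N_def by linarith
  then have margin: "40 * lipschitz_const \<le> real N * \<rho>" using \<rho> by (simp add: field_simps)
  define C where "C = real (card K * (card verts * (card verts * (N ^ card verts * (card verts + 1)))))"
  have C: "C \<ge> 0" by (simp add: C_def)
  \<comment> \<open>The difference of the two leading coefficients.\<close>
  define \<epsilon> where "\<epsilon> = (s\<^sup>2 - 5 * area K l) / (4 * c\<^sup>2)"
  have \<epsilon>: "\<epsilon> > 0" using area c by (simp add: \<epsilon>_def)
  \<comment> \<open>The first bound gives \<open>20 * h < s\<close>. By the second,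
    \<open>\<epsilon> * n\<^sup>2\<close> exceeds the linear losses: \<open>2 * C * n\<close> for
    the fine cells and \<open>s / c * n\<close> for the rounding of \<open>R\<close>.\<close>
  define n where "n = Suc (nat \<lceil>max (20 * c / s) ((2 * C + s / c) / \<epsilon>)\<rceil>)"
  have n: "20 * c / s < real n" "(2 * C + s / c) / \<epsilon> < real n" "0 < n" unfolding n_def by linarith+
  interpret fine_mesh K l n N \<rho>
    by unfold_locales (use n(3) \<rho> ball margin in \<open>auto simp: N_def\<close>)
  have h: "h = c / real n" by (simp add: h_def c_def)
  have sh: "s / h = s * real n / c" by (simp add: h)
  have "20 * c < s * real n" using n(1) s by (simp add: pos_divide_less_eq mult.commute)
  then have small: "20 * h < s" using n(3) by (simp add: h field_simps)
  \<comment> \<open>Subtracting 1 keeps \<open>(2 * R + 1) * h\<close> strictly below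
    \<open>s\<close> at the price of a linear term.\<close>
  define R where "R = nat \<lfloor>s / (2 * h) - 1\<rfloor>"
  have pos: "s / (2 * h) - 1 \<ge> 0" using small h_pos by (simp add: pos_le_divide_eq)
  have R1: "real R \<le> s / (2 * h) - 1" and R2: "s / (2 * h) - 1 \<le> real R + 1" using pos unfolding R_def by linarith+
  have "(2 * real R + 1) * h \<le> (s / h - 1) * h"
  proof (rule mult_right_mono)
    have "2 * (s / (2 * h)) = s / h" by simp
    then show "2 * real R + 1 \<le> s / h - 1" using R1 by linarith
  qed (use h_pos in simp)
  also have "\<dots> < s" using h_pos by (simp add: left_diff_distrib)
  finally have R: "(2 * real R + 1) * h < s" .
  have "real (card (lab ` Sp)) \<le> area K l / (4/5 * h\<^sup>2) + C * (real n + 1)"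
    using card_lab(2) by (simp add: C_def nondeep_count_def)
  also have "area K l / (4/5 * h\<^sup>2) = 5 * area K l / (4 * c\<^sup>2) * (real n)\<^sup>2"
    using c n(3) by (simp add: h field_simps)
  also have "C * (real n + 1) \<le> 2 * C * real n" using C n(3) mult_left_mono[of 1 "real n" C] by (simp add: algebra_simps)
  also have "2 * C * real n < \<epsilon> * (real n)\<^sup>2 - s / c * real n"
  proof -
    have "2 * C + s / c < \<epsilon> * real n" using n(2) \<epsilon> by (simp add: pos_divide_less_eq mult.commute)
    then have "(2 * C + s / c) * real n < \<epsilon> * real n * real n" using n(3) by simp
    then show ?thesis by (simp add: power2_eq_square algebra_simps)
  qed
  also have "5 * area K l / (4 * c\<^sup>2) * (real n)\<^sup>2 + (\<epsilon> * (real n)\<^sup>2 - s / c * real n) = (s / (2 * h))\<^sup>2 - s / h"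
    using c n(3) by (simp add: \<epsilon>_def h field_simps power2_eq_square)
  also have "\<dots> < (s / (2 * h) - 1)\<^sup>2" by (simp add: power2_diff)
  also have "\<dots> \<le> (real R + 1)\<^sup>2" using pos R2 by (intro power_mono) auto
  finally have "real (card (lab ` Sp)) < real ((R + 1)\<^sup>2)" by (simp add: add.commute)
  then have card: "card (lab ` Sp) < (R + 1)\<^sup>2" by (simp only: of_nat_less_iff)
  show ?thesis by (rule free_pi1_of_mesh[OF short small a R card])
qed

text \<open>An infimum over an empty set of chains would be unspecified. For the partition with the
  two points 0 and 1 of a loop the trivial chain excludes this, and one nonnegative partition sum is
  enough.\<close>

lemma path_length_loop_nonneg:
  assumes "pathfinish g = pathstart g" "rectifiable_in K l g"
  shows "0 \<le> path_length K l g"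
proof -
  let ?x = "g 0"
  let ?S = "{(\<Sum>i<k. flat_dist K l (p i) (p (Suc i))) | p k.
      p 0 = ?x \<and> p k = ?x \<and> (\<forall>i<k. \<exists>\<sigma>\<in>K. p i \<in> bary_simplex \<sigma> \<and> p (Suc i) \<in> bary_simplex \<sigma>)}"
  have "0 \<in> ?S" by (intro CollectI exI[of _ "\<lambda>_. ?x"] exI[of _ 0]) auto
  then have "0 \<le> Inf ?S" using chain_dist_nonneg_sums by (intro cInf_greatest) auto
  then have "0 \<le> chain_dist K l (g 0) (g 1)"
    using assms(1) by (simp add: chain_dist_def pathstart_def pathfinish_def)
  moreover have "chain_dist K l (g 0) (g 1) \<in> partition_sums K l g"
    unfolding partition_sums_def by (intro CollectI exI[of _ real] exI[of _ 1]) auto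
  ultimately show ?thesis
    using assms(2) unfolding path_length_def rectifiable_in_def by (meson cSup_upper order_trans)
qed

end

text \<open>The suprema are unrolled: the bound is proved for every metric on every complex whose
  fundamental group is not free, with the area multiplied out.\<close>

theorem theorem1p2:
  fixes K :: "nat set set" and l :: "nat set \<Rightarrow> real" and a :: "nat \<Rightarrow> real"
  assumes "simplicial_2complex K"
    and "connected (realization K)"
    and "a \<in> realization K"
    and "\<not> free_group (pi1 (realization K) a)"
    and "pf_metric K l"
  shows "(systole K l)^2 \<le> 16 / pi * area K l"
proof (rule ccontr)
  assume "\<not> ?thesis"
  then have big: "16 / pi * area K l < (systole K l)\<^sup>2" by simp
  interpret flat_complex K l using assms by unfold_locales
  \<comment> \<open>This amounts to pi being at most 3.2.\<close>
  have "5 \<le> 16 / pi" using pi_approx(2) pi_gt_zero by (simp add: field_simps)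
  then have area: "5 * area K l \<le> 16 / pi * area K l" using area_nonneg by (rule mult_right_mono)
  let ?L = "{path_length K l g | g. path g \<and> path_image g \<subseteq> realization K \<and>
      pathfinish g = pathstart g \<and> rectifiable_in K l g \<and>
      \<not> homotopic_loops (realization K) g (\<lambda>_. pathstart g)}"
  show False
  proof (cases "?L = {}")
    case True
    \<comment> \<open>Without noncontractible loops the systole is the unspecified infimum of the
      empty set. In this case every \<open>s\<close> is admissible, and this one satisfies the
      strict area inequality.\<close>
    have "5 * area K l < (5 * area K l + 1)\<^sup>2"
      using area_nonneg by (simp add: power2_eq_square algebra_simps add_pos_nonneg)
    then have "free_group (pi1 (realization K) a)"
      using True area_nonneg assms(3) by (intro free_pi1_of_long_systole[where s = "5 * area K l + 1"]) auto
    then show False using assms(4) by blast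
  next
    case False
    have nonneg: "0 \<le> x" if "x \<in> ?L" for x using that path_length_loop_nonneg by auto
    have sys: "systole K l = Inf ?L" by (simp add: systole_def)
    have "0 \<le> systole K l" unfolding sys using False nonneg by (intro cInf_greatest) auto
    moreover have "systole K l \<noteq> 0" using big area area_nonneg by auto
    ultimately have s: "0 < systole K l" by simp
    have "homotopic_loops (realization K) g (\<lambda>_. pathstart g)"
      if "path g" "path_image g \<subseteq> realization K" "pathfinish g = pathstart g" "rectifiable_in K l g"
        "path_length K l g < systole K l" for g
    proof (rule ccontr)
      assume "\<not> ?thesis"
      then have "path_length K l g \<in> ?L" using that by blast
      moreover have "bdd_below ?L" using nonneg by (intro bdd_belowI[of _ 0])
      ultimately have "systole K l \<le> path_length K l g" unfolding sys by (rule cInf_lower)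
      then show False using that(5) by simp
    qed
    then have "free_group (pi1 (realization K) a)"
      using s area big assms(3) by (intro free_pi1_of_long_systole[where s = "systole K l"]) auto
    then show False using assms(4) by blast
  qed
qed

end
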